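(* Let $d\ge c\ge 2$ be integers with $d\neq2$, and fix $\varepsilon>0$. Let $\mathbf{I}_n$ be the edge-signed primal graph of a uniformly random signing of a uniformly random $n$-lift of $K_{d,c}$. Regard $\mathbf{I}_n$ as a 2XOR-SAT instance; it is $\kappa$-regular with $\kappa=(c-1)d$, and has $cn$ variables and $\binom c2 dn$ constraints. Then $$\Pr\Big[\mathrm{EIG}(\mathbf{I}_n)\ge\frac{(1+\rho_1)^2}{2\kappa}+\varepsilon\Big]=o_{n\to\infty}(1),\qquad \rho_1=\sqrt{c-1}\sqrt{d-1}.$$ Moreover, let $c=3$ and view $\mathbf{I}_n$ as a random $d$-regular NAE-3SAT instance on $3n$ variables, with eigenvalue bound $\mathrm{EIG}_{\mathrm{NAE}}=\tfrac32\,\mathrm{EIG}(\mathbf{I}_n)$. Then $$\Pr\Big[\mathrm{EIG}_{\mathrm{NAE}}\ge \frac98-\frac38\cdot\frac{(\sqrt{d-1}-\sqrt2)^2}{d}+\varepsilon\Big]=o_{n\to\infty}(1).$$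
   Context: $K_{d,c}$ is the complete bipartite graph with a part of $d$ vertices of degree $c$ ("constraints") and a part of $c$ vertices of degree $d$ ("variables"). An $n$-lift of a graph $(V,E)$ has vertex set $V\times[n]$ and, for each edge $\{u,v\}$, a perfect matching between $\{u\}\times[n]$ and $\{v\}\times[n]$. In a uniformly random $n$-lift these matchings are independent and uniform. A random signing labels each edge independently and uniformly with $\pm1$. Primal graph: for an edge-signed $(c,d)$-biregular graph with signs $\xi_{ai}$ on edges $\{a,i\}$, the primal graph is the edge-signed multigraph on the variables. It has an edge $\{i,j\}$ with sign $\xi_{ai}\xi_{aj}$ for each constraint $a$ and each pair of distinct neighbours $i,j$ of $a$. As a 2XOR-SAT instance, an edge $\{i,j\}$ with sign $\xi$ is the constraint $x_ix_j=-\xi$. For a 2XOR-SAT instance $I$ with $N$ variables and $m$ constraints, let $L_I=D_I-A_I$ be its Laplacian. Here $A_I[i,j]$ is the sum of the signs of edges between $i$ and $j$, and $D_I$ is the diagonal degree matrix. The eigenvalue bound is $\mathrm{EIG}(I)=\frac{N}{4m}\lambda_{\max}(L_I)$; it upper-bounds the maximum fraction of satisfiable constraints. For the primal graph above, $\mathrm{EIG}(I)=\frac1{2\kappa}\lambda_{\max}(L_I)$. For $c=3$, an assignment satisfying a $\beta$ fraction of the NAE-3SAT constraints (on the signed literals $\xi_{ai}x_i$) satisfies a $\tfrac23\beta$ fraction of the 2XOR constraints. This is why the NAE-3SAT eigenvalue bound is $\tfrac32\,\mathrm{EIG}$. *)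

theory Defs
  imports
    "HOL-Probability.Probability"
    "HOL-Library.Landau_Symbols"
    "Jordan_Normal_Form.Char_Poly"
begin

text \<open>
  Bipartite constraint--variable graphs; an edge is a pair (constraint, variable).
  The variables are kept as a list (without repetitions) only to fix the order of the rows and
  columns of the matrices below; eigenvalues do not depend on this order.
\<close>

record ('a, 'v) bigraph =
  bg_constraints :: "'a set"
  bg_variables :: "'v list"
  bg_edges :: "('a \<times> 'v) set"

definition nbrs :: "('a, 'v) bigraph \<Rightarrow> 'a \<Rightarrow> 'v set" where
  "nbrs G a = {i. (a, i) \<in> bg_edges G}"

definition biregular :: "nat \<Rightarrow> nat \<Rightarrow> ('a, 'v) bigraph \<Rightarrow> bool" where
  "biregular c d G \<longleftrightarrow>
     finite (bg_constraints G) \<and> distinct (bg_variables G) \<and>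
     bg_edges G \<subseteq> bg_constraints G \<times> set (bg_variables G) \<and>
     (\<forall>a\<in>bg_constraints G. card (nbrs G a) = c) \<and>
     (\<forall>i\<in>set (bg_variables G). card {a. (a, i) \<in> bg_edges G} = d)"

definition complete_bigraph :: "nat \<Rightarrow> nat \<Rightarrow> (nat, nat) bigraph" where
  "complete_bigraph d c =
     \<lparr>bg_constraints = {..<d}, bg_variables = [0..<c], bg_edges = {..<d} \<times> {..<c}\<rparr>"

text \<open>
  The perfect matching that an n-lift puts over the base edge \<open>(a, i)\<close> is given by a permutation
  \<open>\<pi> (a, i)\<close> of \<open>{..<n}\<close>: it joins \<open>(a, k)\<close> to \<open>(i, \<pi> (a, i) k)\<close>.
\<close>

definition nlift ::
  "nat \<Rightarrow> ('a, 'v) bigraph \<Rightarrow> ('a \<times> 'v \<Rightarrow> nat \<Rightarrow> nat) \<Rightarrow> ('a \<times> nat, 'v \<times> nat) bigraph" where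
  "nlift n G \<pi> =
     \<lparr>bg_constraints = bg_constraints G \<times> {..<n},
      bg_variables = List.product (bg_variables G) [0..<n],
      bg_edges = {((a, k), (i, \<pi> (a, i) k)) | a i k. (a, i) \<in> bg_edges G \<and> k < n}\<rparr>"

definition random_lift :: "nat \<Rightarrow> ('a, 'v) bigraph \<Rightarrow> ('a \<times> nat, 'v \<times> nat) bigraph pmf" where
  "random_lift n G =
     map_pmf (nlift n G)
       (Pi_pmf (bg_edges G) id (\<lambda>_. pmf_of_set {p. p permutes {..<n}}))"

definition random_signing :: "('a, 'v) bigraph \<Rightarrow> ('a \<times> 'v \<Rightarrow> real) pmf" where
  "random_signing G = Pi_pmf (bg_edges G) 0 (\<lambda>_. pmf_of_set {-1, 1})"

type_synonym ('a, 'v) signed_bigraph = "('a, 'v) bigraph \<times> ('a \<times> 'v \<Rightarrow> real)"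

definition random_signed_lift ::
  "nat \<Rightarrow> ('a, 'v) bigraph \<Rightarrow> ('a \<times> nat, 'v \<times> nat) signed_bigraph pmf" where
  "random_signed_lift n G =
     bind_pmf (random_lift n G) (\<lambda>H. map_pmf (\<lambda>\<xi>. (H, \<xi>)) (random_signing H))"

text \<open>
  A 2XOR-SAT instance, i.e. an edge-signed multigraph without loops: the entry \<open>({i, j}, \<xi>)\<close> stands
  for the constraint \<open>x i * x j = - \<xi>\<close> on assignments \<open>x\<close> with values in \<open>{-1, 1}\<close>.
\<close>

record 'v xor_instance =
  xor_variables :: "'v list"
  xor_constraints :: "('v set \<times> real) multiset"

definition wf_xor_instance :: "'v xor_instance \<Rightarrow> bool" where
  "wf_xor_instance I \<longleftrightarrow>
     distinct (xor_variables I) \<and>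
     (\<forall>(e, s)\<in>#xor_constraints I. e \<subseteq> set (xor_variables I) \<and> card e = 2 \<and> s \<in> {-1, 1})"

definition xor_degree :: "'v xor_instance \<Rightarrow> 'v \<Rightarrow> nat" where
  "xor_degree I i = size {#(e, s) \<in># xor_constraints I. i \<in> e#}"

definition xor_adj :: "'v xor_instance \<Rightarrow> 'v \<Rightarrow> 'v \<Rightarrow> real" where
  "xor_adj I i j = (\<Sum>(e, s)\<in>#{#(e, s) \<in># xor_constraints I. e = {i, j}#}. s)"

definition laplacian :: "'v xor_instance \<Rightarrow> real mat" where
  "laplacian I =
     (let vs = xor_variables I; N = length vs in
      mat N N (\<lambda>(p, q). if p = q then real (xor_degree I (vs ! p)) else 0)
      - mat N N (\<lambda>(p, q). xor_adj I (vs ! p) (vs ! q)))"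

definition lambda_max :: "real mat \<Rightarrow> real" where
  "lambda_max M = Max {l. eigenvalue M l}"

definition EIG :: "'v xor_instance \<Rightarrow> real" where
  "EIG I =
     real (length (xor_variables I)) / (4 * real (size (xor_constraints I)))
     * lambda_max (laplacian I)"

text \<open>
  One edge for each constraint \<open>a\<close> and each 2-element set \<open>e = {i, j}\<close> of neighbours of \<open>a\<close>; the
  product is \<open>\<xi> (a, i) * \<xi> (a, j)\<close>.
\<close>

definition primal :: "('a, 'v) signed_bigraph \<Rightarrow> 'v xor_instance" where
  "primal S = (case S of (G, \<xi>) \<Rightarrow>
     \<lparr>xor_variables = bg_variables G,
      xor_constraints =
        image_mset (\<lambda>(a, e). (e, \<Prod>i\<in>e. \<xi> (a, i)))
          (mset_set {(a, e). a \<in> bg_constraints G \<and> e \<subseteq> nbrs G a \<and> card e = 2})\<rparr>)"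

text \<open>
  A signed graph whose constraints have degree 3 is a NAE-3SAT instance: constraint \<open>a\<close> acts on the
  literals \<open>\<xi> (a, i) * x i\<close>. An assignment satisfying a fraction \<open>\<beta>\<close> of its constraints satisfies a
  fraction \<open>2/3 * \<beta>\<close> of the constraints of the primal graph, whence the factor \<open>3/2\<close>.
\<close>

definition EIG_NAE :: "('a, 'v) signed_bigraph \<Rightarrow> real" where
  "EIG_NAE S = 3 / 2 * EIG (primal S)"

end

theory Submission
  imports Defs "HOL-Real_Asymp.Real_Asymp" "Jordan_Normal_Form.Spectral_Radius"
begin

text \<open>
  With \<open>B\<close> the signed constraint--variable matrix, the Laplacian is \<open>c * d - B\<^sup>T * B\<close>, so the claim is
  a lower bound on the smallest eigenvalue \<open>\<mu>\<close> of \<open>B\<^sup>T * B\<close>. On an eigenfunction, the signed sums over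
  nonbacktracking walks of length \<open>2 * k\<close> act by a Chebyshev-like polynomial in \<open>\<mu>\<close>, which grows
  like \<open>(s * \<rho>) ^ k\<close> with \<open>s > 1\<close> when \<open>\<mu>\<close> is too small. Hence the Frobenius norm of the matrix of
  these walk sums would be large. Averaged over the signs alone, its square counts pairs of
  nonbacktracking walks with common ends in which every edge has even multiplicity.

  These are counted in a fixed graph that is sparse: a set \<open>F\<close> of at most \<open>T\<close> edges spans at least
  \<open>card F - card F div (4 * r)\<close> vertices. At most half of the steps of such a closed walk use new
  edges and contribute a factor \<open>\<rho>\<close> each; the remaining ones are cut into few stretches of length at
  most \<open>r\<close>, each determined up to polynomially many choices, since short edge sets contain at most
  one cycle. A union bound shows that a random lift is sparse with high probability.
\<close>

subsection \<open>Nonbacktracking walks in sparse graphs\<close>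


text \<open>The lengths are dictated by competing costs. Since \<open>s > 1\<close> may be
  arbitrarily close to 1, \<open>s ^ (2 * k)\<close> beats the factor \<open>n\<close> coming from
  the start vertices only if the walks are much longer than \<open>ln n\<close>. At that length the
  edges seen by a walk may contain many cycles, so sparsity cannot ask for a bounded excess; it
  allows one proportional to the number of edges, with ratio \<open>1 / (4 * r)\<close>. The 4 makes
  room for three segments of length \<open>r\<close>, as the uniqueness argument for short walks
  needs. A closed walk then falls into O(T / r) pieces, each costing a polynomial in
  \<open>T\<close>, and this is \<open>exp (o T)\<close> only if \<open>r\<close> outgrows
  \<open>ln T\<close>. The union bound over dense edge sets pulls the other way: a power of
  \<open>T\<close> with exponent of order \<open>r\<close> must stay below \<open>n\<close>. Taking
  \<open>T\<close> of order \<open>(ln n)^2\<close> and \<open>r\<close> of order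
  \<open>sqrt (ln n)\<close> meets all demands. Such long walks make a second moment sufficient:
  replacing an eigenvalue by the Frobenius norm loses only a factor of order \<open>n\<close>, so no
  high trace power of the walk matrix is taken.\<close>

fun edges_of :: "'x list \<Rightarrow> 'x set set" where
  "edges_of (x # y # zs) = insert {x, y} (edges_of (y # zs))"
| "edges_of _ = {}"

fun nonback :: "'x list \<Rightarrow> bool" where
  "nonback (x # y # z # zs) \<longleftrightarrow> x \<noteq> z \<and> nonback (y # z # zs)"
| "nonback _ \<longleftrightarrow> True"

lemma edges_of_append:
  "xs \<noteq> [] \<Longrightarrow> edges_of (xs @ ys) = edges_of xs \<union> edges_of (last xs # ys)"
  by (induction xs rule: edges_of.induct) (auto simp: neq_Nil_conv)

lemma edges_of_snoc: "xs \<noteq> [] \<Longrightarrow> edges_of (xs @ [y]) = insert {last xs, y} (edges_of xs)"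
  by (simp add: edges_of_append)

lemma edges_of_conv_nth: "edges_of w = {{w ! i, w ! Suc i} | i. Suc i < length w}"
proof (induction w rule: edges_of.induct)
  case (1 x y zs)
  have "{{(x # y # zs) ! i, (x # y # zs) ! Suc i} | i. Suc i < length (x # y # zs)} =
        insert {x, y} {{(y # zs) ! i, (y # zs) ! Suc i} | i. Suc i < length (y # zs)}"
    (is "?A = ?B")
  proof (rule Set.set_eqI)
    fix e show "e \<in> ?A \<longleftrightarrow> e \<in> ?B"
    proof
      assume "e \<in> ?A"
      then obtain i where i: "e = {(x # y # zs) ! i, (x # y # zs) ! Suc i}" "Suc i < length (x # y # zs)"
        by blast
      show "e \<in> ?B" using i by (cases i) auto
    next
      assume e: "e \<in> ?B"
      then consider "e = {x, y}" | i where "e = {(y # zs) ! i, (y # zs) ! Suc i}" "Suc i < length (y # zs)"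
        by blast
      then show "e \<in> ?A"
      proof cases
        case 1 then show ?thesis by (intro CollectI exI[of _ 0]) auto
      next
        case (2 i) then show ?thesis by (intro CollectI exI[of _ "Suc i"]) auto
      qed
    qed
  qed
  then show ?case using 1 by simp
qed auto

lemma nonback_conv_nth: "nonback w \<longleftrightarrow> (\<forall>i. Suc (Suc i) < length w \<longrightarrow> w ! i \<noteq> w ! Suc (Suc i))"
proof (induction w rule: nonback.induct)
  case (1 x y z zs)
  have "(\<forall>i. Suc (Suc i) < length (x # y # z # zs) \<longrightarrow> (x # y # z # zs) ! i \<noteq> (x # y # z # zs) ! Suc (Suc i))
    \<longleftrightarrow> x \<noteq> z \<and> (\<forall>i. Suc (Suc i) < length (y # z # zs) \<longrightarrow> (y # z # zs) ! i \<noteq> (y # z # zs) ! Suc (Suc i))"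
    (is "?l \<longleftrightarrow> ?r")
  proof
    assume l: ?l
    show ?r using l[rule_format, of 0] l[rule_format, of "Suc _"] by auto
  next
    assume r: ?r
    show ?l
    proof (intro allI impI)
      fix i assume "Suc (Suc i) < length (x # y # z # zs)"
      then show "(x # y # z # zs) ! i \<noteq> (x # y # z # zs) ! Suc (Suc i)"
        using r by (cases i) auto
    qed
  qed
  then show ?case using 1 by simp
qed auto

lemma finite_edges_of [simp]: "finite (edges_of w)"
  by (induction w rule: edges_of.induct) auto

lemma Union_edges_of_subset: "\<Union> (edges_of w) \<subseteq> set w"
  by (induction w rule: edges_of.induct) auto

lemma Union_edges_of: "Suc 0 < length w \<Longrightarrow> \<Union> (edges_of w) = set w"
proof (induction w rule: edges_of.induct)
  case (1 x y zs) then show ?case by (cases zs) auto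
qed auto

definition deg_in :: "'x set set \<Rightarrow> 'x \<Rightarrow> nat" where
  "deg_in F x = card {e \<in> F. x \<in> e}"

lemma handshake:
  assumes "finite F" "\<And>e. e \<in> F \<Longrightarrow> card e = 2"
  shows "(\<Sum>x\<in>\<Union>F. deg_in F x) = 2 * card F"
proof -
  have fin: "finite (\<Union>F)" using assms by (metis card.infinite finite_Union zero_neq_numeral)
  have "(\<Sum>x\<in>\<Union>F. deg_in F x) = (\<Sum>x\<in>\<Union>F. \<Sum>e\<in>F. if x \<in> e then 1 else 0)"
    unfolding deg_in_def using assms(1) by (intro sum.cong) (auto simp: sum.If_cases Int_def)
  also have "\<dots> = (\<Sum>e\<in>F. \<Sum>x\<in>\<Union>F. if x \<in> e then 1 else 0)" by (rule sum.swap)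
  also have "\<dots> = (\<Sum>e\<in>F. card e)"
  proof (intro sum.cong refl)
    fix e assume "e \<in> F"
    then have "\<Union>F \<inter> {x. x \<in> e} = e" by auto
    then show "(\<Sum>x\<in>\<Union>F. if x \<in> e then 1 else 0) = card e" using fin by (simp add: sum.If_cases)
  qed
  also have "\<dots> = 2 * card F" using assms by simp
  finally show ?thesis .
qed

text \<open>The degrees sum to \<open>2 * card F\<close>, at most twice the number of vertices, so
  minimum degree 2 leaves no room for a larger degree anywhere.\<close>

lemma two_regular:
  assumes "finite F" "\<And>e. e \<in> F \<Longrightarrow> card e = 2"
    and "card F \<le> card (\<Union>F)" and "\<And>x. x \<in> \<Union>F \<Longrightarrow> deg_in F x \<ge> 2" and "x \<in> \<Union>F"
  shows "deg_in F x = 2"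
proof (rule ccontr)
  assume "deg_in F x \<noteq> 2"
  then have x: "2 < deg_in F x" using assms(4,5) by force
  have fin: "finite (\<Union>F)" using assms by (metis card.infinite finite_Union zero_neq_numeral)
  have "(\<Sum>x\<in>\<Union>F. 2::nat) < (\<Sum>x\<in>\<Union>F. deg_in F x)"
    by (rule sum_strict_mono_ex1) (use fin assms x in auto)
  then show False using handshake[OF assms(1,2)] assms(3) by simp
qed

lemma deg_in_ge2I:
  assumes "finite F" "{x, y} \<in> F" "{x, z} \<in> F" "y \<noteq> z"
  shows "deg_in F x \<ge> 2"
proof -
  have "card {{x, y}, {x, z}} = 2" using assms(4) by (auto simp: card_insert_if doubleton_eq_iff)
  moreover have "card {{x, y}, {x, z}} \<le> card {e \<in> F. x \<in> e}"
    using assms by (intro card_mono) auto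
  ultimately show ?thesis by (simp add: deg_in_def)
qed

text \<open>At a vertex of degree 2 the edge of arrival \<open>{x, y}\<close> leaves a single edge
  to depart by; this makes nonbacktracking walks deterministic.\<close>

lemma deg_in_2_unique:
  assumes "finite F" "deg_in F x = 2" "{x, y} \<in> F" "{x, z} \<in> F" "{x, z'} \<in> F" "y \<noteq> z" "y \<noteq> z'"
  shows "z = z'"
proof (rule ccontr)
  assume "z \<noteq> z'"
  then have "card {{x, y}, {x, z}, {x, z'}} = 3" using assms(6,7)
    by (auto simp: card_insert_if doubleton_eq_iff)
  moreover have "card {{x, y}, {x, z}, {x, z'}} \<le> card {e \<in> F. x \<in> e}"
    using assms by (intro card_mono) auto
  ultimately show False using assms(2) by (simp add: deg_in_def)
qed

definition nbw :: "'x set set \<Rightarrow> nat \<Rightarrow> 'x \<Rightarrow> 'x list set" where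
  "nbw E j u = {w. length w = Suc j \<and> hd w = u \<and> edges_of w \<subseteq> E \<and> nonback w}"

locale sgraph =
  fixes E :: "'x set set"
  assumes fin: "finite E" and card2: "e \<in> E \<Longrightarrow> card e = 2"
begin

lemma finite_verts: "finite (\<Union>E)"
  using fin card2 by (metis card.infinite finite_Union zero_neq_numeral)

lemma finite_nbw: "finite (nbw E j u)"
proof (rule finite_subset)
  show "nbw E j u \<subseteq> {w. set w \<subseteq> insert u (\<Union>E) \<and> length w = Suc j}"
  proof
    fix w assume w: "w \<in> nbw E j u"
    show "w \<in> {w. set w \<subseteq> insert u (\<Union>E) \<and> length w = Suc j}"
    proof (cases "Suc 0 < length w")
      case True
      then show ?thesis using w Union_edges_of[OF True] by (auto simp: nbw_def)
    next
      case False
      then show ?thesis using w by (cases w) (auto simp: nbw_def)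
    qed
  qed
  show "finite {w. set w \<subseteq> insert u (\<Union>E) \<and> length w = Suc j}"
    using finite_verts by (intro finite_lists_length_eq) auto
qed

text \<open>
  Two distinct walks with the same ends split at \<open>a\<close> and merge for good at \<open>b\<close>. If two walks
  had the same \<open>a\<close> and \<open>b\<close> relative to a reference walk, then the three parts between \<open>a\<close> and \<open>b\<close>
  would span a graph with all degrees at least 2 and, by sparsity, exactly 2, in which a
  nonbacktracking walk is determined by its first step.
\<close>

lemma card_nbw_between:
  assumes sparse: "\<And>F. F \<subseteq> E \<Longrightarrow> card F < 4 * r \<Longrightarrow> card F \<le> card (\<Union>F)"
    and "j \<le> r" "0 < r"
  shows "card {w \<in> nbw E j u. last w = v} \<le> (Suc r)\<^sup>2 + 1"
proof (cases "{w \<in> nbw E j u. last w = v} = {}")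
  case False
  define W where "W = {w \<in> nbw E j u. last w = v}"
  obtain w where w: "w \<in> W" using False by (auto simp: W_def)
  have len: "length x = Suc j" if "x \<in> W" for x using that by (auto simp: W_def nbw_def)
  have ed: "{x ! i, x ! Suc i} \<in> E" if "x \<in> W" "i < j" for x i
  proof -
    have "{x ! i, x ! Suc i} \<in> edges_of x" using that len[OF that(1)] by (auto simp: edges_of_conv_nth)
    then show ?thesis using that(1) by (auto simp: W_def nbw_def)
  qed
  have nb: "x ! i \<noteq> x ! Suc (Suc i)" if "x \<in> W" "Suc i < j" for x i
  proof -
    have "nonback x" using that(1) by (simp add: W_def nbw_def)
    then show ?thesis using that len[OF that(1)] by (simp add: nonback_conv_nth)
  qed
  have first: "x ! 0 = u" if "x \<in> W" for x
    using that len[OF that] unfolding W_def nbw_def by (cases x) auto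
  have lst: "x ! j = v" if "x \<in> W" for x
    using that len[OF that] last_conv_nth[of x] by (cases "x = []") (auto simp: W_def)
  \<comment> \<open>\<open>a\<close> is the last index before the first disagreement of
    \<open>x\<close> with \<open>w\<close>, and \<open>b\<close> the first index after the last one;
    the two walks may meet again in between.\<close>
  define P where "P x a b \<longleftrightarrow> a < b \<and> b \<le> j \<and> (\<forall>i\<le>a. x ! i = w ! i) \<and> (\<forall>i. b \<le> i \<and> i \<le> j \<longrightarrow> x ! i = w ! i)
     \<and> x ! Suc a \<noteq> w ! Suc a \<and> x ! (b - 1) \<noteq> w ! (b - 1)" for x a b
  have ex: "\<exists>a b. P x a b" if x: "x \<in> W" "x \<noteq> w" for x
  proof -
    define M where "M = {i. i \<le> j \<and> x ! i \<noteq> w ! i}"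
    have "M \<noteq> {}" using x len[OF x(1)] len[OF w] by (auto simp: M_def list_eq_iff_nth_eq less_Suc_eq_le)
    moreover have finM: "finite M" by (simp add: M_def)
    ultimately have mi: "Min M \<in> M" "Max M \<in> M" by auto
    have "Min M \<noteq> 0" using mi(1) first[OF x(1)] first[OF w] by (auto simp: M_def intro: ccontr)
    then obtain a where a: "Min M = Suc a" by (metis not0_implies_Suc)
    have "Max M \<noteq> j" using mi(2) lst[OF x(1)] lst[OF w] by (auto simp: M_def intro: ccontr)
    then have bj: "Suc (Max M) \<le> j" using mi(2) by (auto simp: M_def)
    have "P x a (Suc (Max M))" unfolding P_def
    proof (intro conjI allI impI)
      show "a < Suc (Max M)" using a Min_le[OF finM mi(2)] by simp
      show "x ! i = w ! i" if "i \<le> a" for i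
        using that a Min_le[OF finM, of i] bj mi by (force simp: M_def)
      show "x ! i = w ! i" if "Suc (Max M) \<le> i \<and> i \<le> j" for i
      proof -
        have "i \<notin> M" using that Max_ge[OF finM, of i] by auto
        then show ?thesis using that by (simp add: M_def)
      qed
    qed (use mi a bj in \<open>auto simp: M_def\<close>)
    then show ?thesis by blast
  qed
  have uniq: "x = y" if x: "x \<in> W" and y: "y \<in> W" and Px: "P x a b" and Py: "P y a b" for x y a b
  proof -
    define seg where "seg z = (\<lambda>i. {z ! i, z ! Suc i}) ` {a..<b}" for z :: "'x list"
    define F where "F = seg w \<union> seg x \<union> seg y"
    have ab: "a < b" "b \<le> j" using Px by (auto simp: P_def)
    have finF: "finite F" by (simp add: F_def seg_def)
    have FE: "F \<subseteq> E" unfolding F_def seg_def using ed[OF w] ed[OF x] ed[OF y] ab by auto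
    have segF: "{z ! i, z ! Suc i} \<in> F" "{z ! Suc i, z ! i} \<in> F" if "z \<in> {w, x, y}" "a \<le> i" "i < b" for z i
      using that by (auto simp: F_def seg_def insert_commute)
    have cs: "card (seg z) \<le> b - a" for z
      unfolding seg_def by (rule order_trans[OF card_image_le]) auto
    \<comment> \<open>Three segments of at most \<open>r\<close> edges each stay below
      \<open>4 * r\<close>, where \<open>sparse\<close> permits no more edges than vertices.\<close>
    have "card F \<le> 3 * (b - a)" unfolding F_def
      using card_Un_le[of "seg w \<union> seg x" "seg y"] card_Un_le[of "seg w" "seg x"] cs[of w] cs[of x] cs[of y]
      by linarith
    also have "\<dots> < 4 * r" using ab assms(2,3) by linarith
    finally have cF: "card F \<le> card (\<Union>F)" using sparse[OF FE] by simp
    have wa: "z ! a = w ! a" "z ! b = w ! b" if "z \<in> {w, x, y}" for z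
      using that Px Py ab by (auto simp: P_def)
    have deg_end: "deg_in F (w ! a) \<ge> 2" "deg_in F (w ! b) \<ge> 2"
    proof -
      have "{w ! a, w ! Suc a} \<in> F" "{w ! a, x ! Suc a} \<in> F"
        using segF(1)[of w a] segF(1)[of x a] ab wa(1)[of x] by auto
      then show "deg_in F (w ! a) \<ge> 2" using Px by (intro deg_in_ge2I[OF finF, of _ "w ! Suc a" "x ! Suc a"]) (auto simp: P_def)
      have "{w ! b, w ! (b - 1)} \<in> F" "{w ! b, x ! (b - 1)} \<in> F"
        using segF(2)[of w "b - 1"] segF(2)[of x "b - 1"] ab wa(2)[of x] by auto
      then show "deg_in F (w ! b) \<ge> 2" using Px by (intro deg_in_ge2I[OF finF, of _ "w ! (b - 1)" "x ! (b - 1)"]) (auto simp: P_def)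
    qed
    have deg_z: "deg_in F (z ! i) \<ge> 2" if "z \<in> {w, x, y}" "a \<le> i" "i \<le> b" for z i
    proof (cases "i = a \<or> i = b")
      case True then show ?thesis using deg_end wa[OF that(1)] by auto
    next
      case False
      then have "a < i" using that by auto
      then obtain k where k: "i = Suc k" "a \<le> k" by (cases i) auto
      have "z \<in> W" using that x y w by auto
      then have "z ! k \<noteq> z ! Suc (Suc k)" using nb[of z k] False that k ab by auto
      then show ?thesis unfolding k(1) using segF(2)[OF that(1), of k] segF(1)[OF that(1), of "Suc k"] that k False
        by (intro deg_in_ge2I[OF finF, of _ "z ! k" "z ! Suc (Suc k)"]) auto
    qed
    have "deg_in F p \<ge> 2" if "p \<in> \<Union>F" for p
    proof -
      have "\<exists>z\<in>{w, x, y}. \<exists>i\<in>{a..<b}. p = z ! i \<or> p = z ! Suc i"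
        using that unfolding F_def seg_def by blast
      then obtain z i where zi: "z \<in> {w, x, y}" "i \<in> {a..<b}" "p = z ! i \<or> p = z ! Suc i" by blast
      show ?thesis using deg_z[OF zi(1), of i] deg_z[OF zi(1), of "Suc i"] zi(2,3) by auto
    qed
    note reg = two_regular[OF finF card2[OF subsetD[OF FE]] cF this]
    have deg2: "deg_in F (x ! i) = 2" if "a \<le> i" "i < b" for i
      using that segF(1)[of x i] by (intro reg) auto
    \<comment> \<open>At \<open>a\<close> both \<open>x\<close> and \<open>y\<close> leave by an
      edge other than that of \<open>w\<close>, and degree 2 offers only one. From then on the edge
      of arrival determines the next edge.\<close>
    have step: "x ! i = y ! i \<and> x ! Suc i = y ! Suc i" if "a \<le> i" "i < b" for i
      using that
    proof (induction i rule: dec_induct)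
      case base
      have xa: "x ! a = w ! a" "y ! a = w ! a" using wa(1)[of x] wa(1)[of y] by simp_all
      have "deg_in F (w ! a) = 2" using deg2[of a] ab xa by simp
      moreover have "{w ! a, w ! Suc a} \<in> F" "{w ! a, x ! Suc a} \<in> F" "{w ! a, y ! Suc a} \<in> F"
        using segF(1)[of w a] segF(1)[of x a] segF(1)[of y a] ab xa by simp_all
      moreover have "w ! Suc a \<noteq> x ! Suc a" "w ! Suc a \<noteq> y ! Suc a"
        using Px Py unfolding P_def by metis+
      ultimately have "x ! Suc a = y ! Suc a" by (rule deg_in_2_unique[OF finF])
      then show ?case using xa by simp
    next
      case (step i)
      then have IH: "x ! i = y ! i" "x ! Suc i = y ! Suc i" by auto
      have "deg_in F (x ! Suc i) = 2" using deg2[of "Suc i"] step by simp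
      moreover have "{x ! Suc i, x ! i} \<in> F" "{x ! Suc i, x ! Suc (Suc i)} \<in> F"
          "{x ! Suc i, y ! Suc (Suc i)} \<in> F"
        using segF(2)[of x i] segF(1)[of x "Suc i"] segF(1)[of y "Suc i"] step IH by simp_all
      moreover have "x ! i \<noteq> x ! Suc (Suc i)" "x ! i \<noteq> y ! Suc (Suc i)"
        using nb[OF x, of i] nb[OF y, of i] step IH ab by simp_all
      ultimately have "x ! Suc (Suc i) = y ! Suc (Suc i)" by (rule deg_in_2_unique[OF finF])
      then show ?case using IH by simp
    qed
    have "x ! i = y ! i" if "i < length x" for i
    proof -
      consider "i \<le> a" | "b \<le> i" | "a \<le> i" "i < b" by linarith
      then show ?thesis
        by cases (use Px Py step that len[OF x] in \<open>auto simp: P_def\<close>)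
    qed
    then show "x = y" using len[OF x] len[OF y] by (auto simp: list_eq_iff_nth_eq)
  qed
  define ch where "ch x = (SOME ab. P x (fst ab) (snd ab))" for x
  have ch: "P x (fst (ch x)) (snd (ch x))" if "x \<in> W - {w}" for x
    unfolding ch_def using ex[of x] that by (intro someI_ex[of "\<lambda>ab. P x (fst ab) (snd ab)"]) auto
  have "inj_on ch (W - {w})"
    by (rule inj_onI) (metis ch uniq DiffD1)
  moreover have "ch ` (W - {w}) \<subseteq> {..r} \<times> {..r}"
  proof
    fix ab assume "ab \<in> ch ` (W - {w})"
    then obtain x where x: "x \<in> W - {w}" "ab = ch x" by blast
    have "fst (ch x) < snd (ch x)" "snd (ch x) \<le> j" using ch[OF x(1)] unfolding P_def by blast+
    then show "ab \<in> {..r} \<times> {..r}" using assms(2) x(2) by (auto simp: mem_Times_iff)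
  qed
  ultimately have "card (W - {w}) \<le> card ({..r} \<times> {..r})"
    by (rule card_inj_on_le) simp
  then have "card (W - {w}) \<le> (Suc r)\<^sup>2" by (simp add: power2_eq_square)
  moreover have "finite W" unfolding W_def using finite_nbw by auto
  ultimately show ?thesis using w unfolding W_def[symmetric] by (simp add: card_Diff_singleton)
next
  case True then show ?thesis by (simp only: card.empty)
qed

end


section \<open>Walks composed of fresh and stale pieces\<close>

text \<open>
  The edges of a stale piece need not be old: ending at a visited vertex is enough for the count.
\<close>

definition extension :: "'x set set \<Rightarrow> 'x list \<Rightarrow> 'x list \<Rightarrow> bool" where
  "extension E xs ys \<longleftrightarrow> edges_of (last xs # ys) \<subseteq> E \<and> nonback (last xs # ys)"

definition fresh_piece :: "'x set set \<Rightarrow> 'x list \<Rightarrow> nat \<Rightarrow> 'x list set" where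
  "fresh_piece E xs j = {ys. length ys = j \<and> extension E xs ys \<and>
     card (edges_of (xs @ ys)) = card (edges_of xs) + j}"

definition stale_piece :: "'x set set \<Rightarrow> 'x list \<Rightarrow> nat \<Rightarrow> 'x list set" where
  "stale_piece E xs j = {ys. length ys = j \<and> extension E xs ys \<and> last (xs @ ys) \<in> set xs}"

text \<open>\<open>extension\<close> constrains a piece together with its start vertex but not the
  joint with the previous piece, so a walk may turn back at a joint. This accommodates the hinge,
  and it lets each piece be counted as a nonbacktracking walk from \<open>last xs\<close> regardless
  of the past.\<close>

primrec pieces :: "'x set set \<Rightarrow> nat \<Rightarrow> nat \<Rightarrow> 'x \<Rightarrow> nat \<Rightarrow> 'x list set" where
  "pieces E T r u 0 = {[u]}"
| "pieces E T r u (Suc p) = {xs @ ys | xs ys. xs \<in> pieces E T r u p \<and>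
     ys \<in> (\<Union>j\<in>{..T}. fresh_piece E xs j) \<union> (\<Union>j\<in>{..r}. stale_piece E xs j) \<and>
     length (xs @ ys) \<le> Suc T}"

lemma pieces_nonempty: "xs \<in> pieces E T r u p \<Longrightarrow> xs \<noteq> []"
  by (induction p arbitrary: xs) auto

lemma length_pieces: "xs \<in> pieces E T r u p \<Longrightarrow> length xs \<le> Suc T"
  by (induction p arbitrary: xs) auto

lemma pieces_SucI:
  "\<lbrakk>xs \<in> pieces E T r u p; length (xs @ ys) \<le> Suc T;
    ys \<in> fresh_piece E xs j \<and> j \<le> T \<or> ys \<in> stale_piece E xs j \<and> j \<le> r\<rbrakk>
    \<Longrightarrow> xs @ ys \<in> pieces E T r u (Suc p)"
  unfolding pieces.simps by blast

lemma pieces_Suc_freshI: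
  assumes "xs \<in> pieces E T r u p" "extension E xs ys"
    "card (edges_of (xs @ ys)) = card (edges_of xs) + length ys" "length (xs @ ys) \<le> Suc T"
  shows "xs @ ys \<in> pieces E T r u (Suc p)"
proof (rule pieces_SucI[OF assms(1,4)])
  have "length ys \<le> T" using pieces_nonempty[OF assms(1)] assms(4) by (cases xs) auto
  then show "ys \<in> fresh_piece E xs (length ys) \<and> length ys \<le> T \<or>
      ys \<in> stale_piece E xs (length ys) \<and> length ys \<le> r"
    using assms by (simp add: fresh_piece_def)
qed

lemma pieces_Suc_staleI:
  "\<lbrakk>xs \<in> pieces E T r u p; extension E xs ys; last (xs @ ys) \<in> set xs; length ys \<le> r;
    length (xs @ ys) \<le> Suc T\<rbrakk> \<Longrightarrow> xs @ ys \<in> pieces E T r u (Suc p)"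
  by (rule pieces_SucI[of _ _ _ _ _ _ _ "length ys"]) (auto simp: stale_piece_def)

text \<open>The empty list is a stale piece, so a decomposition can be padded to any larger number
  of pieces.\<close>

lemma pieces_mono:
  assumes "p \<le> q" shows "pieces E T r u p \<subseteq> pieces E T r u q"
proof -
  have "pieces E T r u p \<subseteq> pieces E T r u (Suc p)" for p
  proof
    fix xs assume xs: "xs \<in> pieces E T r u p"
    have "xs @ [] \<in> pieces E T r u (Suc p)"
      using pieces_nonempty[OF xs] length_pieces[OF xs]
      by (intro pieces_Suc_staleI[OF xs]) (auto simp: extension_def)
    then show "xs \<in> pieces E T r u (Suc p)" by simp
  qed
  from lift_Suc_mono_le[of "pieces E T r u", OF this assms] show ?thesis .
qed

lemma edges_of_append_mono: "edges_of xs \<subseteq> edges_of (xs @ ys)"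
  by (cases "xs = []") (auto simp: edges_of_append)

context sgraph begin

lemma extension_imp_nbw: "extension E xs ys \<Longrightarrow> last xs # ys \<in> nbw E (length ys) (last xs)"
  by (simp add: extension_def nbw_def)

lemma card_fresh_piece: "card (fresh_piece E xs j) \<le> card (nbw E j (last xs))"
  and finite_fresh_piece: "finite (fresh_piece E xs j)"
proof -
  have *: "(#) (last xs) ` fresh_piece E xs j \<subseteq> nbw E j (last xs)"
    by (auto simp: fresh_piece_def dest!: extension_imp_nbw)
  have inj: "inj_on ((#) (last xs)) (fresh_piece E xs j)" by (rule inj_onI) auto
  show "finite (fresh_piece E xs j)" by (rule finite_imageD[OF finite_subset[OF * finite_nbw] inj])
  show "card (fresh_piece E xs j) \<le> card (nbw E j (last xs))"
    using card_inj_on_le[OF inj * finite_nbw] .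
qed

text \<open>There are at most \<open>length xs\<close> choices for the visited end vertex, and then
  \<open>K\<close> choices for the walk to it.\<close>

lemma card_stale_piece:
  assumes K: "\<And>u v. card {w \<in> nbw E j u. last w = v} \<le> K" and "xs \<noteq> []"
  shows "card (stale_piece E xs j) \<le> length xs * K" and "finite (stale_piece E xs j)"
proof -
  let ?B = "\<Union>v\<in>set xs. {w \<in> nbw E j (last xs). last w = v}"
  have *: "(#) (last xs) ` stale_piece E xs j \<subseteq> ?B"
  proof
    fix w assume "w \<in> (#) (last xs) ` stale_piece E xs j"
    then obtain ys where ys: "w = last xs # ys" "ys \<in> stale_piece E xs j" by blast
    have "last w = last (xs @ ys)" using ys(1) assms(2) by (auto simp: last_append)
    then show "w \<in> ?B" using ys extension_imp_nbw[of xs ys] by (auto simp: stale_piece_def)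
  qed
  have finB: "finite ?B" using finite_nbw by auto
  have inj: "inj_on ((#) (last xs)) (stale_piece E xs j)" by (rule inj_onI) auto
  show "finite (stale_piece E xs j)" by (rule finite_imageD[OF finite_subset[OF * finB] inj])
  have "card (stale_piece E xs j) \<le> card ?B" using card_inj_on_le[OF inj * finB] .
  also have "\<dots> \<le> (\<Sum>v\<in>set xs. card {w \<in> nbw E j (last xs). last w = v})"
    by (rule card_UN_le) simp
  also have "\<dots> \<le> (\<Sum>v\<in>set xs. K)" by (intro sum_mono K)
  also have "\<dots> \<le> length xs * K" using card_length[of xs] by simp
  finally show "card (stale_piece E xs j) \<le> length xs * K" .
qed

text \<open>Weighting every distinct edge by \<open>1 / \<rho>\<close> makes the cost of a fresh
  piece independent of its length: at most \<open>C * \<rho> ^ j\<close> pieces of length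
  \<open>j\<close> each gain a weight \<open>(1 / \<rho>) ^ j\<close>. A stale piece never increases
  the weight and has few choices. Each further piece thus multiplies the total weight by at most the
  same polynomial factor.\<close>

lemma weight_pieces:
  fixes \<rho> C :: real and K :: nat
  assumes \<rho>: "1 \<le> \<rho>" and C: "\<And>j x. real (card (nbw E j x)) \<le> C * \<rho> ^ j"
    and K: "\<And>j u v. j \<le> r \<Longrightarrow> card {w \<in> nbw E j u. last w = v} \<le> K"
  shows "finite (pieces E T r u p) \<and> (\<Sum>xs\<in>pieces E T r u p. (1 / \<rho>) ^ card (edges_of xs))
     \<le> (real (Suc T) * C + real (Suc r * Suc T * K)) ^ p"
proof (induction p)
  case 0 then show ?case by simp
next
  case (Suc p)
  let ?P = "pieces E T r u p" and ?g = "\<lambda>xs. (1 / \<rho>) ^ card (edges_of xs)"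
  let ?Q = "real (Suc T) * C + real (Suc r * Suc T * K)"
  define X where "X xs = (\<Union>j\<in>{..T}. fresh_piece E xs j) \<union> (\<Union>j\<in>{..r}. stale_piece E xs j)" for xs
  have IH: "finite ?P" "(\<Sum>xs\<in>?P. ?g xs) \<le> ?Q ^ p" using Suc by auto
  have C0: "0 \<le> C" using order_trans[OF of_nat_0_le_iff C[of 0 u]] by simp
  have Q0: "0 \<le> ?Q" using C0 by simp
  have finX: "finite (X xs)" if "xs \<in> ?P" for xs
    unfolding X_def using finite_fresh_piece card_stale_piece(2)[OF K pieces_nonempty[OF that]] by auto
  let ?S = "SIGMA xs:?P. X xs"
  have finS: "finite ?S" using IH(1) finX by auto
  have sub: "pieces E T r u (Suc p) \<subseteq> (\<lambda>(xs, ys). xs @ ys) ` ?S"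
    unfolding pieces.simps X_def by blast
  have "(\<Sum>xs\<in>pieces E T r u (Suc p). ?g xs) \<le> (\<Sum>xs\<in>(\<lambda>(xs, ys). xs @ ys) ` ?S. ?g xs)"
    using \<rho> by (intro sum_mono2 finite_imageI finS sub) auto
  \<comment> \<open>Different cuts can produce the same walk, so this is only an inequality.\<close>
  also have "\<dots> \<le> (\<Sum>z\<in>?S. ?g (fst z @ snd z))"
    using \<rho> by (intro order_trans[OF sum_image_le[OF finS]]) (auto simp: case_prod_unfold o_def)
  also have "\<dots> = (\<Sum>xs\<in>?P. \<Sum>ys\<in>X xs. ?g (xs @ ys))"
    using IH(1) finX by (subst sum.Sigma) (auto simp: case_prod_unfold)
  also have "\<dots> \<le> (\<Sum>xs\<in>?P. ?g xs * ?Q)"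
  proof (rule sum_mono)
    fix xs assume xs: "xs \<in> ?P"
    note ne = pieces_nonempty[OF xs]
    have g_le: "?g (xs @ ys) \<le> ?g xs" for ys
      using \<rho> by (intro power_decreasing card_mono edges_of_append_mono) auto
    have "(\<Sum>ys\<in>X xs. ?g (xs @ ys)) \<le> (\<Sum>ys\<in>(\<Union>j\<in>{..T}. fresh_piece E xs j). ?g (xs @ ys))
        + (\<Sum>ys\<in>(\<Union>j\<in>{..r}. stale_piece E xs j). ?g (xs @ ys))"
    proof -
      let ?A = "\<Union>j\<in>{..T}. fresh_piece E xs j" and ?B = "\<Union>j\<in>{..r}. stale_piece E xs j"
      have "finite ?A" "finite ?B" using finX[OF xs] by (simp_all add: X_def)
      then have "(\<Sum>ys\<in>?A \<union> ?B. ?g (xs @ ys)) + (\<Sum>ys\<in>?A \<inter> ?B. ?g (xs @ ys))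
          = (\<Sum>ys\<in>?A. ?g (xs @ ys)) + (\<Sum>ys\<in>?B. ?g (xs @ ys))"
        by (rule sum.union_inter)
      moreover have "0 \<le> (\<Sum>ys\<in>?A \<inter> ?B. ?g (xs @ ys))" using \<rho> by (intro sum_nonneg) simp
      ultimately show ?thesis unfolding X_def by linarith
    qed
    also have "(\<Sum>ys\<in>(\<Union>j\<in>{..T}. fresh_piece E xs j). ?g (xs @ ys))
        = (\<Sum>j\<in>{..T}. \<Sum>ys\<in>fresh_piece E xs j. ?g (xs @ ys))"
      by (rule sum.UNION_disjoint) (simp_all add: finite_fresh_piece, auto simp: fresh_piece_def)
    also have "\<dots> \<le> (\<Sum>j\<in>{..T}. ?g xs * C)"
    proof (rule sum_mono)
      fix j
      have "(\<Sum>ys\<in>fresh_piece E xs j. ?g (xs @ ys)) = (\<Sum>ys\<in>fresh_piece E xs j. ?g xs * (1 / \<rho>) ^ j)"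
        by (rule sum.cong) (auto simp: fresh_piece_def power_add)
      also have "\<dots> = ?g xs * (1 / \<rho>) ^ j * real (card (fresh_piece E xs j))" by simp
      also have "\<dots> \<le> ?g xs * (1 / \<rho>) ^ j * (C * \<rho> ^ j)"
        using \<rho> card_fresh_piece[of xs j] C[of j "last xs"] by (intro mult_left_mono) auto
      also have "\<dots> = ?g xs * C" using \<rho> by (simp add: field_simps)
      finally show "(\<Sum>ys\<in>fresh_piece E xs j. ?g (xs @ ys)) \<le> ?g xs * C" .
    qed
    also have "(\<Sum>ys\<in>(\<Union>j\<in>{..r}. stale_piece E xs j). ?g (xs @ ys))
        = (\<Sum>j\<in>{..r}. \<Sum>ys\<in>stale_piece E xs j. ?g (xs @ ys))"
      using card_stale_piece(2)[OF K ne]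
      by (intro sum.UNION_disjoint) (simp_all, auto simp: stale_piece_def)
    also have "\<dots> \<le> (\<Sum>j\<in>{..r}. ?g xs * real (Suc T * K))"
    proof (rule sum_mono)
      fix j assume j: "j \<in> {..r}"
      have "(\<Sum>ys\<in>stale_piece E xs j. ?g (xs @ ys)) \<le> (\<Sum>ys\<in>stale_piece E xs j. ?g xs)"
        by (intro sum_mono g_le)
      also have "\<dots> = ?g xs * real (card (stale_piece E xs j))" by simp
      also have "\<dots> \<le> ?g xs * real (Suc T * K)"
      proof (intro mult_left_mono of_nat_mono)
        have "card (stale_piece E xs j) \<le> length xs * K" using card_stale_piece(1)[OF K ne] j by simp
        also have "\<dots> \<le> Suc T * K" using length_pieces[OF xs] by (rule mult_right_mono) simp
        finally show "card (stale_piece E xs j) \<le> Suc T * K" .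
      qed (use \<rho> in auto)
      finally show "(\<Sum>ys\<in>stale_piece E xs j. ?g (xs @ ys)) \<le> ?g xs * real (Suc T * K)" .
    qed
    finally show "(\<Sum>ys\<in>X xs. ?g (xs @ ys)) \<le> ?g xs * ?Q" by (simp add: algebra_simps)
  qed
  also have "\<dots> = (\<Sum>xs\<in>?P. ?g xs) * ?Q" by (simp only: sum_distrib_right)
  also have "\<dots> \<le> ?Q ^ p * ?Q" by (intro mult_right_mono IH Q0)
  finally show ?case using finite_subset[OF sub finite_imageI[OF finS]] by (simp only: power_Suc2)
qed

end


section \<open>Excess, and the decomposition of hikes into pieces\<close>

lemma Union_edge_in_set: "{x, y} \<in> edges_of w \<Longrightarrow> x \<in> set w \<and> y \<in> set w"
  using Union_edges_of_subset[of w] by auto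

text \<open>A step to a new vertex uses a new edge. In particular the subtraction in
  \<open>excess\<close> does not truncate.\<close>

lemma card_set_le_edges: "w \<noteq> [] \<Longrightarrow> card (set w) \<le> Suc (card (edges_of w))"
proof (induction w rule: rev_induct)
  case (snoc y xs)
  show ?case
  proof (cases "xs = []")
    case False
    have "y \<notin> set xs \<Longrightarrow> {last xs, y} \<notin> edges_of xs"
      using Union_edge_in_set[of "last xs" y xs] by auto
    then show ?thesis using snoc.IH[OF False] False
      by (auto simp: edges_of_snoc card_insert_if)
  qed simp
qed simp

text \<open>Number of steps along a new edge to an already visited vertex.\<close>

definition excess :: "'x list \<Rightarrow> nat" where
  "excess w = Suc (card (edges_of w)) - card (set w)"

lemma excess_snoc:
  assumes "xs \<noteq> []"
  shows "{last xs, y} \<in> edges_of xs \<Longrightarrow> excess (xs @ [y]) = excess xs"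
    and "{last xs, y} \<notin> edges_of xs \<Longrightarrow> y \<notin> set xs \<Longrightarrow> excess (xs @ [y]) = excess xs"
    and "{last xs, y} \<notin> edges_of xs \<Longrightarrow> y \<in> set xs \<Longrightarrow> excess (xs @ [y]) = Suc (excess xs)"
  using assms card_set_le_edges[OF assms] Union_edge_in_set[of "last xs" y xs]
  by (auto simp: excess_def edges_of_snoc insert_absorb Suc_diff_le)

lemma nonback_snoc:
  "nonback (zs @ [a]) \<Longrightarrow> zs \<noteq> [] \<Longrightarrow> last zs \<noteq> b \<Longrightarrow> nonback (zs @ [a, b])"
proof (induction zs rule: nonback.induct)
  case (1 x y z zs)
  then show ?case by (cases zs) auto
next
  case ("2_3" x y)
  then show ?case by simp
qed auto

lemma extension_snoc:
  assumes "extension E xs ys" "xs \<noteq> []" "{last (xs @ ys), y} \<in> E"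
    and "ys \<noteq> [] \<Longrightarrow> (xs @ ys) ! (length (xs @ ys) - 2) \<noteq> y"
  shows "extension E xs (ys @ [y])"
proof (cases ys rule: rev_cases)
  case Nil
  then show ?thesis using assms by (simp add: extension_def)
next
  case (snoc zs a)
  have "(xs @ ys) ! (length (xs @ ys) - 2) = last (last xs # zs)"
    using assms(2) snoc by (cases zs rule: rev_cases) (auto simp: nth_append last_conv_nth)
  then have "nonback ((last xs # zs) @ [a, y])"
    using assms(1,4) snoc by (intro nonback_snoc) (auto simp: extension_def)
  moreover have "edges_of ((last xs # ys) @ [y]) \<subseteq> E"
    using assms by (subst edges_of_snoc) (auto simp: extension_def snoc)
  ultimately show ?thesis using snoc by (simp add: extension_def)
qed

text \<open>
  Of the requirement that every edge is used at least twice, only \<open>2 * card (edges_of w) \<le> T\<close> matters.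
  The walk may turn back at time \<open>h\<close>, where the second walk of a pair begins, run in reverse.
\<close>

definition hikes :: "'x set set \<Rightarrow> nat \<Rightarrow> nat \<Rightarrow> 'x \<Rightarrow> 'x list set" where
  "hikes E T h u = {w. length w = Suc T \<and> hd w = u \<and> edges_of w \<subseteq> E \<and> 2 * card (edges_of w) \<le> T \<and>
     (\<forall>i. Suc (Suc i) < length w \<and> Suc i \<noteq> h \<longrightarrow> w ! i \<noteq> w ! Suc (Suc i))}"

declare pieces.simps(2) [simp del]

context sgraph begin

text \<open>
  Greedy decomposition: a stale piece is closed when it has length \<open>r\<close>, at the hinge, or when a
  new edge comes; a fresh piece is followed by a stale one only if it ended at the hinge or at an
  old vertex, which is charged to the excess.
\<close>

lemma decompose:
  assumes w: "length w = Suc T" "hd w = u" "edges_of w \<subseteq> E"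
    and nb: "\<And>i. Suc (Suc i) < length w \<Longrightarrow> Suc i \<noteq> h \<Longrightarrow> w ! i \<noteq> w ! Suc (Suc i)"
    and r: "0 < r"
  shows "w \<in> pieces E T r u (T div r + 2 * excess w + 4)"
proof -
  define pr where "pr t = take (Suc t) w" for t
  \<comment> \<open>Budget for extra pieces, in units of \<open>r\<close>: each unit of excess pays
    for two, and so does the hinge once it has been passed.\<close>
  define X where "X t = 2 * excess (pr t) + (if h < t then 2 else 0)" for t
  let ?P = "pieces E T r u"
  \<comment> \<open>The open piece \<open>ys\<close> is stale. In the accounting, a piece costs
    \<open>r\<close>; it is paid by the elapsed time if it runs to full length \<open>r\<close>, and
    from \<open>X\<close> otherwise.\<close>
  define S where "S t \<longleftrightarrow> (\<exists>p xs ys. pr t = xs @ ys \<and> xs \<in> ?P p \<and> extension E xs ys \<and> length ys \<le> r \<and>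
     edges_of (pr t) = edges_of xs \<and> w ! t \<in> set xs \<and> r * p + length ys \<le> t + r * X t)" for t
  \<comment> \<open>The open piece is fresh. The stale piece cut short by its first new edge may
    still be on credit, hence the extra \<open>+ r\<close>. If the current vertex was visited
    before, the excess has just grown: its two units repay this credit and pay for closing the fresh
    piece.\<close>
  define F where "F t \<longleftrightarrow> (\<exists>p xs ys. pr t = xs @ ys \<and> xs \<in> ?P p \<and> extension E xs ys \<and> ys \<noteq> [] \<and>
     card (edges_of (pr t)) = card (edges_of xs) + length ys \<and> r * p \<le> t + r * X t + r \<and>
     (w ! t \<in> set (take t w) \<longrightarrow> r * p + r \<le> t + r * X t))" for t
  have pr_ne: "pr t \<noteq> []" for t using w by (auto simp: pr_def)
  have pr_last: "last (pr t) = w ! t" if "t \<le> T" for t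
    using that w by (simp add: pr_def take_Suc_conv_app_nth)
  have pr_len: "length (pr t) = Suc t" if "t \<le> T" for t using that w by (simp add: pr_def)
  have pr_Suc: "pr (Suc t) = pr t @ [w ! Suc t]" if "Suc t \<le> T" for t
    using that w by (simp add: pr_def take_Suc_conv_app_nth)
  have pr_nth: "pr t ! i = w ! i" if "i \<le> t" for t i using that by (simp add: pr_def)
  have eSuc: "edges_of (pr (Suc t)) = insert {w ! t, w ! Suc t} (edges_of (pr t))" if "Suc t \<le> T" for t
    using that pr_ne by (simp add: pr_Suc edges_of_snoc pr_last)
  have eE: "{w ! t, w ! Suc t} \<in> E" if "Suc t \<le> T" for t
  proof -
    have "{w ! t, w ! Suc t} \<in> edges_of w"
      unfolding edges_of_conv_nth using that w(1) by (intro CollectI exI[of _ t]) auto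
    then show ?thesis using w(3) by blast
  qed
  have closeS: "\<exists>p. pr t \<in> ?P (Suc p) \<and> r * p \<le> t + r * X t" if "S t" "t \<le> T" for t
  proof -
    obtain p xs ys where s: "pr t = xs @ ys" "xs \<in> ?P p" "extension E xs ys" "length ys \<le> r"
      "w ! t \<in> set xs" "r * p + length ys \<le> t + r * X t" using \<open>S t\<close> by (auto simp: S_def)
    have "last (xs @ ys) \<in> set xs" using s(1,5) pr_last[OF that(2)] by simp
    then have "xs @ ys \<in> ?P (Suc p)"
      using s pr_len[OF that(2)] that(2) by (intro pieces_Suc_staleI) auto
    then show ?thesis using s by (intro exI[of _ p]) auto
  qed
  have main: "S t \<or> F t" if "t \<le> T" for t
    using that
  proof (induction t)
    case 0
    have "pr 0 = [u]" using w by (cases w) (auto simp: pr_def)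
    moreover have "w ! 0 = u" using w by (cases w) auto
    ultimately have "S 0" unfolding S_def
      by (intro exI[of _ 0] exI[of _ "[u]"] exI[of _ "[]"]) (auto simp: extension_def)
    then show ?case by simp
  next
    case (Suc t)
    then have T: "t \<le> T" "Suc t \<le> T" by auto
    let ?y = "w ! Suc t"
    have lst: "last (pr t) = w ! t" by (rule pr_last[OF T(1)])
    note exc = excess_snoc[OF pr_ne[of t], of ?y, unfolded lst, folded pr_Suc[OF T(2)]]
    have ext1: "extension E (pr t) [?y]" using eE[OF T(2)] lst by (simp add: extension_def)
    have prev: "{w ! t, w ! (t - 1)} \<in> edges_of (pr t)" if "0 < t"
      using that eSuc[of "t - 1"] T by (auto simp: insert_commute)
    have pen: "(xs @ ys) ! (length (xs @ ys) - 2) = w ! (t - 1)" if "pr t = xs @ ys" "0 < t" for xs ys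
      using that pr_len[OF T(1)] pr_nth[of "t - 1" t] by (metis Suc_1 diff_Suc_Suc diff_le_self)
    show ?case
    proof (cases "{w ! t, ?y} \<in> edges_of (pr t)")
      case False
      have Xle: "X t \<le> X (Suc t)"
        using exc(2,3)[OF False] by (cases "?y \<in> set (pr t)") (auto simp: X_def)
      then have X1: "r * X t \<le> r * X (Suc t)" by simp
      have X2: "r * X t + 2 * r \<le> r * X (Suc t)" if "?y \<in> set (pr t)"
      proof -
        have "X t + 2 \<le> X (Suc t)" using exc(3)[OF False that] by (auto simp: X_def)
        then have "r * (X t + 2) \<le> r * X (Suc t)" by (rule mult_le_mono2)
        then show ?thesis by (simp add: algebra_simps)
      qed
      have cSuc: "card (edges_of (pr (Suc t))) = Suc (card (edges_of (pr t)))"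
        using False by (simp add: eSuc[OF T(2)])
      have "F (Suc t)" using Suc.IH[OF T(1)]
      proof
        assume "S t"
        then obtain p where p: "pr t \<in> ?P (Suc p)" "r * p \<le> t + r * X t" using closeS[OF \<open>S t\<close> T(1)] by blast
        show ?thesis unfolding F_def
        proof (intro exI conjI impI)
          show "pr (Suc t) = pr t @ [?y]" by (rule pr_Suc[OF T(2)])
          show "pr t \<in> ?P (Suc p)" by (rule p)
          show "extension E (pr t) [?y]" by (rule ext1)
          show "card (edges_of (pr (Suc t))) = card (edges_of (pr t)) + length [?y]" by (simp add: cSuc)
          show "r * Suc p \<le> Suc t + r * X (Suc t) + r" using p(2) X1 unfolding mult_Suc_right by linarith
          show "r * Suc p + r \<le> Suc t + r * X (Suc t)" if "?y \<in> set (take (Suc t) w)"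
            using p(2) X2 that unfolding mult_Suc_right pr_def by linarith
        qed simp
      next
        assume "F t"
        then obtain p xs ys where s: "pr t = xs @ ys" "xs \<in> ?P p" "extension E xs ys" "ys \<noteq> []"
          "card (edges_of (pr t)) = card (edges_of xs) + length ys" "r * p \<le> t + r * X t + r"
          by (auto simp: F_def)
        have ne: "xs \<noteq> []" by (rule pieces_nonempty[OF s(2)])
        have t: "0 < t" using pr_len[OF T(1)] s(1,4) ne by (cases xs; cases ys) auto
        \<comment> \<open>The edge back to \<open>w ! (t - 1)\<close> has already been used, so a
          new edge cannot turn back, even at the hinge.\<close>
        have "?y \<noteq> w ! (t - 1)" using prev[OF t] False by auto
        then have "extension E xs (ys @ [?y])"
          using eE[OF T(2)] lst s(1) pen[OF s(1) t] by (intro extension_snoc s ne) auto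
        note e = this
        show ?thesis unfolding F_def
        proof (intro exI conjI impI)
          show "pr (Suc t) = xs @ (ys @ [?y])" using pr_Suc[OF T(2)] s(1) by simp
          show "xs \<in> ?P p" by (rule s)
          show "extension E xs (ys @ [?y])" by (rule e)
          show "card (edges_of (pr (Suc t))) = card (edges_of xs) + length (ys @ [?y])"
            using cSuc s(5) by simp
          show "r * p \<le> Suc t + r * X (Suc t) + r" using s(6) X1 by linarith
          show "r * p + r \<le> Suc t + r * X (Suc t)" if "?y \<in> set (take (Suc t) w)"
            using s(6) X2 that unfolding pr_def by linarith
        qed simp
      qed
      then show ?thesis ..
    next
      case True
      have y: "?y \<in> set (pr t)" using Union_edge_in_set[OF True] by simp
      have eq: "edges_of (pr (Suc t)) = edges_of (pr t)" using True eSuc[OF T(2)] by auto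
      have Xle: "X t \<le> X (Suc t)" using exc(1)[OF True] by (auto simp: X_def)
      then have X1: "r * X t \<le> r * X (Suc t)" by simp
      have X2: "r * X t + 2 * r \<le> r * X (Suc t)" if "t = h"
      proof -
        have "X t + 2 \<le> X (Suc t)" using exc(1)[OF True] that by (auto simp: X_def)
        then have "r * (X t + 2) \<le> r * X (Suc t)" by (rule mult_le_mono2)
        then show ?thesis by (simp add: algebra_simps)
      qed
      have new_stale: "S (Suc t)" if "pr t \<in> ?P (Suc p)" "r * p + r \<le> t + r * X (Suc t)" for p
        unfolding S_def
      proof (intro exI conjI)
        show "pr (Suc t) = pr t @ [?y]" by (rule pr_Suc[OF T(2)])
        show "r * Suc p + length [?y] \<le> Suc t + r * X (Suc t)" using that(2) by simp
        show "length [?y] \<le> r" using r by simp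
      qed (rule that ext1 eq y)+
      have nbt: "w ! (t - 1) \<noteq> ?y" if "0 < t" "t \<noteq> h"
        using nb[of "t - 1"] that T w by simp
      have "S (Suc t)" using Suc.IH[OF T(1)]
      proof
        assume St: "S t"
        then obtain p xs ys where s: "pr t = xs @ ys" "xs \<in> ?P p" "extension E xs ys" "length ys \<le> r"
          "edges_of (pr t) = edges_of xs" "w ! t \<in> set xs" "r * p + length ys \<le> t + r * X t"
          by (auto simp: S_def)
        have ne: "xs \<noteq> []" by (rule pieces_nonempty[OF s(2)])
        have cl: "pr t \<in> ?P (Suc p)" unfolding s(1)
          by (rule pieces_Suc_staleI) (use s lst pr_len[OF T(1)] T in auto)
        consider "t = h" | "length ys = r" | "t \<noteq> h" "length ys < r" using s(4) by linarith
        then show ?thesis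
        proof cases
          case 1 then show ?thesis using new_stale[OF cl] X2 s(7) by linarith
        next
          case 2 then show ?thesis using new_stale[OF cl] X1 s(7) by linarith
        next
          case 3
          have "extension E xs (ys @ [?y])"
          proof (rule extension_snoc[OF s(3) ne])
            show "{last (xs @ ys), ?y} \<in> E" using eE[OF T(2)] lst s(1) by simp
            assume "ys \<noteq> []"
            then have t: "0 < t" using pr_len[OF T(1)] s(1) ne by (cases xs; cases ys) auto
            show "(xs @ ys) ! (length (xs @ ys) - 2) \<noteq> ?y" using pen[OF s(1) t] nbt[OF t 3(1)] by simp
          qed
          moreover have "?y \<in> set xs" using True s(5) Union_edge_in_set[of _ ?y xs] by auto
          note e = calculation this
          show ?thesis unfolding S_def
          proof (intro exI conjI)
            show "pr (Suc t) = xs @ (ys @ [?y])" using pr_Suc[OF T(2)] s(1) by simp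
            show "length (ys @ [?y]) \<le> r" using 3 by simp
            show "edges_of (pr (Suc t)) = edges_of xs" using eq s(5) by simp
            show "r * p + length (ys @ [?y]) \<le> Suc t + r * X (Suc t)"
              unfolding length_append_singleton using s(7) X1 by linarith
          qed (rule s(2) e)+
        qed
      next
        assume "F t"
        then obtain p xs ys where s: "pr t = xs @ ys" "xs \<in> ?P p" "extension E xs ys" "ys \<noteq> []"
          "card (edges_of (pr t)) = card (edges_of xs) + length ys" "r * p \<le> t + r * X t + r"
          "w ! t \<in> set (take t w) \<Longrightarrow> r * p + r \<le> t + r * X t"
          by (auto simp: F_def)
        have ne: "xs \<noteq> []" by (rule pieces_nonempty[OF s(2)])
        have t: "0 < t" using pr_len[OF T(1)] s(1,4) ne by (cases xs; cases ys) auto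
        have cl: "pr t \<in> ?P (Suc p)" unfolding s(1)
          by (rule pieces_Suc_freshI) (use s pr_len[OF T(1)] T in auto)
        show ?thesis
        proof (cases "w ! t \<in> set (take t w)")
          case True then show ?thesis using new_stale[OF cl] s(7) X1 by linarith
        next
          case notin: False
          \<comment> \<open>A fresh step has just reached a new vertex, whose only used edge is the
            one just crossed. Taking a used edge now means turning back, so this is the hinge, which
            pays.\<close>
          have "edges_of (pr t) = insert {w ! (t - 1), w ! t} (edges_of (take t w))"
            using eSuc[of "t - 1"] t T by (simp add: pr_def)
          then have "{w ! t, ?y} = {w ! (t - 1), w ! t}"
            using True notin Union_edge_in_set[of "w ! t" ?y "take t w"] by auto
          then have "?y = w ! (t - 1)" by (auto simp: doubleton_eq_iff)
          then have "t = h" using nbt[OF t] by auto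
          then show ?thesis using new_stale[OF cl] s(6) X2 by linarith
        qed
      qed
      then show ?thesis ..
    qed
  qed
  have wT: "pr T = w" using w by (simp add: pr_def)
  have "\<exists>p. pr T \<in> ?P (Suc p) \<and> r * p \<le> T + r * X T + r"
    using main[OF order_refl]
  proof
    assume "S T" then show ?thesis using closeS[of T] trans_le_add1 by blast
  next
    assume "F T"
    then obtain p xs ys where s: "pr T = xs @ ys" "xs \<in> ?P p" "extension E xs ys" "ys \<noteq> []"
          "card (edges_of (pr T)) = card (edges_of xs) + length ys" "r * p \<le> T + r * X T + r"
      by (auto simp: F_def)
    have "pr T \<in> ?P (Suc p)" unfolding s(1)
      by (rule pieces_Suc_freshI) (use s pr_len[of T] in auto)
    then show ?thesis using s(6) by blast
  qed
  then obtain p where p: "w \<in> ?P (Suc p)" "r * p \<le> T + r * X T + r" using wT by auto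
  have "p = (r * p) div r" using r by simp
  also have "\<dots> \<le> (T + r * (X T + 1)) div r" using p(2) by (intro div_le_mono) simp
  also have "\<dots> = T div r + (X T + 1)" using r by (subst div_mult_self2) simp_all
  \<comment> \<open>The 4 consists of the 2 for the hinge in \<open>X T\<close>, 1 for the credit of
    a fresh piece still open at the end, and 1 for closing the last piece.\<close>
  finally have "Suc p \<le> T div r + 2 * excess w + 4" by (auto simp: X_def wT split: if_splits)
  from subsetD[OF pieces_mono[OF this] p(1)] show ?thesis .
qed

text \<open>A hike has at most \<open>T div 2\<close> distinct edges, so its weight is at least
  \<open>(1 / \<rho>) ^ (T div 2)\<close>, and the total weight of the walks made of pieces bounds
  the number of hikes. Sparsity controls the excess and thereby keeps the number of pieces of order
  \<open>T / r\<close>.\<close>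

lemma card_hikes:
  fixes \<rho> C :: real
  assumes sparse: "\<And>F. F \<subseteq> E \<Longrightarrow> card F \<le> T \<Longrightarrow> card F \<le> card (\<Union>F) + card F div (4 * r)"
    and r: "0 < r" "4 * r \<le> T"
    and \<rho>: "1 \<le> \<rho>" and C: "\<And>j x. real (card (nbw E j x)) \<le> C * \<rho> ^ j"
  shows "finite (hikes E T h u) \<and> real (card (hikes E T h u)) \<le> \<rho> ^ (T div 2) *
    (real (Suc T) * C + real (Suc r * Suc T * ((Suc r)\<^sup>2 + 1))) ^ (2 * (T div r) + 6)"
proof -
  let ?P = "pieces E T r u (2 * (T div r) + 6)"
  let ?g = "\<lambda>xs. (1 / \<rho>) ^ card (edges_of xs)"
  let ?Q = "real (Suc T) * C + real (Suc r * Suc T * ((Suc r)\<^sup>2 + 1))"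
  have K: "card {w \<in> nbw E j u. last w = v} \<le> (Suc r)\<^sup>2 + 1" if "j \<le> r" for j u v
  proof (rule card_nbw_between[OF _ that r(1)])
    fix F assume "F \<subseteq> E" "card F < 4 * r"
    then show "card F \<le> card (\<Union>F)" using sparse[of F] r by simp
  qed
  have W: "finite ?P" "(\<Sum>xs\<in>?P. ?g xs) \<le> ?Q ^ (2 * (T div r) + 6)"
    using weight_pieces[OF \<rho> C K, where T = T and u = u and p = "2 * (T div r) + 6"] by auto
  have sub: "hikes E T h u \<subseteq> ?P"
  proof
    fix w assume "w \<in> hikes E T h u"
    then have w: "length w = Suc T" "hd w = u" "edges_of w \<subseteq> E" "2 * card (edges_of w) \<le> T"
      and nb: "\<And>i. Suc (Suc i) < length w \<Longrightarrow> Suc i \<noteq> h \<Longrightarrow> w ! i \<noteq> w ! Suc (Suc i)"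
      by (auto simp: hikes_def)
    have "\<Union> (edges_of w) = set w" using w(1) r by (intro Union_edges_of) auto
    then have e: "excess w \<le> 1 + card (edges_of w) div (4 * r)"
      using sparse[OF w(3)] w(4) by (simp add: excess_def)
    have "2 * (card (edges_of w) div (4 * r)) \<le> (2 * card (edges_of w)) div (4 * r)"
      using r(1) div_times_less_eq_dividend[of "card (edges_of w)" "4 * r"]
      by (subst less_eq_div_iff_mult_less_eq) (simp, linarith)
    also have "\<dots> \<le> T div (4 * r)" using w(4) by (rule div_le_mono)
    also have "\<dots> \<le> T div r" using r by (intro div_le_mono2) auto
    \<comment> \<open>The 6 is the 4 from \<open>decompose\<close> plus twice the 1 in the bound on
      the excess.\<close>
    finally have "T div r + 2 * excess w + 4 \<le> 2 * (T div r) + 6" using e by linarith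
    from subsetD[OF pieces_mono[OF this] decompose[OF w(1-3) nb r(1)]] show "w \<in> ?P" .
  qed
  have fin: "finite (hikes E T h u)" by (rule finite_subset[OF sub W(1)])
  have "real (card (hikes E T h u)) * (1 / \<rho>) ^ (T div 2) = (\<Sum>w\<in>hikes E T h u. (1 / \<rho>) ^ (T div 2))"
    by simp
  also have "\<dots> \<le> (\<Sum>w\<in>hikes E T h u. ?g w)"
    using \<rho> by (intro sum_mono power_decreasing) (auto simp: hikes_def)
  also have "\<dots> \<le> (\<Sum>w\<in>?P. ?g w)" using \<rho> by (intro sum_mono2 W sub) auto
  also have "\<dots> \<le> ?Q ^ (2 * (T div r) + 6)" by (rule W)
  finally have "real (card (hikes E T h u)) * (1 / \<rho>) ^ (T div 2) * \<rho> ^ (T div 2)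
      \<le> ?Q ^ (2 * (T div r) + 6) * \<rho> ^ (T div 2)"
    using \<rho> by (intro mult_right_mono) auto
  then show ?thesis using fin \<rho> by (simp add: power_divide field_simps)
qed

end


subsection \<open>Signed sums over nonbacktracking walks\<close>

text \<open>Walks that may follow a step from \<open>z\<close> to \<open>u\<close>. Splitting off
  the first step leads from this family back to itself, which fails for \<open>nbw\<close>.\<close>

definition nbw_avoid :: "'x set set \<Rightarrow> nat \<Rightarrow> 'x \<Rightarrow> 'x \<Rightarrow> 'x list set" where
  "nbw_avoid E j z u = {w \<in> nbw E j u. nonback (z # w)}"

context sgraph begin

lemma finite_nbr: "finite {y. {u, y} \<in> E}"
  by (rule finite_subset[OF _ finite_verts]) auto

lemma finite_nbw_avoid: "finite (nbw_avoid E j z u)"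
  unfolding nbw_avoid_def using finite_nbw by simp

lemma nbw_0: "nbw E 0 u = {[u]}"
  by (auto simp: nbw_def length_Suc_conv)

lemma nbw_avoid_0: "nbw_avoid E 0 z u = {[u]}"
  by (auto simp: nbw_avoid_def nbw_0)

lemma nbw_Suc: "nbw E (Suc j) u = (\<lambda>(y, w). u # w) ` (SIGMA y:{y. {u, y} \<in> E}. nbw_avoid E j u y)"
proof (intro equalityI subsetI)
  fix w assume "w \<in> nbw E (Suc j) u"
  then obtain y zs where w: "w = u # y # zs" "length zs = j" "edges_of w \<subseteq> E" "nonback w"
    by (auto simp: nbw_def length_Suc_conv)
  then have "(y, y # zs) \<in> (SIGMA y:{y. {u, y} \<in> E}. nbw_avoid E j u y)"
    by (cases zs) (auto simp: nbw_avoid_def nbw_def)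
  then show "w \<in> (\<lambda>(y, w). u # w) ` (SIGMA y:{y. {u, y} \<in> E}. nbw_avoid E j u y)"
    using w(1) by (force simp: image_iff)
next
  fix w assume "w \<in> (\<lambda>(y, w). u # w) ` (SIGMA y:{y. {u, y} \<in> E}. nbw_avoid E j u y)"
  then obtain y v where "w = u # v" "{u, y} \<in> E" "v \<in> nbw_avoid E j u y" by auto
  then show "w \<in> nbw E (Suc j) u"
    by (cases v) (auto simp: nbw_avoid_def nbw_def)
qed

lemma nbw_avoid_Suc:
  "nbw_avoid E (Suc j) z u = (\<lambda>(y, w). u # w) ` (SIGMA y:{y. {u, y} \<in> E} - {z}. nbw_avoid E j u y)"
proof -
  have *: "nonback (z # u # v) \<longleftrightarrow> z \<noteq> y \<and> nonback (u # v)" if "v \<in> nbw_avoid E j u y" for v y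
    using that by (cases v) (auto simp: nbw_avoid_def nbw_def)
  have nb: "nonback (u # v)" if "v \<in> nbw_avoid E j u y" for v y
    using that by (auto simp: nbw_avoid_def)
  show ?thesis
    unfolding nbw_avoid_def[of _ "Suc j"] nbw_Suc
    by (auto simp: image_iff * nb)
qed

lemma sum_nbw_Suc:
  "(\<Sum>w\<in>nbw E (Suc j) u. g w) = (\<Sum>y | {u, y} \<in> E. \<Sum>w\<in>nbw_avoid E j u y. g (u # w))"
proof -
  have "inj_on (\<lambda>(y, w). u # w) (SIGMA y:{y. {u, y} \<in> E}. nbw_avoid E j u y)"
    by (auto simp: inj_on_def nbw_avoid_def nbw_def)
  then show ?thesis unfolding nbw_Suc
    by (simp add: sum.reindex sum.Sigma finite_nbr finite_nbw_avoid case_prod_unfold)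
qed

lemma sum_nbw_avoid_Suc:
  "(\<Sum>w\<in>nbw_avoid E (Suc j) z u. g w) =
    (\<Sum>y\<in>{y. {u, y} \<in> E} - {z}. \<Sum>w\<in>nbw_avoid E j u y. g (u # w))"
proof -
  have "inj_on (\<lambda>(y, w). u # w) (SIGMA y:{y. {u, y} \<in> E} - {z}. nbw_avoid E j u y)"
    by (auto simp: inj_on_def nbw_avoid_def nbw_def)
  then show ?thesis unfolding nbw_avoid_Suc
    by (simp add: sum.reindex sum.Sigma finite_nbr finite_nbw_avoid case_prod_unfold)
qed

end

section \<open>Signs along walks in the bipartite graph\<close>

fun edge_pair :: "'a + 'v \<Rightarrow> 'a + 'v \<Rightarrow> 'a \<times> 'v" where
  "edge_pair (Inl a) (Inr i) = (a, i)"
| "edge_pair (Inr i) (Inl a) = (a, i)"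
| "edge_pair _ _ = undefined"

fun steps :: "('a + 'v) list \<Rightarrow> ('a \<times> 'v) list" where
  "steps (x # y # zs) = edge_pair x y # steps (y # zs)"
| "steps _ = []"

definition walk_sign :: "('a \<times> 'v \<Rightarrow> real) \<Rightarrow> ('a + 'v) list \<Rightarrow> real" where
  "walk_sign \<xi> w = prod_list (map \<xi> (steps w))"

definition bedges :: "('a, 'v) bigraph \<Rightarrow> ('a + 'v) set set" where
  "bedges G = (\<lambda>(a, i). {Inl a, Inr i}) ` bg_edges G"

lemma length_steps: "length (steps w) = length w - 1"
  by (induction w rule: steps.induct) auto

lemma bedges_iff [simp]:
  "{Inl a, Inr i} \<in> bedges G \<longleftrightarrow> (a, i) \<in> bg_edges G"
  "{Inr i, Inl a} \<in> bedges G \<longleftrightarrow> (a, i) \<in> bg_edges G"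
  "{Inl a, Inl b} \<notin> bedges G" "{Inr i, Inr j} \<notin> bedges G"
  by (auto simp: bedges_def doubleton_eq_iff)

lemma set_steps:
  assumes "edges_of w \<subseteq> bedges G"
  shows "edges_of w = (\<lambda>(a, i). {Inl a, Inr i}) ` set (steps w) \<and> set (steps w) \<subseteq> bg_edges G"
  using assms
proof (induction w rule: steps.induct)
  case (1 x y zs)
  then show ?case by (cases x; cases y) (auto simp: insert_commute)
qed auto

lemma card_set_steps:
  assumes "edges_of w \<subseteq> bedges G" "edges_of w' \<subseteq> bedges G"
  shows "card (edges_of w \<union> edges_of w') = card (set (steps w @ steps w'))"
proof -
  have "edges_of w \<union> edges_of w' = (\<lambda>(a, i). {Inl a, Inr i}) ` set (steps w @ steps w')"
    using set_steps[OF assms(1)] set_steps[OF assms(2)] by (simp add: image_Un)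
  moreover have "inj_on (\<lambda>(a, i). {Inl a, Inr i}) (set (steps w @ steps w'))"
    by (auto simp: inj_on_def doubleton_eq_iff)
  ultimately show ?thesis by (simp add: card_image)
qed

lemma walk_sign_Cons: "w \<noteq> [] \<Longrightarrow> walk_sign \<xi> (u # w) = \<xi> (edge_pair u (hd w)) * walk_sign \<xi> w"
  by (cases w) (auto simp: walk_sign_def)

locale biregular_graph =
  fixes G :: "('a, 'v) bigraph" and c d :: nat
  assumes breg: "biregular c d G"
begin

lemma finite_bg_edges: "finite (bg_edges G)"
  using breg unfolding biregular_def by (meson finite_SigmaI finite_set finite_subset)

lemma edge_ends: "(a, i) \<in> bg_edges G \<Longrightarrow> a \<in> bg_constraints G \<and> i \<in> set (bg_variables G)"
  using breg by (auto simp: biregular_def)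

sublocale sgraph "bedges G"
proof
  show "finite (bedges G)" using finite_bg_edges by (simp add: bedges_def)
qed (auto simp: bedges_def)

lemma nbr_Inl: "{y. {Inl a, y} \<in> bedges G} = Inr ` nbrs G a"
proof (intro equalityI subsetI)
  fix y assume "y \<in> {y. {Inl a, y} \<in> bedges G}"
  then show "y \<in> Inr ` nbrs G a" by (cases y) (auto simp: nbrs_def)
qed (auto simp: nbrs_def)

lemma nbr_Inr: "{y. {Inr i, y} \<in> bedges G} = Inl ` {a. (a, i) \<in> bg_edges G}"
proof (intro equalityI subsetI)
  fix y assume "y \<in> {y. {Inr i, y} \<in> bedges G}"
  then show "y \<in> Inl ` {a. (a, i) \<in> bg_edges G}" by (cases y) auto
qed auto

lemma finite_nbrs: "finite (nbrs G a)" "finite {a. (a, i) \<in> bg_edges G}"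
proof -
  have "nbrs G a \<subseteq> snd ` bg_edges G" "{a. (a, i) \<in> bg_edges G} \<subseteq> fst ` bg_edges G"
    by (force simp: nbrs_def)+
  then show "finite (nbrs G a)" "finite {a. (a, i) \<in> bg_edges G}"
    using finite_bg_edges by (auto intro: finite_subset)
qed

lemma card_nbrs: "(a, i) \<in> bg_edges G \<Longrightarrow> card (nbrs G a) = c"
  "(a, i) \<in> bg_edges G \<Longrightarrow> card {a. (a, i) \<in> bg_edges G} = d"
  using breg edge_ends by (auto simp: biregular_def)

lemma card_nbr_avoid:
  assumes "{u, z} \<in> bedges G"
  shows "card ({y. {u, y} \<in> bedges G} - {z}) = (case u of Inl a \<Rightarrow> c - 1 | Inr i \<Rightarrow> d - 1)"
proof -
  have "card {y. {u, y} \<in> bedges G} = (case u of Inl a \<Rightarrow> c | Inr i \<Rightarrow> d)"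
    using assms card_nbrs by (cases u; cases z) (auto simp: nbr_Inl nbr_Inr card_image)
  then show ?thesis using assms by (cases u) (auto simp: finite_nbr)
qed

text \<open>The branching numbers \<open>c - 1\<close> and \<open>d - 1\<close> alternate, so two
  steps multiply the count by \<open>\<rho>\<^sup>2\<close>; hence the induction by two steps. A
  leftover single step and the unrestricted first step each cost a factor \<open>d\<close>.\<close>

lemma card_nbw_le:
  fixes \<rho> :: real
  assumes \<rho>: "1 \<le> \<rho>" "\<rho>\<^sup>2 = real (c - 1) * real (d - 1)" and cd: "c \<le> d" "1 \<le> d"
  shows "real (card (nbw (bedges G) j u)) \<le> (real d)\<^sup>2 * \<rho> ^ j"
proof -
  let ?E = "bedges G"
  have Suc_eq: "real (card (nbw_avoid ?E (Suc j) z u)) =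
      (\<Sum>y\<in>{y. {u, y} \<in> ?E} - {z}. real (card (nbw_avoid ?E j u y)))" for j z u
    using sum_nbw_avoid_Suc[of "\<lambda>_. 1::real" j z u] by simp
  define B where "B u = real (case u of Inl a \<Rightarrow> c - 1 | Inr i \<Rightarrow> d - 1)" for u :: "'a + 'v"
  have B: "B u * B y = \<rho>\<^sup>2" if "{u, y} \<in> ?E" for u y
    using that \<rho> by (cases u; cases y) (auto simp: B_def)
  have Bd: "B u \<le> real d" for u using cd by (cases u) (auto simp: B_def)
  have B0: "0 \<le> B u" for u by (cases u) (auto simp: B_def)
  have cB: "real (card ({y. {u, y} \<in> ?E} - {z})) = B u" if "{u, z} \<in> ?E" for u z
    using card_nbr_avoid[OF that] by (simp add: B_def)
  have step: "real (card (nbw_avoid ?E (Suc j) z u)) \<le> B u * M"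
    if "{u, z} \<in> ?E" "\<And>y. {u, y} \<in> ?E \<Longrightarrow> real (card (nbw_avoid ?E j u y)) \<le> M" for j z u M
  proof -
    have "real (card (nbw_avoid ?E (Suc j) z u)) \<le> (\<Sum>y\<in>{y. {u, y} \<in> ?E} - {z}. M)"
      unfolding Suc_eq by (intro sum_mono) (use that in auto)
    then show ?thesis using cB[OF that(1)] by simp
  qed
  have one: "real (card (nbw_avoid ?E 1 z u)) \<le> B u" if "{u, z} \<in> ?E" for z u
    using step[OF that, of 0 1] by (simp add: nbw_avoid_0)
  have main: "real (card (nbw_avoid ?E j z u)) \<le> real d * \<rho> ^ j" if "{u, z} \<in> ?E" for j z u
    using that
  proof (induction j arbitrary: z u rule: less_induct)
    case (less j)
    consider "j = 0" | "j = 1" | i where "j = Suc (Suc i)"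
      by (metis One_nat_def not0_implies_Suc)
    then show ?case
    proof cases
      case 1 then show ?thesis using cd by (simp add: nbw_avoid_0)
    next
      case 2
      have "real (card (nbw_avoid ?E j z u)) \<le> real d * 1" using one[OF less.prems] Bd[of u] 2 by simp
      also have "\<dots> \<le> real d * \<rho> ^ j" using \<rho> by (intro mult_left_mono one_le_power) auto
      finally show ?thesis .
    next
      case (3 i)
      have "real (card (nbw_avoid ?E (Suc i) u y)) \<le> B y * (real d * \<rho> ^ i)" if y: "{u, y} \<in> ?E" for y
        using less.IH[of i] 3 y by (intro step) (auto simp: insert_commute)
      moreover have "B y = B z" if "{u, y} \<in> ?E" for y
        using that less.prems by (cases u; cases y; cases z) (auto simp: B_def)
      ultimately have "real (card (nbw_avoid ?E (Suc i) u y)) \<le> B z * (real d * \<rho> ^ i)"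
        if "{u, y} \<in> ?E" for y
        using that by metis
      then have "real (card (nbw_avoid ?E j z u)) \<le> B u * (B z * (real d * \<rho> ^ i))"
        unfolding 3 by (intro step less.prems)
      also have "\<dots> = (B u * B z) * (real d * \<rho> ^ i)" by simp
      also have "\<dots> = real d * \<rho> ^ j" using B[OF less.prems] 3 by (simp add: power2_eq_square)
      finally show ?thesis .
    qed
  qed
  show ?thesis
  proof (cases j)
    case 0
    have "1 \<le> (real d)\<^sup>2" using cd by (intro one_le_power) auto
    then show ?thesis using 0 by (simp add: nbw_0)
  next
    case (Suc k)
    have "card {y. {u, y} \<in> ?E} \<le> d"
    proof (cases "{y. {u, y} \<in> ?E} = {}")
      case False
      then obtain z where "{u, z} \<in> ?E" by blast
      then show ?thesis using cd card_nbrs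
        by (cases u; cases z) (auto simp: nbr_Inl nbr_Inr card_image)
    qed (simp only: card.empty)
    then have deg: "real (card {y. {u, y} \<in> ?E}) \<le> real d" by simp
    have "real (card (nbw ?E j u)) = (\<Sum>y | {u, y} \<in> ?E. real (card (nbw_avoid ?E k u y)))"
      using sum_nbw_Suc[of "\<lambda>_. 1::real" k u] Suc by simp
    also have "\<dots> \<le> (\<Sum>y | {u, y} \<in> ?E. real d * \<rho> ^ k)"
      by (intro sum_mono main) (auto simp: insert_commute)
    also have "\<dots> = real (card {y. {u, y} \<in> ?E}) * (real d * \<rho> ^ k)" by simp
    also have "\<dots> \<le> real d * (real d * \<rho> ^ k)" using deg \<rho> by (intro mult_right_mono) auto
    also have "\<dots> \<le> real d * (real d * \<rho> ^ j)" unfolding Suc using \<rho>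
      by (intro mult_left_mono power_increasing) auto
    finally show ?thesis by (simp add: power2_eq_square)
  qed
qed

end

subsection \<open>Eigenfunctions\<close>

text \<open>
  On an eigenfunction \<open>f\<close> of the signed variable--variable matrix, with \<open>h a\<close> its signed sum around
  the constraint \<open>a\<close>, the signed sum over nonbacktracking walks of length \<open>2 * k\<close> that start at \<open>i\<close>
  and do not use \<open>(a, i)\<close> first has the form \<open>\<alpha> * f i + \<beta> * \<xi> (a, i) * h a\<close>, with coefficients
  obeying a linear recursion.
\<close>

fun nb_coeff :: "real \<Rightarrow> real \<Rightarrow> real \<Rightarrow> nat \<Rightarrow> real \<times> real" where
  "nb_coeff c d \<mu> 0 = (1, 0)"
| "nb_coeff c d \<mu> (Suc k) = (case nb_coeff c d \<mu> k of (\<alpha>, \<beta>) \<Rightarrow>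
     (\<mu> * (\<alpha> + (c - 1) * \<beta>) - (d - 1) * \<alpha>, - (\<alpha> + (c - 1) * \<beta>)))"

text \<open>This differs from the first component of the next coefficient only in having
  \<open>d\<close> for \<open>d - 1\<close>: the first step is now free to use every constraint at
  the start. Index \<open>k\<close> belongs to walks of length \<open>2 * Suc k\<close>.\<close>

definition nb_poly :: "real \<Rightarrow> real \<Rightarrow> real \<Rightarrow> nat \<Rightarrow> real" where
  "nb_poly c d \<mu> k = (case nb_coeff c d \<mu> k of (\<alpha>, \<beta>) \<Rightarrow> \<mu> * (\<alpha> + (c - 1) * \<beta>) - d * \<alpha>)"

text \<open>The condition \<open>eigen\<close> says \<open>B\<^sup>T * B * f = \<mu> * f\<close>.
  That \<open>f\<close> is nonzero is added only where it is needed, to cancel its norm.\<close>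

locale signed_eigenfunction = biregular_graph +
  fixes \<xi> :: "'a \<times> 'v \<Rightarrow> real" and f :: "'v \<Rightarrow> real" and \<mu> :: real
  assumes sign: "e \<in> bg_edges G \<Longrightarrow> \<xi> e * \<xi> e = 1"
    and eigen: "i \<in> set (bg_variables G) \<Longrightarrow>
      (\<Sum>a | (a, i) \<in> bg_edges G. \<xi> (a, i) * (\<Sum>j\<in>nbrs G a. \<xi> (a, j) * f j)) = \<mu> * f i"
begin

definition fv :: "'a + 'v \<Rightarrow> real" where "fv = case_sum (\<lambda>_. 0) f"

definition h :: "'a \<Rightarrow> real" where "h a = (\<Sum>j\<in>nbrs G a. \<xi> (a, j) * f j)"

definition V :: "nat \<Rightarrow> 'a + 'v \<Rightarrow> 'a + 'v \<Rightarrow> real" where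
  "V j z u = (\<Sum>w\<in>nbw_avoid (bedges G) j z u. walk_sign \<xi> w * fv (last w))"

lemma V_0: "V 0 z u = fv u" by (simp add: V_def nbw_avoid_0 walk_sign_def)

lemma walk_step:
  "w \<in> nbw_avoid (bedges G) j u y \<Longrightarrow>
    walk_sign \<xi> (u # w) * fv (last (u # w)) = \<xi> (edge_pair u y) * (walk_sign \<xi> w * fv (last w))"
  by (cases w) (auto simp: nbw_avoid_def nbw_def walk_sign_Cons)

lemma V_Suc: "V (Suc j) z u = (\<Sum>y\<in>{y. {u, y} \<in> bedges G} - {z}. \<xi> (edge_pair u y) * V j u y)"
  unfolding V_def sum_nbw_avoid_Suc sum_distrib_left by (intro sum.cong refl walk_step)

lemma nbw_Suc_sum: "(\<Sum>w\<in>nbw (bedges G) (Suc j) u. walk_sign \<xi> w * fv (last w)) =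
    (\<Sum>y | {u, y} \<in> bedges G. \<xi> (edge_pair u y) * V j u y)"
  unfolding V_def sum_nbw_Suc sum_distrib_left by (intro sum.cong refl walk_step)

lemma V_Suc_Inl: "V (Suc j) (Inr i) (Inl a) = (\<Sum>j'\<in>nbrs G a - {i}. \<xi> (a, j') * V j (Inl a) (Inr j'))"
proof -
  have *: "Inr ` nbrs G a - {Inr i} = Inr ` (nbrs G a - {i})" by auto
  show ?thesis unfolding V_Suc nbr_Inl * by (subst sum.reindex) auto
qed

lemma V_Suc_Inr: "V (Suc j) (Inl a) (Inr i) = (\<Sum>b\<in>{b. (b, i) \<in> bg_edges G} - {a}. \<xi> (b, i) * V j (Inr i) (Inl b))"
proof -
  have *: "Inl ` {b. (b, i) \<in> bg_edges G} - {Inl a} = Inl ` ({b. (b, i) \<in> bg_edges G} - {a})" by auto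
  show ?thesis unfolding V_Suc nbr_Inr * by (subst sum.reindex) auto
qed

text \<open>Leaving \<open>b\<close> by every edge except \<open>(b, i)\<close> turns the
  \<open>\<alpha>\<close> part into \<open>h b\<close> minus the term of \<open>i\<close>; in the
  \<open>\<beta>\<close> part the sign of each edge is squared away, which leaves
  \<open>c - 1\<close> equal terms.\<close>

lemma half_step:
  assumes V: "\<And>j. (b, j) \<in> bg_edges G \<Longrightarrow> V k (Inl b) (Inr j) = \<alpha> * f j + \<beta> * \<xi> (b, j) * h b"
    and bi: "(b, i) \<in> bg_edges G" and c: "1 \<le> c"
  shows "\<xi> (b, i) * V (Suc k) (Inr i) (Inl b) = (\<alpha> + (real c - 1) * \<beta>) * (\<xi> (b, i) * h b) - \<alpha> * f i"
proof -
  have i: "i \<in> nbrs G b" using bi by (simp add: nbrs_def)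
  have "V (Suc k) (Inr i) (Inl b) = (\<Sum>j\<in>nbrs G b - {i}. \<alpha> * (\<xi> (b, j) * f j) + \<beta> * h b)"
    unfolding V_Suc_Inl
  proof (intro sum.cong refl)
    fix j assume "j \<in> nbrs G b - {i}"
    then have e: "(b, j) \<in> bg_edges G" by (simp add: nbrs_def)
    have "\<xi> (b, j) * V k (Inl b) (Inr j) = \<alpha> * (\<xi> (b, j) * f j) + \<beta> * h b * (\<xi> (b, j) * \<xi> (b, j))"
      unfolding V[OF e] by (simp add: algebra_simps)
    then show "\<xi> (b, j) * V k (Inl b) (Inr j) = \<alpha> * (\<xi> (b, j) * f j) + \<beta> * h b"
      using sign[OF e] by simp
  qed
  also have "\<dots> = \<alpha> * (h b - \<xi> (b, i) * f i) + (real c - 1) * (\<beta> * h b)"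
    using finite_nbrs i c card_nbrs(1)[OF bi]
    by (simp add: sum.distrib sum_distrib_left[symmetric] sum_diff1 h_def of_nat_diff)
  finally have e: "V (Suc k) (Inr i) (Inl b) =
    \<alpha> * (h b - \<xi> (b, i) * f i) + (real c - 1) * (\<beta> * h b)" .
  have "\<xi> (b, i) * V (Suc k) (Inr i) (Inl b) =
     (\<alpha> + (real c - 1) * \<beta>) * (\<xi> (b, i) * h b) - \<alpha> * f i * (\<xi> (b, i) * \<xi> (b, i))"
    unfolding e by (simp add: algebra_simps)
  then show ?thesis using sign[OF bi] by simp
qed

text \<open>The signed sum of \<open>h\<close> over all constraints at \<open>i\<close> is
  \<open>\<mu> * f i\<close>, which closes the recursion within multiples of
  \<open>f i\<close>.\<close>

lemma sum_half_steps:
  assumes V: "\<And>b j. (b, j) \<in> bg_edges G \<Longrightarrow> V k (Inl b) (Inr j) = \<alpha> * f j + \<beta> * \<xi> (b, j) * h b"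
    and i: "i \<in> set (bg_variables G)" and c: "1 \<le> c"
  shows "(\<Sum>b | (b, i) \<in> bg_edges G. \<xi> (b, i) * V (Suc k) (Inr i) (Inl b)) =
     (\<mu> * (\<alpha> + (real c - 1) * \<beta>) - real d * \<alpha>) * f i"
proof -
  have "(\<Sum>b | (b, i) \<in> bg_edges G. \<xi> (b, i) * V (Suc k) (Inr i) (Inl b)) =
    (\<Sum>b | (b, i) \<in> bg_edges G. (\<alpha> + (real c - 1) * \<beta>) * (\<xi> (b, i) * h b) - \<alpha> * f i)"
    by (intro sum.cong refl half_step V c) auto
  also have "\<dots> = (\<alpha> + (real c - 1) * \<beta>) * (\<mu> * f i) - real d * (\<alpha> * f i)"
    using eigen[OF i] breg i
    by (simp add: sum_subtractf sum_distrib_left[symmetric] h_def[symmetric] biregular_def)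
  finally show ?thesis by (simp add: algebra_simps)
qed

lemma V_eq:
  assumes "1 \<le> c" "(a, i) \<in> bg_edges G"
  shows "V (2 * k) (Inl a) (Inr i) =
    fst (nb_coeff c d \<mu> k) * f i + snd (nb_coeff c d \<mu> k) * \<xi> (a, i) * h a"
  using assms(2)
proof (induction k arbitrary: a i)
  case 0 then show ?case by (simp add: V_0 fv_def)
next
  case (Suc k)
  obtain \<alpha> \<beta> where ab: "nb_coeff c d \<mu> k = (\<alpha>, \<beta>)" by fastforce
  have IH: "V (2 * k) (Inl b) (Inr j) = \<alpha> * f j + \<beta> * \<xi> (b, j) * h b" if "(b, j) \<in> bg_edges G" for b j
    using Suc.IH[OF that] ab by simp
  have i: "i \<in> set (bg_variables G)" using edge_ends[OF Suc.prems] by simp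
  have "V (2 * Suc k) (Inl a) (Inr i) =
    (\<Sum>b\<in>{b. (b, i) \<in> bg_edges G} - {a}. \<xi> (b, i) * V (Suc (2 * k)) (Inr i) (Inl b))"
    using V_Suc_Inr[of "Suc (2 * k)" a i] by simp
  also have "\<dots> = (\<mu> * (\<alpha> + (real c - 1) * \<beta>) - real d * \<alpha>) * f i
      - \<xi> (a, i) * V (Suc (2 * k)) (Inr i) (Inl a)"
    using finite_nbrs Suc.prems sum_half_steps[OF IH i assms(1)] by (simp add: sum_diff1)
  also have "\<dots> = (\<mu> * (\<alpha> + (real c - 1) * \<beta>) - real d * \<alpha>) * f i
      - ((\<alpha> + (real c - 1) * \<beta>) * (\<xi> (a, i) * h a) - \<alpha> * f i)"
    using half_step[OF IH Suc.prems assms(1)] by simp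
  finally show ?case by (simp add: ab algebra_simps)
qed

lemma nbw_sum:
  assumes "1 \<le> c" "i \<in> set (bg_variables G)"
  shows "(\<Sum>w\<in>nbw (bedges G) (2 * Suc k) (Inr i). walk_sign \<xi> w * fv (last w)) = nb_poly c d \<mu> k * f i"
proof -
  obtain \<alpha> \<beta> where ab: "nb_coeff c d \<mu> k = (\<alpha>, \<beta>)" by fastforce
  have V: "V (2 * k) (Inl b) (Inr j) = \<alpha> * f j + \<beta> * \<xi> (b, j) * h b" if "(b, j) \<in> bg_edges G" for b j
    using V_eq[OF assms(1) that] ab by simp
  have "(\<Sum>w\<in>nbw (bedges G) (2 * Suc k) (Inr i). walk_sign \<xi> w * fv (last w)) =
    (\<Sum>b | (b, i) \<in> bg_edges G. \<xi> (b, i) * V (Suc (2 * k)) (Inr i) (Inl b))"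
    using nbw_Suc_sum[of "Suc (2 * k)" "Inr i"] by (simp add: nbr_Inr sum.reindex)
  also have "\<dots> = nb_poly c d \<mu> k * f i"
    using sum_half_steps[OF V assms(2,1)] by (simp add: nb_poly_def ab)
  finally show ?thesis .
qed

end


text \<open>At \<open>s = 1\<close> the expression is
  \<open>(d - 2) / (d - 1) - (c - 2) / \<rho>\<close>. After squaring, its nonnegativity follows
  from the factorization with factor \<open>d - c\<close>, with equality for \<open>c = d\<close>;
  \<open>s > 1\<close> makes it strict.\<close>

lemma growth_rate_pos:
  fixes c d \<rho> s :: real
  assumes "2 \<le> c" "c \<le> d" "3 \<le> d" "0 < \<rho>" "\<rho>\<^sup>2 = (c - 1) * (d - 1)" "1 < s"
  shows "0 < s - 1 / ((d - 1) * s) - (c - 2) / \<rho>"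
proof -
  have "(c - 2)\<^sup>2 * (d - 1) \<le> (d - 2)\<^sup>2 * (c - 1)"
  proof -
    have "(d - 2)\<^sup>2 * (c - 1) - (c - 2)\<^sup>2 * (d - 1) = (d - c) * ((c - 1) * (d - 1) - 1)"
      by (simp add: power2_eq_square algebra_simps)
    moreover have "1 * 1 \<le> (c - 1) * (d - 1)" using assms by (intro mult_mono) auto
    ultimately show ?thesis using assms by (smt (verit) mult_nonneg_nonneg)
  qed
  then have "((c - 2)\<^sup>2 * (d - 1)) * (d - 1) \<le> ((d - 2)\<^sup>2 * (c - 1)) * (d - 1)"
    using assms by (intro mult_right_mono) auto
  then have "((c - 2) * (d - 1))\<^sup>2 \<le> ((d - 2) * \<rho>)\<^sup>2"
    unfolding power_mult_distrib assms(5) by (simp add: power2_eq_square mult_ac)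
  then have "(c - 2) * (d - 1) \<le> (d - 2) * \<rho>"
    by (rule power2_le_imp_le) (use assms in simp)
  then have 1: "(c - 2) / \<rho> \<le> (d - 2) / (d - 1)"
    using assms by (simp add: field_simps)
  have "1 / ((d - 1) * s) < 1 / (d - 1)"
    using assms by (intro divide_strict_left_mono) auto
  moreover have "(d - 2) / (d - 1) = 1 - 1 / (d - 1)" using assms by (simp add: field_simps)
  ultimately show ?thesis using 1 assms by linarith
qed

text \<open>With the alternating sign removed, \<open>S\<close> satisfies
  \<open>S (k + 1) = x * S k - \<rho>\<^sup>2 * S (k - 1)\<close> for
  \<open>x = (c - 1) + (d - 1) - \<mu>\<close>, the recursion of rescaled Chebyshev polynomials. At
  \<open>x = (s + 1 / s) * \<rho>\<close> its characteristic roots are \<open>s * \<rho>\<close> and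
  \<open>\<rho> / s\<close>, and for larger \<open>x\<close> the growth rate can only
  increase.\<close>

lemma nb_poly_growth:
  fixes c d \<rho> s \<mu> :: real
  assumes \<rho>: "0 < \<rho>" "\<rho>\<^sup>2 = (c - 1) * (d - 1)" and s: "1 < s" and d: "1 < d"
    and \<mu>: "(s + 1 / s) * \<rho> \<le> (c - 1) + (d - 1) - \<mu>"
    and pos: "0 < s - 1 / ((d - 1) * s) - (c - 2) / \<rho>"
  shows "\<rho> * (s * \<rho>) ^ k * (s - 1 / ((d - 1) * s) - (c - 2) / \<rho>) \<le> \<bar>nb_poly c d \<mu> k\<bar>"
proof -
  define A where "A k = (-1) ^ k * fst (nb_coeff c d \<mu> k)" for k
  define B where "B k = (-1) ^ k * snd (nb_coeff c d \<mu> k)" for k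
  define S where "S k = A k + (c - 1) * B k" for k
  have B_Suc: "B (Suc k) = S k" and A_Suc: "A (Suc k) = (d - 1) * A k - \<mu> * S k" for k
    by (cases "nb_coeff c d \<mu> k"; simp add: A_def B_def S_def algebra_simps)+
  have S_Suc: "S (Suc k) = ((c - 1) + (d - 1) - \<mu>) * S k - \<rho>\<^sup>2 * B k" for k
    unfolding S_def[of "Suc k"] A_Suc B_Suc \<rho> by (simp add: S_def algebra_simps)
  \<comment> \<open>As \<open>B (Suc k) = S k\<close>, the second part says that successive values
    of \<open>S\<close> have ratio at least \<open>s * \<rho>\<close>.\<close>
  have main: "(s * \<rho>) ^ k \<le> S k \<and> s * \<rho> * B k \<le> S k" for k
  proof (induction k)
    case 0 then show ?case by (simp add: S_def A_def B_def)
  next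
    case (Suc k)
    have S0: "0 < S k" using Suc \<rho> s by (smt (verit) mult_pos_pos zero_less_power)
    have "(s + 1 / s) * \<rho> * S k \<le> ((c - 1) + (d - 1) - \<mu>) * S k"
      using \<mu> S0 by (intro mult_right_mono) auto
    then have "(s + 1 / s) * \<rho> * S k - \<rho>\<^sup>2 * B k \<le> S (Suc k)" unfolding S_Suc by simp
    moreover have "(s + 1 / s) * \<rho> * S k - \<rho>\<^sup>2 * B k = s * \<rho> * S k + \<rho> / s * (S k - s * \<rho> * B k)"
      using s by (simp add: field_simps power2_eq_square)
    moreover have "0 \<le> \<rho> / s * (S k - s * \<rho> * B k)" using Suc \<rho> s by (intro mult_nonneg_nonneg) auto
    ultimately have 1: "s * \<rho> * S k \<le> S (Suc k)" by linarith
    have "(s * \<rho>) ^ Suc k \<le> s * \<rho> * S k" using Suc \<rho> s by (simp add: mult_left_mono)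
    then show ?case using 1 B_Suc by simp
  qed
  have S0: "0 \<le> S k" using main[of k] \<rho> s by (smt (verit) mult_pos_pos zero_less_power)
  have "(-1) ^ Suc k * nb_poly c d \<mu> k = d * A k - \<mu> * S k"
    by (cases "nb_coeff c d \<mu> k") (simp add: nb_poly_def A_def B_def S_def algebra_simps)
  also have "\<dots> = (d - \<mu>) * S k - d * (c - 1) * B k"
    by (simp add: S_def algebra_simps)
  finally have e: "(-1) ^ Suc k * nb_poly c d \<mu> k = (d - \<mu>) * S k - d * (c - 1) * B k" .
  \<comment> \<open>The bound on \<open>\<mu>\<close>, rearranged as a lower bound on
    \<open>d - \<mu>\<close>.\<close>
  have "((s + 1 / s) * \<rho> - (c - 2)) * S k \<le> (d - \<mu>) * S k"
    using \<mu> S0 by (intro mult_right_mono) auto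
  moreover have "d * (c - 1) * B k \<le> d / ((d - 1) * s) * \<rho> * S k"
  proof -
    have c1: "c - 1 = \<rho>\<^sup>2 / (d - 1)" using \<rho> d by (simp add: field_simps)
    have "d * (c - 1) * B k = d / ((d - 1) * s) * \<rho> * (s * \<rho> * B k)"
      unfolding c1 using s by (simp add: power2_eq_square)
    also have "\<dots> \<le> d / ((d - 1) * s) * \<rho> * S k"
      using main[of k] s d \<rho> by (intro mult_left_mono) auto
    finally show ?thesis .
  qed
  moreover have "((s + 1 / s) * \<rho> - (c - 2)) * S k - d / ((d - 1) * s) * \<rho> * S k =
      \<rho> * S k * (s - 1 / ((d - 1) * s) - (c - 2) / \<rho>)"
  proof -
    define X where "X = (c - 2) / \<rho>"
    have "c - 2 = \<rho> * X" using \<rho> by (simp add: X_def)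
    moreover have "d / ((d - 1) * s) = 1 / s + 1 / ((d - 1) * s)" using s d by (simp add: field_simps)
    ultimately show ?thesis unfolding X_def[symmetric] by (simp add: algebra_simps)
  qed
  ultimately have "\<rho> * S k * (s - 1 / ((d - 1) * s) - (c - 2) / \<rho>) \<le> (-1) ^ Suc k * nb_poly c d \<mu> k"
    using e by linarith
  also have "\<dots> \<le> \<bar>nb_poly c d \<mu> k\<bar>"
    by (cases "even k") auto
  finally have "\<rho> * S k * (s - 1 / ((d - 1) * s) - (c - 2) / \<rho>) \<le> \<bar>nb_poly c d \<mu> k\<bar>" .
  moreover have "\<rho> * (s * \<rho>) ^ k * (s - 1 / ((d - 1) * s) - (c - 2) / \<rho>) \<le>
      \<rho> * S k * (s - 1 / ((d - 1) * s) - (c - 2) / \<rho>)"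
    using main[of k] \<rho> pos by (intro mult_right_mono mult_left_mono) auto
  ultimately show ?thesis by linarith
qed

subsection \<open>Averaging over the signs\<close>

text \<open>If some entry of \<open>es\<close> occurs an odd number of times, flipping its sign
  preserves the uniform distribution and negates the product, so the expectation vanishes. Otherwise
  all entries occur at least twice; of this only the count of distinct entries is kept.\<close>

lemma expectation_sign_product:
  assumes A: "finite A" and es: "set es \<subseteq> A"
  shows "measure_pmf.expectation (Pi_pmf A 0 (\<lambda>_. pmf_of_set {-1, 1 :: real})) (\<lambda>\<xi>. prod_list (map \<xi> es))
    \<le> (if 2 * card (set es) \<le> length es then 1 else 0)"
proof -
  let ?X = "PiE_dflt A 0 (\<lambda>_. {-1, 1 :: real})"
  let ?M = "pmf_of_set ?X"
  let ?g = "\<lambda>\<xi>. prod_list (map \<xi> es)"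
  have M: "Pi_pmf A 0 (\<lambda>_. pmf_of_set {-1, 1 :: real}) = ?M"
    using A by (intro Pi_pmf_of_set) auto
  have finX: "finite ?X" using A by (intro finite_PiE_dflt) auto
  have "(\<lambda>e. if e \<in> A then 1 else 0) \<in> ?X" by (auto simp: PiE_dflt_def)
  then have neX: "?X \<noteq> {}" by blast
  have g_prod: "?g \<xi> = (\<Prod>e\<in>set es. \<xi> e ^ count_list es e)" for \<xi> :: "'a \<Rightarrow> real"
  proof -
    have "?g \<xi> = prod_mset (image_mset \<xi> (mset es))" by (simp add: prod_mset_prod_list[symmetric])
    then show ?thesis by (simp add: image_prod_mset_multiplicity count_mset)
  qed
  have int: "integrable ?M g" for g :: "('a \<Rightarrow> real) \<Rightarrow> real"
    using finX neX by (intro integrable_measure_pmf_finite) simp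
  show ?thesis
  proof (cases "2 * card (set es) \<le> length es")
    case True
    have le1: "?g \<xi> \<le> 1" if "\<xi> \<in> set_pmf ?M" for \<xi>
    proof -
      have "\<bar>\<xi> e\<bar> = 1" if "e \<in> set es" for e
        using that es \<open>\<xi> \<in> set_pmf ?M\<close> finX neX by (auto simp: PiE_dflt_def)
      then have "\<bar>?g \<xi>\<bar> = 1" unfolding g_prod by (simp add: abs_prod power_abs)
      then show ?thesis by linarith
    qed
    have "measure_pmf.expectation ?M ?g \<le> measure_pmf.expectation ?M (\<lambda>_. 1)"
      by (intro integral_mono_AE int AE_pmfI le1)
    then show ?thesis using True M by simp
  next
    case False
    have "\<exists>e\<in>set es. odd (count_list es e)"
    proof (rule ccontr)
      assume "\<not> ?thesis"
      then have "2 \<le> count_list es e" if "e \<in> set es" for e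
        using that count_list_0_iff[of es e]
        by (metis One_nat_def Suc_1 Suc_leI le_neq_implies_less not_gr_zero odd_one)
      then have "(\<Sum>e\<in>set es. 2) \<le> (\<Sum>e\<in>set es. count_list es e)" by (intro sum_mono)
      then show False using False sum_count_set[of es "set es"] by simp
    qed
    then obtain e where e: "e \<in> set es" "odd (count_list es e)" by blast
    let ?flip = "\<lambda>\<xi> :: 'a \<Rightarrow> real. \<xi>(e := - \<xi> e)"
    have gflip: "?g (?flip \<xi>) = - ?g \<xi>" for \<xi>
    proof -
      have "?g (?flip \<xi>) = (- \<xi> e) ^ count_list es e * (\<Prod>x\<in>set es - {e}. \<xi> x ^ count_list es x)"
        unfolding g_prod using e by (subst prod.remove[of _ e]) auto
      also have "\<dots> = - (\<xi> e ^ count_list es e * (\<Prod>x\<in>set es - {e}. \<xi> x ^ count_list es x))"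
        using e(2) by simp
      also have "\<xi> e ^ count_list es e * (\<Prod>x\<in>set es - {e}. \<xi> x ^ count_list es x) = ?g \<xi>"
        unfolding g_prod using e by (subst (2) prod.remove[of _ e]) auto
      finally show ?thesis .
    qed
    have inj: "inj_on ?flip ?X"
      by (rule inj_on_inverseI[of _ ?flip]) auto
    have flipX: "?flip \<xi> \<in> ?X" if "\<xi> \<in> ?X" for \<xi>
      unfolding PiE_dflt_def
    proof (intro CollectI allI)
      fix x
      have "(x \<in> A \<longrightarrow> \<xi> x \<in> {-1, 1}) \<and> (x \<notin> A \<longrightarrow> \<xi> x = 0)" for x
        using that by (simp add: PiE_dflt_def)
      from this[of x] this[of e] show "(x \<in> A \<longrightarrow> ?flip \<xi> x \<in> {-1, 1}) \<and> (x \<notin> A \<longrightarrow> ?flip \<xi> x = 0)"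
        using e es by auto
    qed
    have img: "?flip ` ?X = ?X"
    proof (intro equalityI subsetI)
      fix \<xi> assume "\<xi> \<in> ?X"
      moreover have "\<xi> = ?flip (?flip \<xi>)" by auto
      ultimately show "\<xi> \<in> ?flip ` ?X" using flipX by blast
    qed (use flipX in blast)
    have "map_pmf ?flip ?M = ?M" using map_pmf_of_set_inj[OF inj neX finX] img by simp
    then have "measure_pmf.expectation ?M ?g = measure_pmf.expectation (map_pmf ?flip ?M) ?g" by simp
    also have "\<dots> = measure_pmf.expectation ?M (\<lambda>\<xi>. - ?g \<xi>)"
      unfolding integral_map_pmf gflip ..
    finally have "measure_pmf.expectation ?M ?g = 0" by simp
    then show ?thesis using False M by simp
  qed
qed

lemma edges_of_rev: "edges_of (rev w) = edges_of w"
proof (induction w rule: edges_of.induct)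
  case (1 x y zs)
  have "edges_of (rev (x # y # zs)) = insert {y, x} (edges_of (rev (y # zs)))"
    by (simp add: edges_of_snoc[of "rev zs @ [y]" x, simplified])
  then show ?case using 1 by (simp add: insert_commute)
qed auto

text \<open>Dropping the head of \<open>rev w'\<close> avoids repeating the common end. The joint
  lies at index \<open>m\<close>, the one place where the combined walk may turn back.\<close>

lemma hike_of_pair:
  assumes w: "w \<in> nbw E m u" "w' \<in> nbw E m u" "last w = last w'"
    and c: "2 * card (edges_of w \<union> edges_of w') \<le> 2 * m"
  shows "w @ tl (rev w') \<in> hikes E (2 * m) m u"
proof -
  have len: "length w = Suc m" "length w' = Suc m" using w by (auto simp: nbw_def)
  then have ne: "w \<noteq> []" "w' \<noteq> []" by auto
  have rw: "rev w' = last w # tl (rev w')" using ne w(3) by (metis hd_rev list.collapse rev_is_Nil_conv)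
  have ed: "edges_of (w @ tl (rev w')) = edges_of w \<union> edges_of w'"
    using ne by (simp add: edges_of_append rw[symmetric] edges_of_rev)
  have nthr: "(w @ tl (rev w')) ! i = (if i < m then w ! i else w' ! (2 * m - i))" if "i \<le> 2 * m" for i
  proof (cases "i \<le> m")
    case True
    have "w ! m = w' ! m" using w(3) len ne by (simp add: last_conv_nth)
    then show ?thesis using True len by (auto simp: nth_append le_less)
  next
    case False
    then have "(w @ tl (rev w')) ! i = (last w # tl (rev w')) ! (i - m)"
      using len by (simp add: nth_append nth_Cons')
    also have "\<dots> = rev w' ! (i - m)" by (simp only: rw[symmetric])
    also have "\<dots> = w' ! (2 * m - i)"
      using False that len by (subst rev_nth) (auto intro!: arg_cong[of _ _ "(!) w'"])
    finally show ?thesis using False by simp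
  qed
  have nb: "w ! i \<noteq> w ! Suc (Suc i)" "w' ! i \<noteq> w' ! Suc (Suc i)" if "Suc i < m" for i
    using w that len by (auto simp: nbw_def nonback_conv_nth)
  have "(w @ tl (rev w')) ! i \<noteq> (w @ tl (rev w')) ! Suc (Suc i)"
    if i: "Suc (Suc i) < Suc (2 * m)" "Suc i \<noteq> m" for i
  proof (cases "Suc i < m")
    case True
    have "(w @ tl (rev w')) ! j = w ! j" if "j \<le> m" for j
      using that len by (simp add: nth_append)
    then show ?thesis using nb(1)[OF True] True by simp
  next
    case False
    then have "2 * m - i = Suc (Suc (2 * m - Suc (Suc i)))" using i by linarith
    moreover have "Suc (2 * m - Suc (Suc i)) < m" using i False by linarith
    note nb(2)[OF this]
    ultimately show ?thesis using nthr[of i] nthr[of "Suc (Suc i)"] i False by auto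
  qed
  then show ?thesis using w len ed c ne by (auto simp: hikes_def nbw_def)
qed

context biregular_graph begin

definition walk_sum :: "('a \<times> 'v \<Rightarrow> real) \<Rightarrow> nat \<Rightarrow> 'v \<Rightarrow> 'v \<Rightarrow> real" where
  "walk_sum \<xi> m i v = (\<Sum>w | w \<in> nbw (bedges G) m (Inr i) \<and> last w = Inr v. walk_sign \<xi> w)"

text \<open>Expanding the squares gives pairs of walks with common ends. The pairs that survive the
  averaging embed into hikes, since the two walks can be recovered from their concatenation; the sum
  over \<open>v\<close> merely sorts the pairs by their end.\<close>

lemma expectation_walk_sum:
  "measure_pmf.expectation (random_signing G)
     (\<lambda>\<xi>. \<Sum>i\<in>set (bg_variables G). \<Sum>v\<in>set (bg_variables G). (walk_sum \<xi> m i v)\<^sup>2)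
   \<le> (\<Sum>i\<in>set (bg_variables G). real (card (hikes (bedges G) (2 * m) m (Inr i))))"
proof -
  let ?E = "bedges G" and ?M = "random_signing G" and ?V = "set (bg_variables G)"
  define W where "W i v = {w \<in> nbw ?E m (Inr i). last w = Inr v}" for i v
  have finW: "finite (W i v)" for i v unfolding W_def using finite_nbw by simp
  have finM: "finite (set_pmf ?M)" unfolding random_signing_def
    using finite_bg_edges by (subst set_Pi_pmf) (auto intro!: finite_PiE_dflt simp: o_def)
  have int: "integrable ?M g" for g :: "_ \<Rightarrow> real" by (rule integrable_measure_pmf_finite[OF finM])
  define H where "H i = {(w, w'). w \<in> nbw ?E m (Inr i) \<and> w' \<in> nbw ?E m (Inr i) \<and> last w = last w' \<and>
      2 * card (edges_of w \<union> edges_of w') \<le> 2 * m}" for i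
  have one: "measure_pmf.expectation ?M (\<lambda>\<xi>. walk_sign \<xi> w * walk_sign \<xi> w')
     \<le> (if (w, w') \<in> H i then 1 else 0)" if "w \<in> W i v" "w' \<in> W i v" for w w' i v
  proof -
    have ed: "edges_of w \<subseteq> ?E" "edges_of w' \<subseteq> ?E" "length w = Suc m" "length w' = Suc m"
      using that by (auto simp: W_def nbw_def)
    have "measure_pmf.expectation ?M (\<lambda>\<xi>. walk_sign \<xi> w * walk_sign \<xi> w') =
       measure_pmf.expectation ?M (\<lambda>\<xi>. prod_list (map \<xi> (steps w @ steps w')))"
      by (simp add: walk_sign_def)
    also have "\<dots> \<le> (if 2 * card (set (steps w @ steps w')) \<le> length (steps w @ steps w') then 1 else 0)"
      unfolding random_signing_def
      by (intro expectation_sign_product finite_bg_edges) (use set_steps[OF ed(1)] set_steps[OF ed(2)] in auto)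
    also have "\<dots> = (if (w, w') \<in> H i then 1 else 0)"
      using that ed card_set_steps[OF ed(1,2)] by (auto simp: H_def W_def length_steps)
    finally show ?thesis .
  qed
  have "measure_pmf.expectation ?M (\<lambda>\<xi>. \<Sum>i\<in>?V. \<Sum>v\<in>?V. (walk_sum \<xi> m i v)\<^sup>2) =
    (\<Sum>i\<in>?V. \<Sum>v\<in>?V. \<Sum>w\<in>W i v. \<Sum>w'\<in>W i v. measure_pmf.expectation ?M (\<lambda>\<xi>. walk_sign \<xi> w * walk_sign \<xi> w'))"
    unfolding walk_sum_def W_def[symmetric] power2_eq_square sum_product
    by (simp add: int)
  also have "\<dots> \<le> (\<Sum>i\<in>?V. \<Sum>v\<in>?V. \<Sum>w\<in>W i v. \<Sum>w'\<in>W i v. if (w, w') \<in> H i then 1 else 0)"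
    by (intro sum_mono one)
  also have "\<dots> \<le> (\<Sum>i\<in>?V. real (card (hikes ?E (2 * m) m (Inr i))))"
  proof (rule sum_mono)
    fix i assume "i \<in> ?V"
    have finH: "finite (H i)"
      by (rule finite_subset[of _ "nbw ?E m (Inr i) \<times> nbw ?E m (Inr i)"]) (auto simp: H_def finite_nbw)
    define HV where "HV v = {z \<in> H i. last (fst z) = Inr v}" for v
    have "(\<Sum>v\<in>?V. \<Sum>w\<in>W i v. \<Sum>w'\<in>W i v. if (w, w') \<in> H i then 1 else 0) = (\<Sum>v\<in>?V. real (card (HV v)))"
    proof (intro sum.cong refl)
      fix v
      have "(\<Sum>w\<in>W i v. \<Sum>w'\<in>W i v. if (w, w') \<in> H i then 1 else (0::real)) =
         (\<Sum>z\<in>W i v \<times> W i v. if z \<in> H i then 1 else 0)"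
        by (simp add: sum.cartesian_product)
      also have "\<dots> = real (card (W i v \<times> W i v \<inter> H i))"
        using finW by (simp add: sum.If_cases Int_def)
      also have "W i v \<times> W i v \<inter> H i = HV v" by (auto simp: W_def H_def HV_def)
      finally show "(\<Sum>w\<in>W i v. \<Sum>w'\<in>W i v. if (w, w') \<in> H i then 1 else 0) = real (card (HV v))" .
    qed
    also have "\<dots> = real (card (\<Union>v\<in>?V. HV v))"
    proof -
      have "card (\<Union>v\<in>?V. HV v) = (\<Sum>v\<in>?V. card (HV v))"
        using finH by (intro card_UN_disjoint) (auto simp: HV_def)
      then show ?thesis by simp
    qed
    also have "\<dots> \<le> real (card (H i))"
      using finH by (intro of_nat_mono card_mono) (auto simp: HV_def)
    also have "\<dots> \<le> real (card (hikes ?E (2 * m) m (Inr i)))"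
    proof (intro of_nat_mono card_inj_on_le)
      show "inj_on (\<lambda>(w, w'). w @ tl (rev w')) (H i)"
      proof (rule inj_onI)
        fix z z' assume z: "z \<in> H i" "z' \<in> H i" and eq: "(case z of (w, w') \<Rightarrow> w @ tl (rev w')) = (case z' of (w, w') \<Rightarrow> w @ tl (rev w'))"
        obtain w w' x x' where zz: "z = (w, w')" "z' = (x, x')" by (cases z; cases z')
        have l: "length w = length x" "w' \<noteq> []" "x' \<noteq> []" "last w = last w'" "last x = last x'"
          using z zz by (auto simp: H_def nbw_def)
        then have "w = x" "tl (rev w') = tl (rev x')" using eq zz by auto
        moreover then have "rev w' = rev x'" using l by (metis hd_rev list.collapse rev_is_Nil_conv)
        ultimately show "z = z'" using zz by simp
      qed
      show "(\<lambda>(w, w'). w @ tl (rev w')) ` H i \<subseteq> hikes ?E (2 * m) m (Inr i)"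
        using hike_of_pair by (auto simp: H_def)
      show "finite (hikes ?E (2 * m) m (Inr i))"
      proof (rule finite_subset)
        show "hikes ?E (2 * m) m (Inr i) \<subseteq> {w. set w \<subseteq> insert (Inr i) (\<Union>?E) \<and> length w = Suc (2 * m)}"
        proof
          fix w assume w: "w \<in> hikes ?E (2 * m) m (Inr i)"
          show "w \<in> {w. set w \<subseteq> insert (Inr i) (\<Union>?E) \<and> length w = Suc (2 * m)}"
          proof (cases "Suc 0 < length w")
            case True
            then show ?thesis using w Union_edges_of[OF True] by (auto simp: hikes_def)
          next
            case False
            then show ?thesis using w by (cases w) (auto simp: hikes_def)
          qed
        qed
        show "finite {w. set w \<subseteq> insert (Inr i) (\<Union>?E) \<and> length w = Suc (2 * m)}"
          using finite_verts by (intro finite_lists_length_eq) auto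
      qed
    qed
    finally show "(\<Sum>v\<in>?V. \<Sum>w\<in>W i v. \<Sum>w'\<in>W i v. if (w, w') \<in> H i then 1 else 0)
       \<le> real (card (hikes ?E (2 * m) m (Inr i)))" .
  qed
  finally show ?thesis .
qed

text \<open>\<open>length\<close> counts vertices, so odd length means an even number of steps,
  which leads back to the variable side.\<close>

lemma last_even_walk:
  assumes "edges_of w \<subseteq> bedges G" "hd w = Inr i" "i \<in> set (bg_variables G)" "odd (length w)"
  shows "\<exists>v\<in>set (bg_variables G). last w = Inr v"
  using assms
proof (induction "length w" arbitrary: w i rule: less_induct)
  case less
  show ?case
  proof (cases w)
    case Nil then show ?thesis using less.prems by simp
  next
    case x: (Cons x ws)
    show ?thesis
    proof (cases ws)
      case Nil then show ?thesis using less.prems x by simp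
    next
      case y: (Cons y vs)
      show ?thesis
      proof (cases vs)
        case Nil then show ?thesis using less.prems x y by simp
      next
        case z: (Cons z us)
        obtain j where j: "z = Inr j" "j \<in> set (bg_variables G)"
          using less.prems x y z edge_ends by (cases y; cases z) auto
        show ?thesis
          using less.hyps[of vs j] less.prems x y z j by simp
      qed
    qed
  qed
qed

end

text \<open>The walk matrix maps \<open>f\<close> to \<open>nb_poly c d \<mu> k\<close> times
  \<open>f\<close>; Cauchy-Schwarz in each row bounds the square of an eigenvalue by the squared
  Frobenius norm.\<close>

lemma (in signed_eigenfunction) frobenius_bound:
  assumes c: "1 \<le> c" and f: "\<exists>i\<in>set (bg_variables G). f i \<noteq> 0"
  shows "(nb_poly c d \<mu> k)\<^sup>2 \<le>
    (\<Sum>i\<in>set (bg_variables G). \<Sum>v\<in>set (bg_variables G). (walk_sum \<xi> (2 * Suc k) i v)\<^sup>2)"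
proof -
  let ?V = "set (bg_variables G)" and ?W = "walk_sum \<xi> (2 * Suc k)" and ?p = "nb_poly c d \<mu> k"
  have e: "?p * f i = (\<Sum>v\<in>?V. ?W i v * f v)" if i: "i \<in> ?V" for i
  proof -
    let ?N = "nbw (bedges G) (2 * Suc k) (Inr i)"
    have "last ` ?N \<subseteq> Inr ` ?V"
      using last_even_walk[OF _ _ i] by (fastforce simp: nbw_def)
    then have "(\<Sum>w\<in>?N. walk_sign \<xi> w * fv (last w)) =
        (\<Sum>y\<in>Inr ` ?V. \<Sum>w\<in>{w \<in> ?N. last w = y}. walk_sign \<xi> w * fv (last w))"
      by (intro sum.group[symmetric] finite_nbw) auto
    also have "\<dots> = (\<Sum>v\<in>?V. \<Sum>w\<in>{w \<in> ?N. last w = Inr v}. walk_sign \<xi> w * fv (last w))"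
      by (subst sum.reindex) auto
    also have "\<dots> = (\<Sum>v\<in>?V. ?W i v * f v)"
      unfolding walk_sum_def sum_distrib_right
      by (intro sum.cong refl) (auto simp: fv_def)
    finally show ?thesis using nbw_sum[OF c i, of k] by simp
  qed
  let ?F = "\<Sum>v\<in>?V. (f v)\<^sup>2"
  have "?p\<^sup>2 * ?F = (\<Sum>i\<in>?V. (?p * f i)\<^sup>2)"
    by (simp add: sum_distrib_left power_mult_distrib)
  also have "\<dots> = (\<Sum>i\<in>?V. (\<Sum>v\<in>?V. ?W i v * f v)\<^sup>2)"
    by (intro sum.cong refl) (simp only: e)
  also have "\<dots> \<le> (\<Sum>i\<in>?V. (\<Sum>v\<in>?V. (?W i v)\<^sup>2) * ?F)"
    by (intro sum_mono Cauchy_Schwarz_ineq_sum)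
  also have "\<dots> = (\<Sum>i\<in>?V. \<Sum>v\<in>?V. (?W i v)\<^sup>2) * ?F" by (simp only: sum_distrib_right)
  finally have "?p\<^sup>2 * ?F \<le> (\<Sum>i\<in>?V. \<Sum>v\<in>?V. (?W i v)\<^sup>2) * ?F" .
  moreover have "0 < ?F"
  proof -
    obtain i where "i \<in> ?V" "f i \<noteq> 0" using f by blast
    then show ?thesis by (intro sum_pos2[of _ i]) auto
  qed
  ultimately show ?thesis by (simp only: mult_le_cancel_right_pos)
qed


subsection \<open>Sparsity of random lifts\<close>

lemma nlift_edge_iff:
  "((a, k), (i, m)) \<in> bg_edges (nlift n G \<pi>) \<longleftrightarrow> (a, i) \<in> bg_edges G \<and> k < n \<and> m = \<pi> (a, i) k"
  by (auto simp: nlift_def)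

definition lift_perms :: "nat \<Rightarrow> ('a, 'v) bigraph \<Rightarrow> ('a \<times> 'v \<Rightarrow> nat \<Rightarrow> nat) set" where
  "lift_perms n G = PiE_dflt (bg_edges G) id (\<lambda>_. {p. p permutes {..<n}})"

lemma lift_perms_permutes: "\<pi> \<in> lift_perms n G \<Longrightarrow> e \<in> bg_edges G \<Longrightarrow> \<pi> e permutes {..<n}"
  by (cases e) (auto simp: lift_perms_def PiE_dflt_def)

lemma finite_lift_perms: "finite (bg_edges G) \<Longrightarrow> finite (lift_perms n G)"
  unfolding lift_perms_def by (intro finite_PiE_dflt) (auto intro: finite_permutations)

lemma id_lift_perms: "(\<lambda>_. id) \<in> lift_perms n G"
  by (auto simp: lift_perms_def PiE_dflt_def permutes_id)

lemma random_lift_eq: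
  assumes "finite (bg_edges G)"
  shows "random_lift n G = map_pmf (nlift n G) (pmf_of_set (lift_perms n G))"
  unfolding random_lift_def lift_perms_def using assms
  by (subst Pi_pmf_of_set) (auto intro: finite_permutations permutes_id)

text \<open>A switching argument: compose the permutation over \<open>(a, i)\<close> with the
  transposition of \<open>m\<close> and some \<open>m'\<close> outside the variable levels used by
  \<open>F\<close>. This redirects \<open>k\<close> to \<open>m'\<close> and keeps the edges of
  \<open>F\<close>. The pair is recoverable, because \<open>m'\<close> is the new image of
  \<open>k\<close>, and there are at least \<open>n - card F\<close> choices of
  \<open>m'\<close>.\<close>

lemma lift_perms_insert:
  fixes F :: "(('a \<times> nat) \<times> ('v \<times> nat)) set" and n :: nat
  assumes fin: "finite (bg_edges G)" "finite F" and x: "x \<notin> F"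
  defines "A \<equiv> \<lambda>F. {\<pi> \<in> lift_perms n G. F \<subseteq> bg_edges (nlift n G \<pi>)}"
  shows "card (A (insert x F)) * (n - card F) \<le> card (A F)"
proof (cases "A (insert x F) = {}")
  case False
  obtain a k i m where x_eq: "x = ((a, k), (i, m))" by (metis prod.exhaust)
  obtain \<pi>0 where "\<pi>0 \<in> A (insert x F)" using False by blast
  then have ai: "(a, i) \<in> bg_edges G" "k < n" "m = \<pi>0 (a, i) k" "\<pi>0 \<in> lift_perms n G"
    by (auto simp: A_def x_eq nlift_edge_iff)
  then have m: "m < n" using lift_perms_permutes[of \<pi>0 n G "(a, i)"] permutes_in_image by fastforce
  define R where "R = {..<n} - (\<lambda>y. snd (snd y)) ` F"
  have "n - card F \<le> card R"
    unfolding R_def using fin(2) card_image_le[of F "\<lambda>y. snd (snd y)"]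
    by (intro order_trans[OF _ diff_card_le_card_Diff]) auto
  let ?\<Phi> = "\<lambda>(\<pi>, m'). \<pi>((a, i) := Transposition.transpose m m' \<circ> \<pi> (a, i))"
  have px: "\<pi> (a, i) k = m" "\<pi> (a, i) permutes {..<n}" "\<pi> \<in> lift_perms n G" if "\<pi> \<in> A (insert x F)" for \<pi>
    using that ai lift_perms_permutes[of \<pi> n G "(a, i)"] by (auto simp: A_def x_eq nlift_edge_iff)
  have "inj_on ?\<Phi> (A (insert x F) \<times> R)"
  proof (rule inj_onI, clarify)
    fix \<pi> m' \<pi>' m'' assume 1: "\<pi> \<in> A (insert x F)" "\<pi>' \<in> A (insert x F)"
      and eq: "\<pi>((a, i) := Transposition.transpose m m' \<circ> \<pi> (a, i)) = \<pi>'((a, i) := Transposition.transpose m m'' \<circ> \<pi>' (a, i))"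
    have e: "Transposition.transpose m m' \<circ> \<pi> (a, i) = Transposition.transpose m m'' \<circ> \<pi>' (a, i)" using fun_cong[OF eq, of "(a, i)"] by simp
    have mm: "m' = m''" using fun_cong[OF e, of k] px(1)[OF 1(1)] px(1)[OF 1(2)] by simp
    have "Transposition.transpose m m' \<circ> (Transposition.transpose m m' \<circ> \<pi> (a, i)) = Transposition.transpose m m' \<circ> (Transposition.transpose m m' \<circ> \<pi>' (a, i))"
      using e mm by simp
    then have "\<pi> (a, i) = \<pi>' (a, i)" by (simp add: o_assoc)
    then have "\<pi> y = \<pi>' y" for y using fun_cong[OF eq, of y] by (cases "y = (a, i)") auto
    then show "\<pi> = \<pi>' \<and> m' = m''" using mm by auto
  qed
  moreover have "?\<Phi> ` (A (insert x F) \<times> R) \<subseteq> A F"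
  proof clarify
    fix \<pi> m' assume 1: "\<pi> \<in> A (insert x F)" and m': "m' \<in> R"
    let ?\<pi>' = "\<pi>((a, i) := Transposition.transpose m m' \<circ> \<pi> (a, i))"
    have "Transposition.transpose m m' permutes {..<n}" using m m' by (intro permutes_swap_id) (auto simp: R_def)
    then have pp: "Transposition.transpose m m' \<circ> \<pi> (a, i) permutes {..<n}" using px(2)[OF 1] by (intro permutes_compose)
    have L: "?\<pi>' \<in> lift_perms n G"
      using px(3)[OF 1] pp ai(1) by (auto simp: lift_perms_def PiE_dflt_def)
    have "y \<in> bg_edges (nlift n G ?\<pi>')" if y: "y \<in> F" for y
    proof -
      obtain b l j q where y_eq: "y = ((b, l), (j, q))" by (metis prod.exhaust)
      have yE: "(b, j) \<in> bg_edges G" "l < n" "q = \<pi> (b, j) l"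
        using 1 y by (auto simp: A_def y_eq nlift_edge_iff)
      have "?\<pi>' (b, j) l = q"
      proof (cases "(b, j) = (a, i)")
        case True
        have "q \<noteq> m'" using m' y by (force simp: R_def y_eq)
        moreover have "q \<noteq> m"
        proof
          assume "q = m"
          then have "\<pi> (a, i) l = \<pi> (a, i) k" using yE True px(1)[OF 1] by simp
          then have "l = k" using permutes_inj[OF px(2)[OF 1]] by (simp add: inj_eq)
          then show False using x y True \<open>q = m\<close> by (simp add: x_eq y_eq)
        qed
        ultimately show ?thesis using yE True by (simp add: transpose_apply_other)
      qed (use yE in auto)
      then show ?thesis using yE by (simp add: y_eq nlift_edge_iff)
    qed
    then show "?\<pi>' \<in> A F" using L by (auto simp: A_def)
  qed
  moreover have "finite (A F)" unfolding A_def using finite_lift_perms[OF fin(1)] by simp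
  ultimately have "card (A (insert x F) \<times> R) \<le> card (A F)" by (rule card_inj_on_le)
  then show ?thesis using \<open>n - card F \<le> card R\<close>
    by (simp add: card_cartesian_product) (meson le_trans mult_le_mono2)
qed (simp only: card.empty mult_0 le0)

text \<open>The assumption on \<open>n\<close> keeps \<open>n - card F\<close> at least
  \<open>n / 2\<close> throughout, so each prescribed edge costs a factor
  \<open>2 / n\<close>.\<close>

lemma lift_contains_prob:
  fixes F :: "(('a \<times> nat) \<times> ('v \<times> nat)) set"
  assumes fin: "finite (bg_edges G)" "finite F" and n: "2 * card F \<le> n"
  shows "measure_pmf.prob (random_lift n G) {H. F \<subseteq> bg_edges H} \<le> (2 / real n) ^ card F"
proof -
  define A where "A F = {\<pi> \<in> lift_perms n G. F \<subseteq> bg_edges (nlift n G \<pi>)}"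
    for F :: "(('a \<times> nat) \<times> ('v \<times> nat)) set"
  let ?X = "lift_perms n G"
  have X: "finite ?X" "?X \<noteq> {}" using finite_lift_perms[OF fin(1)] id_lift_perms by blast+
  have "real (card (A F)) \<le> (2 / real n) ^ card F * real (card ?X)"
    using fin(2) n
  proof (induction F)
    case empty
    have "A {} = ?X" by (auto simp: A_def)
    then show ?case by simp
  next
    case (insert x F)
    have c: "2 * card F + 2 \<le> n" using insert by simp
    have "card (A (insert x F)) * (n - card F) \<le> card (A F)"
      unfolding A_def by (rule lift_perms_insert[OF fin(1) insert(1,2)])
    then have "real (card (A (insert x F))) * real (n - card F) \<le> real (card (A F))"
      by (metis of_nat_le_iff of_nat_mult)
    moreover have "real n / 2 \<le> real (n - card F)" using c by (simp add: of_nat_diff)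
    ultimately have "real (card (A (insert x F))) * (real n / 2) \<le> real (card (A F))"
      by (smt (verit) mult_left_mono of_nat_0_le_iff)
    then have "real (card (A (insert x F))) \<le> 2 / real n * real (card (A F))"
      using c by (simp add: field_simps)
    also have "\<dots> \<le> 2 / real n * ((2 / real n) ^ card F * real (card ?X))"
      using insert by (intro mult_left_mono) auto
    finally show ?case using insert by simp
  qed
  moreover have "measure_pmf.prob (random_lift n G) {H. F \<subseteq> bg_edges H} = real (card (A F)) / real (card ?X)"
  proof -
    have "?X \<inter> nlift n G -` {H. F \<subseteq> bg_edges H} = A F" by (auto simp: A_def)
    then show ?thesis using X by (simp add: random_lift_eq[OF fin(1)] measure_pmf_of_set)
  qed
  moreover have "0 < real (card ?X)" using X by (simp add: card_gt_0_iff)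
  ultimately show ?thesis by (simp only: pos_divide_le_eq)
qed

definition sparse_upto :: "nat \<Rightarrow> nat \<Rightarrow> ('a \<times> 'v) set \<Rightarrow> bool" where
  "sparse_upto T q E \<longleftrightarrow> (\<forall>F\<subseteq>E. finite F \<longrightarrow> card F \<le> T \<longrightarrow>
     card F \<le> card (fst ` F) + card (snd ` F) + card F div q)"

text \<open>Such a set is encoded by a list of exactly \<open>v\<close> vertices that covers its
  ends, padded by repetition, and a list of \<open>f\<close> pairs of positions in it. Codes are far
  from unique, but every set has one.\<close>

lemma card_dense_sets:
  fixes A :: "'a set" and B :: "'v set"
  assumes fin: "finite A" "finite B" and f: "0 < f"
  shows "card {F. F \<subseteq> A \<times> B \<and> card F = f \<and> card (fst ` F) + card (snd ` F) \<le> v}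
    \<le> (card A + card B) ^ v * (v * v) ^ f"
proof -
  define X where "X = Inl ` A \<union> Inr ` B"
  have cX: "card X = card A + card B" unfolding X_def
    using fin by (subst card_Un_disjoint) (auto simp: card_image)
  have finX: "finite X" using fin by (simp add: X_def)
  define L1 where "L1 = {xs. set xs \<subseteq> X \<and> length xs = v}"
  define L2 where "L2 = {ps. set ps \<subseteq> {..<v} \<times> {..<v} \<and> length ps = f}"
  let ?\<Psi> = "\<lambda>(vs, ps). (\<lambda>(p, q). (projl (vs ! p), projr (vs ! q))) ` set ps"
  have "{F. F \<subseteq> A \<times> B \<and> card F = f \<and> card (fst ` F) + card (snd ` F) \<le> v} \<subseteq> ?\<Psi> ` (L1 \<times> L2)"
  proof
    fix F assume "F \<in> {F. F \<subseteq> A \<times> B \<and> card F = f \<and> card (fst ` F) + card (snd ` F) \<le> v}"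
    then have F: "F \<subseteq> A \<times> B" "card F = f" "card (fst ` F) + card (snd ` F) \<le> v" by auto
    have finF: "finite F" "F \<noteq> {}" using F(2) f by (auto intro: card_ge_0_finite)
    define V where "V = Inl ` fst ` F \<union> Inr ` snd ` F"
    have "card V \<le> v" using F(3) finF unfolding V_def
      by (subst card_Un_disjoint) (auto simp: card_image)
    moreover have finV: "finite V" using finF by (simp add: V_def)
    ultimately obtain us where us: "set us = V" "length us \<le> v"
      using finite_distinct_list[OF finV] distinct_card by metis
    have "us \<noteq> []" using us finF by (auto simp: V_def)
    define vs where "vs = us @ replicate (v - length us) (hd us)"
    have vs: "set vs = V" "length vs = v" using us \<open>us \<noteq> []\<close> hd_in_set by (auto simp: vs_def)
    define ix where "ix y = (SOME p. p < v \<and> vs ! p = y)" for y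
    have ix: "ix y < v \<and> vs ! ix y = y" if "y \<in> V" for y
      unfolding ix_def using that vs by (intro someI_ex[of "\<lambda>p. p < v \<and> vs ! p = y"]) (metis in_set_conv_nth)
    obtain es where es: "set es = F" "length es = f"
      using finite_distinct_list[OF finF(1)] distinct_card F(2) by metis
    define ps where "ps = map (\<lambda>(a, i). (ix (Inl a), ix (Inr i))) es"
    have inV: "Inl a \<in> V \<and> Inr i \<in> V" if "(a, i) \<in> F" for a i using that by (force simp: V_def)
    have ixs: "ix (Inl a) < v" "ix (Inr i) < v" "projl (vs ! ix (Inl a)) = a" "projr (vs ! ix (Inr i)) = i"
      if "(a, i) \<in> F" for a i
      using ix[of "Inl a"] ix[of "Inr i"] inV[OF that] by auto
    have "vs \<in> L1" using vs F(1) by (auto simp: L1_def X_def V_def)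
    moreover have "ps \<in> L2" using es ixs by (auto simp: L2_def ps_def)
    moreover have "?\<Psi> (vs, ps) = F"
    proof -
      have "?\<Psi> (vs, ps) = (\<lambda>(a, i). (projl (vs ! ix (Inl a)), projr (vs ! ix (Inr i)))) ` F"
        using es by (auto simp: ps_def image_image case_prod_unfold)
      also have "\<dots> = (\<lambda>z. z) ` F" using ixs by (intro image_cong) auto
      finally show ?thesis by simp
    qed
    ultimately show "F \<in> ?\<Psi> ` (L1 \<times> L2)" by (metis (no_types, lifting) SigmaI image_eqI)
  qed
  moreover have fL: "finite (L1 \<times> L2)" using finX
    by (auto simp: L1_def L2_def intro!: finite_lists_length_eq)
  ultimately have "card {F. F \<subseteq> A \<times> B \<and> card F = f \<and> card (fst ` F) + card (snd ` F) \<le> v} \<le> card (L1 \<times> L2)"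
    by (meson surj_card_le)
  also have "\<dots> = (card A + card B) ^ v * (v * v) ^ f"
    using finX by (simp add: card_cartesian_product L1_def L2_def card_lists_length_eq cX)
  finally show ?thesis .
qed

lemma complete_bigraph_simps [simp]:
  "bg_edges (complete_bigraph d c) = {..<d} \<times> {..<c}"
  "bg_variables (complete_bigraph d c) = [0..<c]"
  "bg_constraints (complete_bigraph d c) = {..<d}"
  by (simp_all add: complete_bigraph_def)

lemma set_random_lift:
  "set_pmf (random_lift n (complete_bigraph d c)) =
    nlift n (complete_bigraph d c) ` lift_perms n (complete_bigraph d c)"
proof -
  let ?K = "complete_bigraph d c"
  have "finite (lift_perms n ?K)" "lift_perms n ?K \<noteq> {}"
    using finite_lift_perms[of ?K n] id_lift_perms[of n ?K] by auto
  then show ?thesis by (simp add: random_lift_eq)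
qed

text \<open>First moment over dense sets. With \<open>f\<close> edges and at most
  \<open>f - g\<close> vertices, where \<open>g = Suc (f div q)\<close>, the number of sets times
  \<open>(2 / n) ^ f\<close> is at most \<open>M ^ f / n ^ g\<close> for
  \<open>M = 2 * (d + c) * T\<^sup>2\<close>. As \<open>f \<le> q * g\<close>, this is at most
  \<open>(M ^ q / n) ^ g\<close>, and \<open>big\<close> says \<open>M ^ q \<le> sqrt n\<close>. The
  factor \<open>T\<close> comes from summing over \<open>f\<close>.\<close>

lemma random_lift_sparse:
  assumes n: "0 < n" "2 * T \<le> n" and q: "0 < q" and T: "0 < T"
    and big: "(2 * (d + c) * T\<^sup>2) ^ (2 * q) \<le> n" and dc: "0 < d + c"
  shows "measure_pmf.prob (random_lift n (complete_bigraph d c)) {H. \<not> sparse_upto T q (bg_edges H)}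
    \<le> real T / sqrt (real n)"
proof -
  let ?M = "random_lift n (complete_bigraph d c)"
  let ?A = "{..<d} \<times> {..<n}" and ?B = "{..<c} \<times> {..<n}"
  \<comment> \<open>The last conjunct keeps the natural-number subtraction
    \<open>f - Suc (f div q)\<close> from truncating.\<close>
  define FF where "FF f = {F. F \<subseteq> ?A \<times> ?B \<and> card F = f \<and> card (fst ` F) + card (snd ` F) \<le> f - Suc (f div q) \<and> Suc (f div q) \<le> f}" for f
  have sub: "{H. \<not> sparse_upto T q (bg_edges H)} \<inter> set_pmf ?M \<subseteq> (\<Union>f\<in>{1..T}. \<Union>F\<in>FF f. {H. F \<subseteq> bg_edges H})"
  proof
    fix H assume H: "H \<in> {H. \<not> sparse_upto T q (bg_edges H)} \<inter> set_pmf ?M"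
    then obtain \<pi> where \<pi>: "H = nlift n (complete_bigraph d c) \<pi>" "\<pi> \<in> lift_perms n (complete_bigraph d c)"
      by (auto simp: set_random_lift)
    have E: "bg_edges H \<subseteq> ?A \<times> ?B"
    proof
      fix y assume y: "y \<in> bg_edges H"
      obtain a k i m where e: "y = ((a, k), (i, m))" by (metis prod.exhaust)
      then have "a < d" "i < c" "k < n" "m = \<pi> (a, i) k"
        using y \<pi>(1) nlift_edge_iff[of a k i m n "complete_bigraph d c" \<pi>] by auto
      moreover then have "m < n"
        using permutes_in_image[OF lift_perms_permutes[OF \<pi>(2), of "(a, i)"], of k] by simp
      ultimately show "y \<in> ?A \<times> ?B" using e by simp
    qed
    obtain F where F: "F \<subseteq> bg_edges H" "finite F" "card F \<le> T" "card (fst ` F) + card (snd ` F) + card F div q < card F"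
      using H by (auto simp: sparse_upto_def not_le)
    have "F \<in> FF (card F)" "card F \<in> {1..T}" using F E by (auto simp: FF_def)
    then show "H \<in> (\<Union>f\<in>{1..T}. \<Union>F\<in>FF f. {H. F \<subseteq> bg_edges H})" using F(1) by blast
  qed
  have finFF: "finite (FF f)" for f
    by (rule finite_subset[of _ "Pow (?A \<times> ?B)"]) (auto simp: FF_def)
  have each: "real (card (FF f)) * (2 / real n) ^ f \<le> 1 / sqrt (real n)" if f: "f \<in> {1..T}" for f
  proof (cases "Suc (f div q) \<le> f")
    case True
    define g where "g = Suc (f div q)"
    define M where "M = 2 * (d + c) * T\<^sup>2"
    have M1: "1 \<le> M" using dc T by (auto simp: M_def)
    have "FF f \<subseteq> {F. F \<subseteq> ?A \<times> ?B \<and> card F = f \<and> card (fst ` F) + card (snd ` F) \<le> f - g}"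
      by (auto simp: FF_def g_def)
    then have "card (FF f) \<le> card {F. F \<subseteq> ?A \<times> ?B \<and> card F = f \<and> card (fst ` F) + card (snd ` F) \<le> f - g}"
      by (rule card_mono[rotated]) (rule finite_subset[of _ "Pow (?A \<times> ?B)"], auto)
    also have "\<dots> \<le> (card ?A + card ?B) ^ (f - g) * ((f - g) * (f - g)) ^ f"
      using f by (intro card_dense_sets) auto
    also have "card ?A + card ?B = (d + c) * n" by (simp add: algebra_simps)
    also have "((d + c) * n) ^ (f - g) * ((f - g) * (f - g)) ^ f \<le> ((d + c) ^ f * n ^ (f - g)) * (T\<^sup>2) ^ f"
      unfolding power_mult_distrib power2_eq_square using dc f
      by (intro mult_mono power_mono power_increasing) auto
    finally have "real (card (FF f)) \<le> real (((d + c) ^ f * n ^ (f - g)) * (T\<^sup>2) ^ f)"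
      by (rule of_nat_mono)
    then have "real (card (FF f)) * (2 / real n) ^ f \<le> real (((d + c) ^ f * n ^ (f - g)) * (T\<^sup>2) ^ f) * (2 / real n) ^ f"
      by (intro mult_right_mono) auto
    also have "\<dots> = real M ^ f * (real n ^ (f - g) / real n ^ f)"
    proof -
      have "real M ^ f = 2 ^ f * real ((d + c) ^ f) * real ((T\<^sup>2) ^ f)"
        by (simp only: M_def of_nat_mult of_nat_power power_mult_distrib of_nat_numeral)
      then show ?thesis by (simp add: power_divide)
    qed
    also have "real n ^ (f - g) / real n ^ f = 1 / real n ^ g"
      using True n by (simp add: g_def power_diff field_simps)
    also have "real M ^ f * (1 / real n ^ g) \<le> real M ^ (q * g) * (1 / real n ^ g)"
    proof (intro mult_right_mono power_increasing)
      have "f = q * (f div q) + f mod q" by simp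
      also have "\<dots> \<le> q * (f div q) + q" using q by (intro add_left_mono less_imp_le mod_less_divisor)
      finally show "f \<le> q * g" by (simp add: g_def)
    qed (use M1 n in auto)
    also have "\<dots> = (real M ^ q / real n) ^ g" by (simp add: power_mult power_divide)
    also have "\<dots> \<le> (1 / sqrt (real n)) ^ g"
    proof (rule power_mono)
      have "(real M ^ q)\<^sup>2 = real (M ^ (2 * q))" by (simp add: power_mult[symmetric] mult.commute)
      also have "\<dots> \<le> real n" using big unfolding M_def[symmetric] by (rule of_nat_mono)
      finally have "real M ^ q \<le> sqrt (real n)" by (intro real_le_rsqrt)
      then have "real M ^ q / real n \<le> sqrt (real n) / real n" by (intro divide_right_mono) auto
      also have "\<dots> = 1 / sqrt (real n)" using n by (simp add: real_div_sqrt field_simps)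
      finally show "real M ^ q / real n \<le> 1 / sqrt (real n)" .
    qed simp
    also have "\<dots> \<le> (1 / sqrt (real n)) ^ 1"
      using n by (intro power_decreasing) (auto simp: g_def)
    finally show ?thesis by simp
  next
    case False
    then have "FF f = {}" by (auto simp: FF_def)
    then show ?thesis using n by (simp only: card.empty) simp
  qed
  have "measure_pmf.prob ?M {H. \<not> sparse_upto T q (bg_edges H)} =
     measure_pmf.prob ?M ({H. \<not> sparse_upto T q (bg_edges H)} \<inter> set_pmf ?M)"
    by (simp add: measure_Int_set_pmf)
  also have "\<dots> \<le> measure_pmf.prob ?M (\<Union>f\<in>{1..T}. \<Union>F\<in>FF f. {H. F \<subseteq> bg_edges H})"
    by (intro measure_pmf.finite_measure_mono sub) auto
  also have "\<dots> \<le> (\<Sum>f\<in>{1..T}. measure_pmf.prob ?M (\<Union>F\<in>FF f. {H. F \<subseteq> bg_edges H}))"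
    by (intro measure_pmf.finite_measure_subadditive_finite) auto
  also have "\<dots> \<le> (\<Sum>f\<in>{1..T}. 1 / sqrt (real n))"
  proof (rule sum_mono)
    fix f assume f: "f \<in> {1..T}"
    have "measure_pmf.prob ?M (\<Union>F\<in>FF f. {H. F \<subseteq> bg_edges H}) \<le> (\<Sum>F\<in>FF f. measure_pmf.prob ?M {H. F \<subseteq> bg_edges H})"
      by (intro measure_pmf.finite_measure_subadditive_finite finFF) auto
    also have "\<dots> \<le> (\<Sum>F\<in>FF f. (2 / real n) ^ f)"
    proof (rule sum_mono)
      fix F assume F: "F \<in> FF f"
      then have "card F = f" "finite F" using f by (auto simp: FF_def intro: finite_subset)
      then show "measure_pmf.prob ?M {H. F \<subseteq> bg_edges H} \<le> (2 / real n) ^ f"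
        using lift_contains_prob[of "complete_bigraph d c" F n] f n(2) by simp
    qed
    also have "\<dots> \<le> 1 / sqrt (real n)" using each[OF f] by simp
    finally show "measure_pmf.prob ?M (\<Union>F\<in>FF f. {H. F \<subseteq> bg_edges H}) \<le> 1 / sqrt (real n)" .
  qed
  also have "\<dots> = real T / sqrt (real n)" by simp
  finally show ?thesis .
qed

lemma biregular_nlift:
  assumes \<pi>: "\<pi> \<in> lift_perms n (complete_bigraph d c)"
  shows "biregular c d (nlift n (complete_bigraph d c) \<pi>)"
    and "length (bg_variables (nlift n (complete_bigraph d c) \<pi>)) = c * n"
    and "card (bg_constraints (nlift n (complete_bigraph d c) \<pi>)) = d * n"
proof -
  let ?K = "complete_bigraph d c" and ?H = "nlift n (complete_bigraph d c) \<pi>"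
  have perm: "\<pi> (a, i) permutes {..<n}" if "a < d" "i < c" for a i
    using lift_perms_permutes[OF \<pi>, of "(a, i)"] that by simp
  have edge: "((a, k), (i, m)) \<in> bg_edges ?H \<longleftrightarrow> a < d \<and> i < c \<and> k < n \<and> m = \<pi> (a, i) k" for a k i m
    by (auto simp: nlift_edge_iff)
  show "biregular c d ?H" unfolding biregular_def
  proof (intro conjI ballI)
    show "finite (bg_constraints ?H)" by (simp add: nlift_def)
    show "distinct (bg_variables ?H)" by (simp add: nlift_def distinct_product)
    show "bg_edges ?H \<subseteq> bg_constraints ?H \<times> set (bg_variables ?H)"
    proof
      fix y assume y: "y \<in> bg_edges ?H"
      obtain a k i m where e: "y = ((a, k), (i, m))" by (metis prod.exhaust)
      then have "a < d" "i < c" "k < n" "m = \<pi> (a, i) k" using y edge by auto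
      moreover then have "m < n" using permutes_in_image[OF perm, of a i k] by simp
      ultimately show "y \<in> bg_constraints ?H \<times> set (bg_variables ?H)"
        using e by (simp add: nlift_def)
    qed
    fix x assume "x \<in> bg_constraints ?H"
    then obtain a k where x: "x = (a, k)" "a < d" "k < n" by (auto simp: nlift_def)
    have "nbrs ?H x = (\<lambda>i. (i, \<pi> (a, i) k)) ` {..<c}"
      using x by (auto simp: nbrs_def edge)
    then show "card (nbrs ?H x) = c" by (simp add: card_image inj_on_def)
  next
    fix y assume "y \<in> set (bg_variables ?H)"
    then obtain i m where y: "y = (i, m)" "i < c" "m < n" by (auto simp: nlift_def)
    have "{x. (x, y) \<in> bg_edges ?H} = (\<lambda>a. (a, inv_into UNIV (\<pi> (a, i)) m)) ` {..<d}"
    proof (intro equalityI subsetI)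
      fix x assume "x \<in> {x. (x, y) \<in> bg_edges ?H}"
      then obtain a k where x: "x = (a, k)" "a < d" "k < n" "m = \<pi> (a, i) k"
        using y by (cases x) (auto simp: edge)
      then have "k = inv_into UNIV (\<pi> (a, i)) m" using permutes_inverses[OF perm[OF x(2) y(2)]] by simp
      then show "x \<in> (\<lambda>a. (a, inv_into UNIV (\<pi> (a, i)) m)) ` {..<d}" using x by blast
    next
      fix x assume "x \<in> (\<lambda>a. (a, inv_into UNIV (\<pi> (a, i)) m)) ` {..<d}"
      then obtain a where a: "x = (a, inv_into UNIV (\<pi> (a, i)) m)" "a < d" by blast
      note p = perm[OF a(2) y(2)]
      have "inv_into UNIV (\<pi> (a, i)) m < n" using permutes_in_image[OF permutes_inv[OF p], of m] y by simp
      then show "x \<in> {x. (x, y) \<in> bg_edges ?H}"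
        using a y permutes_inverses[OF p] by (simp add: edge)
    qed
    then show "card {x. (x, y) \<in> bg_edges ?H} = d" by (simp add: card_image inj_on_def)
  qed
  show "length (bg_variables ?H) = c * n" "card (bg_constraints ?H) = d * n"
    by (simp_all add: nlift_def length_product card_cartesian_product)
qed


subsection \<open>The Laplacian of the primal graph\<close>

lemma eigenvalue_coords:
  fixes A :: "'a :: field mat"
  assumes A: "A \<in> carrier_mat n n" and ev: "eigenvalue A k"
  shows "\<exists>x. (\<exists>p<n. x p \<noteq> 0) \<and> (\<forall>p<n. (\<Sum>q<n. A $$ (p, q) * x q) = k * x p)"
proof -
  obtain v where v: "v \<in> carrier_vec n" "v \<noteq> 0\<^sub>v n" "A *\<^sub>v v = k \<cdot>\<^sub>v v"
    using ev A by (auto simp: eigenvalue_def eigenvector_def)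
  have "\<exists>p<n. vec_index v p \<noteq> 0"
  proof (rule ccontr)
    assume "\<not> ?thesis"
    then have "v = 0\<^sub>v n" using v(1) by (intro eq_vecI) auto
    then show False using v(2) by simp
  qed
  moreover have "(\<Sum>q<n. A $$ (p, q) * vec_index v q) = k * vec_index v p" if "p < n" for p
  proof -
    have "vec_index (A *\<^sub>v v) p = (\<Sum>q<n. A $$ (p, q) * vec_index v q)"
      using that A v(1) by (auto simp: scalar_prod_def atLeast0LessThan intro!: sum.cong)
    then show ?thesis using v that by simp
  qed
  ultimately show ?thesis by blast
qed

text \<open>\<open>lambda_max\<close> is a \<open>Max\<close>, meaningful only for a nonempty set.
  The complex spectrum is nonempty; for a complex eigenvector \<open>x\<close> the Hermitian form
  \<open>Q\<close> is its own conjugate and equals \<open>k * N\<close> with \<open>N > 0\<close>,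
  so \<open>k\<close> is real and a root of the real characteristic polynomial.\<close>

lemma symmetric_real_mat_has_eigenvalue:
  fixes A :: "real mat"
  assumes A: "A \<in> carrier_mat n n" and n: "0 < n"
    and sym: "\<And>p q. p < n \<Longrightarrow> q < n \<Longrightarrow> A $$ (p, q) = A $$ (q, p)"
  shows "\<exists>l. eigenvalue A l"
proof -
  let ?C = "map_mat complex_of_real A"
  have C: "?C \<in> carrier_mat n n" using A by simp
  obtain k where k: "eigenvalue ?C k" using spectrum_non_empty[OF C n] by (auto simp: spectrum_def)
  obtain x where x: "\<exists>p<n. x p \<noteq> 0" and ex: "\<And>p. p < n \<Longrightarrow> (\<Sum>q<n. ?C $$ (p, q) * x q) = k * x p"
    using eigenvalue_coords[OF C k] by blast
  have CA: "?C $$ (p, q) = complex_of_real (A $$ (p, q))" if "p < n" "q < n" for p q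
    using that A by auto
  define Q where "Q = (\<Sum>p<n. \<Sum>q<n. complex_of_real (A $$ (p, q)) * (cnj (x p) * x q))"
  define N where "N = (\<Sum>p<n. (cmod (x p))\<^sup>2)"
  have "Q = (\<Sum>p<n. cnj (x p) * (\<Sum>q<n. ?C $$ (p, q) * x q))"
    unfolding Q_def sum_distrib_left by (intro sum.cong refl) (auto simp: CA mult_ac)
  also have "\<dots> = (\<Sum>p<n. k * complex_of_real ((cmod (x p))\<^sup>2))"
  proof (intro sum.cong refl)
    fix p assume "p \<in> {..<n}"
    then have "(\<Sum>q<n. ?C $$ (p, q) * x q) = k * x p" by (intro ex) simp
    then have "cnj (x p) * (\<Sum>q<n. ?C $$ (p, q) * x q) = k * (x p * cnj (x p))"
      by (simp only: mult_ac)
    then show "cnj (x p) * (\<Sum>q<n. ?C $$ (p, q) * x q) = k * complex_of_real ((cmod (x p))\<^sup>2)"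
      by (simp only: complex_norm_square)
  qed
  also have "\<dots> = k * complex_of_real N" by (simp add: N_def sum_distrib_left)
  finally have QN: "Q = k * complex_of_real N" .
  have "cnj Q = (\<Sum>p<n. \<Sum>q<n. complex_of_real (A $$ (p, q)) * (x p * cnj (x q)))"
    by (simp add: Q_def)
  also have "\<dots> = (\<Sum>q<n. \<Sum>p<n. complex_of_real (A $$ (p, q)) * (x p * cnj (x q)))"
    by (rule sum.swap)
  also have "\<dots> = Q" unfolding Q_def
    by (intro sum.cong refl) (auto simp: sym mult_ac)
  finally have "cnj Q = Q" .
  then have "cnj k * complex_of_real N = k * complex_of_real N" using QN by simp
  moreover have "0 < N"
  proof -
    obtain p where "p < n" "x p \<noteq> 0" using x by blast
    then show ?thesis unfolding N_def by (intro sum_pos2[of _ p]) auto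
  qed
  ultimately have "cnj k = k" by simp
  then have k_real: "k = complex_of_real (Re k)" by (simp add: complex_eq_iff)
  have "poly (map_poly complex_of_real (char_poly A)) (complex_of_real (Re k)) = 0"
  proof -
    have "char_poly ?C = map_poly complex_of_real (char_poly A)" by (rule of_real_hom.char_poly_hom[OF A])
    moreover have "poly (char_poly ?C) k = 0" using k eigenvalue_root_char_poly[OF C] by blast
    ultimately show ?thesis using k_real by simp
  qed
  then have "poly (char_poly A) (Re k) = 0"
    by (simp add: of_real_hom.poly_map_poly)
  then show ?thesis using eigenvalue_root_char_poly[OF A] by blast
qed

lemma lambda_max_eigenvalue:
  fixes A :: "real mat"
  assumes A: "A \<in> carrier_mat n n" and n: "0 < n"
    and sym: "\<And>p q. p < n \<Longrightarrow> q < n \<Longrightarrow> A $$ (p, q) = A $$ (q, p)"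
  shows "eigenvalue A (lambda_max A)"
proof -
  have "finite {l. eigenvalue A l}" using card_finite_spectrum(1)[OF A] by (simp add: spectrum_def)
  moreover have "{l. eigenvalue A l} \<noteq> {}" using symmetric_real_mat_has_eigenvalue[OF assms] by blast
  ultimately show ?thesis unfolding lambda_max_def using Max_in by blast
qed

lemma laplacian_carrier:
  "laplacian I \<in> carrier_mat (length (xor_variables I)) (length (xor_variables I))"
  unfolding laplacian_def Let_def by (intro minus_carrier_mat mat_carrier)

lemma laplacian_index:
  "p < length (xor_variables I) \<Longrightarrow> q < length (xor_variables I) \<Longrightarrow>
    laplacian I $$ (p, q) = (if p = q then real (xor_degree I (xor_variables I ! p)) else 0)
      - xor_adj I (xor_variables I ! p) (xor_variables I ! q)"
  by (simp add: laplacian_def Let_def)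

lemma xor_adj_commute: "xor_adj I i j = xor_adj I j i"
  by (simp add: xor_adj_def insert_commute)

lemma doubleton_card2: "i \<in> e \<Longrightarrow> card e = 2 \<Longrightarrow> \<exists>j. j \<noteq> i \<and> e = {i, j}"
  by (auto simp: card_2_iff)

locale signed_biregular = biregular_graph G c d
  for G :: "('a, 'v) bigraph" and c d :: nat +
  fixes \<xi> :: "'a \<times> 'v \<Rightarrow> real"
  assumes signs: "e \<in> bg_edges G \<Longrightarrow> \<xi> e \<in> {-1, 1}"
begin

abbreviation "J \<equiv> primal (G, \<xi>)"

definition triples :: "('a \<times> 'v set) set" where
  "triples = {(a, e). a \<in> bg_constraints G \<and> e \<subseteq> nbrs G a \<and> card e = 2}"

lemma triples_Sigma: "triples = (SIGMA a:bg_constraints G. {e. e \<subseteq> nbrs G a \<and> card e = 2})"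
  by (auto simp: triples_def)

lemma finite_constraints: "finite (bg_constraints G)" using breg by (simp add: biregular_def)

lemma finite_triples: "finite triples"
  unfolding triples_Sigma using finite_constraints finite_nbrs(1) by (intro finite_SigmaI) auto

lemma xor_variables_J: "xor_variables J = bg_variables G"
  by (simp add: primal_def)

lemma xor_constraints_J:
  "xor_constraints J = image_mset (\<lambda>(a, e). (e, \<Prod>i\<in>e. \<xi> (a, i))) (mset_set triples)"
  by (simp add: primal_def triples_def)

lemma wf_J: "wf_xor_instance J"
  unfolding wf_xor_instance_def xor_variables_J
proof (intro conjI)
  show "distinct (bg_variables G)" using breg by (simp add: biregular_def)
  have "e \<subseteq> set (bg_variables G) \<and> card e = 2 \<and> (\<Prod>i\<in>e. \<xi> (a, i)) \<in> {-1, 1}"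
    if "(a, e) \<in> triples" for a e
  proof -
    have e: "e \<subseteq> nbrs G a" "card e = 2" using that by (auto simp: triples_def)
    then obtain i j where ij: "e = {i, j}" "i \<noteq> j" by (auto simp: card_2_iff)
    have "(a, i) \<in> bg_edges G" "(a, j) \<in> bg_edges G" using e ij by (auto simp: nbrs_def)
    then show ?thesis using e ij signs[of "(a, i)"] signs[of "(a, j)"] edge_ends by auto
  qed
  then show "\<forall>(e, s)\<in>#xor_constraints J. e \<subseteq> set (bg_variables G) \<and> card e = 2 \<and> s \<in> {-1, 1}"
    using finite_triples by (auto simp: xor_constraints_J)
qed

lemma size_J: "size (xor_constraints J) = card (bg_constraints G) * (c choose 2)"
proof -
  have "size (xor_constraints J) = card triples" by (simp add: xor_constraints_J)
  also have "\<dots> = (\<Sum>a\<in>bg_constraints G. card {e. e \<subseteq> nbrs G a \<and> card e = 2})"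
    unfolding triples_Sigma using finite_constraints finite_nbrs(1) by (intro card_SigmaI) auto
  also have "\<dots> = (\<Sum>a\<in>bg_constraints G. c choose 2)"
    using breg finite_nbrs(1) by (intro sum.cong refl) (simp add: n_subsets biregular_def)
  finally show ?thesis by simp
qed

lemma xor_degree_J:
  assumes i: "i \<in> set (bg_variables G)"
  shows "xor_degree J i = (c - 1) * d"
proof -
  have "xor_degree J i = card {z \<in> triples. i \<in> snd z}"
    using finite_triples
    by (simp add: xor_degree_def xor_constraints_J filter_mset_image_mset case_prod_unfold o_def filter_mset_mset_set)
  also have "\<dots> = card (SIGMA a:{a. (a, i) \<in> bg_edges G}. nbrs G a - {i})"
  proof (rule bij_betw_same_card[symmetric])
    show "bij_betw (\<lambda>(a, j). (a, {i, j})) (SIGMA a:{a. (a, i) \<in> bg_edges G}. nbrs G a - {i}) {z \<in> triples. i \<in> snd z}"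
    proof (rule bij_betw_imageI)
      show "inj_on (\<lambda>(a, j). (a, {i, j})) (SIGMA a:{a. (a, i) \<in> bg_edges G}. nbrs G a - {i})"
        by (auto simp: inj_on_def doubleton_eq_iff)
      show "(\<lambda>(a, j). (a, {i, j})) ` (SIGMA a:{a. (a, i) \<in> bg_edges G}. nbrs G a - {i}) = {z \<in> triples. i \<in> snd z}"
      proof (intro equalityI subsetI)
        fix z assume "z \<in> (\<lambda>(a, j). (a, {i, j})) ` (SIGMA a:{a. (a, i) \<in> bg_edges G}. nbrs G a - {i})"
        then show "z \<in> {z \<in> triples. i \<in> snd z}"
          using edge_ends by (auto simp: triples_def nbrs_def)
      next
        fix z assume "z \<in> {z \<in> triples. i \<in> snd z}"
        then obtain a e where z: "z = (a, e)" "e \<subseteq> nbrs G a" "card e = 2" "i \<in> e"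
          by (auto simp: triples_def)
        then obtain j where j: "j \<noteq> i" "e = {i, j}" using doubleton_card2 by metis
        have "(a, j) \<in> (SIGMA a:{a. (a, i) \<in> bg_edges G}. nbrs G a - {i})"
          using z j by (auto simp: nbrs_def)
        then show "z \<in> (\<lambda>(a, j). (a, {i, j})) ` (SIGMA a:{a. (a, i) \<in> bg_edges G}. nbrs G a - {i})"
          using z(1) j(2) by (force simp: image_iff)
      qed
    qed
  qed
  also have "\<dots> = (\<Sum>a | (a, i) \<in> bg_edges G. card (nbrs G a - {i}))"
    using finite_nbrs by (intro card_SigmaI) auto
  also have "\<dots> = (\<Sum>a | (a, i) \<in> bg_edges G. c - 1)"
    using finite_nbrs card_nbrs(1) by (intro sum.cong refl) (auto simp: nbrs_def)
  also have "\<dots> = (c - 1) * d" using breg i by (simp add: biregular_def mult.commute)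
  finally show ?thesis .
qed

lemma xor_adj_J:
  "xor_adj J i j = (if i = j then 0 else \<Sum>a | (a, i) \<in> bg_edges G \<and> (a, j) \<in> bg_edges G. \<xi> (a, i) * \<xi> (a, j))"
proof -
  have "xor_adj J i j = (\<Sum>z\<in>#mset_set {z \<in> triples. snd z = {i, j}}. \<Prod>k\<in>snd z. \<xi> (fst z, k))"
    using finite_triples
    by (simp add: xor_adj_def xor_constraints_J filter_mset_image_mset case_prod_unfold o_def
        filter_mset_mset_set image_mset.compositionality)
  also have "\<dots> = (\<Sum>z | z \<in> triples \<and> snd z = {i, j}. \<Prod>k\<in>snd z. \<xi> (fst z, k))"
    by (simp only: sum_unfold_sum_mset)
  also have "\<dots> = (if i = j then 0 else \<Sum>a | (a, i) \<in> bg_edges G \<and> (a, j) \<in> bg_edges G. \<xi> (a, i) * \<xi> (a, j))"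
  proof (cases "i = j")
    case True
    then have "{z. z \<in> triples \<and> snd z = {i, j}} = {}" by (auto simp: triples_def)
    then show ?thesis using True by (simp only: sum.empty) simp
  next
    case False
    have "{z. z \<in> triples \<and> snd z = {i, j}} = (\<lambda>a. (a, {i, j})) ` {a. (a, i) \<in> bg_edges G \<and> (a, j) \<in> bg_edges G}"
      using False edge_ends by (auto simp: triples_def nbrs_def image_iff)
    moreover have "inj_on (\<lambda>a. (a, {i, j})) {a. (a, i) \<in> bg_edges G \<and> (a, j) \<in> bg_edges G}"
      by (auto simp: inj_on_def)
    ultimately show ?thesis using False by (simp add: sum.reindex)
  qed
  finally show ?thesis .
qed

text \<open>The primal adjacency matrix is the off-diagonal part of \<open>B\<^sup>T * B\<close>,
  whose diagonal is \<open>d\<close> because signs square to 1. With degrees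
  \<open>(c - 1) * d\<close> this gives the Laplacian \<open>c * d - B\<^sup>T * B\<close>.\<close>

lemma eigenfunction_of_laplacian:
  assumes l: "eigenvalue (laplacian J) l" and c: "1 \<le> c"
  shows "\<exists>f. signed_eigenfunction G c d \<xi> f (real c * real d - l) \<and> (\<exists>i\<in>set (bg_variables G). f i \<noteq> 0)"
proof -
  let ?vs = "bg_variables G" let ?N = "length ?vs" let ?V = "set ?vs"
  have dist: "distinct ?vs" using breg by (simp add: biregular_def)
  obtain x where x: "\<exists>p<?N. x p \<noteq> 0" and ex: "\<And>p. p < ?N \<Longrightarrow> (\<Sum>q<?N. laplacian J $$ (p, q) * x q) = l * x p"
    using eigenvalue_coords[OF laplacian_carrier[of J] l] by (auto simp: xor_variables_J)
  define f where "f i = x (inv_into {..<?N} ((!) ?vs) i)" for i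
  have fx: "f (?vs ! p) = x p" if "p < ?N" for p
    using that inj_on_nth[OF dist, of "{..<?N}"] by (simp add: f_def inv_into_f_f)
  have "(\<Sum>a | (a, i) \<in> bg_edges G. \<xi> (a, i) * (\<Sum>j\<in>nbrs G a. \<xi> (a, j) * f j)) = (real c * real d - l) * f i"
    if i: "i \<in> ?V" for i
  proof -
    obtain p where p: "p < ?N" "i = ?vs ! p" using i by (metis in_set_conv_nth)
    have "l * f i = (\<Sum>q<?N. laplacian J $$ (p, q) * x q)" using ex[OF p(1)] fx[OF p(1)] p(2) by simp
    also have "\<dots> = (\<Sum>q<?N. (if q = p then real ((c - 1) * d) * x p else 0) - xor_adj J i (?vs ! q) * f (?vs ! q))"
      using p i by (intro sum.cong refl) (auto simp: laplacian_index xor_variables_J xor_degree_J fx algebra_simps)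
    also have "\<dots> = real ((c - 1) * d) * f i - (\<Sum>q<?N. xor_adj J i (?vs ! q) * f (?vs ! q))"
      using p fx[OF p(1)] by (simp add: sum_subtractf)
    also have "(\<Sum>q<?N. xor_adj J i (?vs ! q) * f (?vs ! q)) = (\<Sum>j\<in>?V. xor_adj J i j * f j)"
      using bij_betw_nth[OF dist, of "{..<?N}" ?V]
      by (intro sum.reindex_bij_betw[of "(!) ?vs" "{..<?N}" ?V "\<lambda>j. xor_adj J i j * f j"]) simp
    also have "\<dots> = (\<Sum>j\<in>?V. \<Sum>a | (a, i) \<in> bg_edges G. if j \<in> nbrs G a - {i} then \<xi> (a, i) * \<xi> (a, j) * f j else 0)"
    proof (intro sum.cong refl)
      fix j
      show "xor_adj J i j * f j = (\<Sum>a | (a, i) \<in> bg_edges G. if j \<in> nbrs G a - {i} then \<xi> (a, i) * \<xi> (a, j) * f j else 0)"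
      proof (cases "i = j")
        case False
        have "xor_adj J i j * f j = (\<Sum>a\<in>{a. (a, i) \<in> bg_edges G} \<inter> {a. (a, j) \<in> bg_edges G}. \<xi> (a, i) * \<xi> (a, j) * f j)"
          using False by (simp add: xor_adj_J sum_distrib_right Int_def)
        also have "\<dots> = (\<Sum>a | (a, i) \<in> bg_edges G. if a \<in> {a. (a, j) \<in> bg_edges G} then \<xi> (a, i) * \<xi> (a, j) * f j else 0)"
          using finite_nbrs(2) by (subst sum.inter_restrict) auto
        finally show ?thesis using False by (simp add: nbrs_def)
      qed (simp add: xor_adj_J)
    qed
    also have "\<dots> = (\<Sum>a | (a, i) \<in> bg_edges G. \<Sum>j\<in>?V. if j \<in> nbrs G a - {i} then \<xi> (a, i) * \<xi> (a, j) * f j else 0)"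
      by (rule sum.swap)
    also have "\<dots> = (\<Sum>a | (a, i) \<in> bg_edges G. \<xi> (a, i) * (\<Sum>j\<in>nbrs G a. \<xi> (a, j) * f j) - f i)"
    proof (intro sum.cong refl)
      fix a assume "a \<in> {a. (a, i) \<in> bg_edges G}"
      then have a: "(a, i) \<in> bg_edges G" by simp
      have sq: "\<xi> (a, i) * \<xi> (a, i) = 1" using signs[OF a] by auto
      have sub: "?V \<inter> (nbrs G a - {i}) = nbrs G a - {i}" using edge_ends by (auto simp: nbrs_def)
      have "(\<Sum>j\<in>?V. if j \<in> nbrs G a - {i} then \<xi> (a, i) * \<xi> (a, j) * f j else 0) =
        (\<Sum>j\<in>nbrs G a - {i}. \<xi> (a, i) * \<xi> (a, j) * f j)"
        using sum.inter_restrict[of ?V "\<lambda>j. \<xi> (a, i) * \<xi> (a, j) * f j" "nbrs G a - {i}"] sub by simp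
      also have "\<dots> = \<xi> (a, i) * (\<Sum>j\<in>nbrs G a. \<xi> (a, j) * f j) - (\<xi> (a, i) * \<xi> (a, i)) * f i"
        using a finite_nbrs(1) by (simp add: sum_diff1 nbrs_def sum_distrib_left algebra_simps)
      finally show "(\<Sum>j\<in>?V. if j \<in> nbrs G a - {i} then \<xi> (a, i) * \<xi> (a, j) * f j else 0) =
        \<xi> (a, i) * (\<Sum>j\<in>nbrs G a. \<xi> (a, j) * f j) - f i" using sq by simp
    qed
    also have "\<dots> = (\<Sum>a | (a, i) \<in> bg_edges G. \<xi> (a, i) * (\<Sum>j\<in>nbrs G a. \<xi> (a, j) * f j)) - real d * f i"
      using breg i by (simp add: sum_subtractf biregular_def)
    finally have "l * f i = real ((c - 1) * d) * f i
       - ((\<Sum>a | (a, i) \<in> bg_edges G. \<xi> (a, i) * (\<Sum>j\<in>nbrs G a. \<xi> (a, j) * f j)) - real d * f i)" .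
    then show ?thesis using c by (simp add: of_nat_diff algebra_simps)
  qed
  moreover have "\<xi> e * \<xi> e = 1" if "e \<in> bg_edges G" for e using signs[OF that] by auto
  ultimately have "signed_eigenfunction G c d \<xi> f (real c * real d - l)"
    by unfold_locales auto
  moreover have "\<exists>i\<in>?V. f i \<noteq> 0" using x fx by (metis nth_mem)
  ultimately show ?thesis by blast
qed

end


subsection \<open>The spectral bound for random signed lifts\<close>

text \<open>\<open>B\<close> is the exceptional event of the first stage, on which the second stage
  is bounded trivially by 1.\<close>

lemma prob_bind_pmf_le:
  assumes "\<And>x. x \<in> set_pmf M \<Longrightarrow> x \<notin> B \<Longrightarrow> measure_pmf.prob (f x) A \<le> \<delta>" and "0 \<le> \<delta>"
  shows "measure_pmf.prob (bind_pmf M f) A \<le> measure_pmf.prob M B + \<delta>"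
proof -
  have "emeasure (measure_pmf (bind_pmf M f)) A = (\<integral>\<^sup>+x. emeasure (measure_pmf (f x)) A \<partial>measure_pmf M)"
    by simp
  also have "\<dots> \<le> (\<integral>\<^sup>+x. indicator B x + ennreal \<delta> \<partial>measure_pmf M)"
  proof (intro nn_integral_mono_AE AE_pmfI)
    fix x assume x: "x \<in> set_pmf M"
    have "emeasure (measure_pmf (f x)) A \<le> 1" by (rule measure_pmf.emeasure_le_1)
    moreover have "emeasure (measure_pmf (f x)) A \<le> ennreal \<delta>" if "x \<notin> B"
      using assms(1)[OF x that] by (simp add: measure_pmf.emeasure_eq_measure ennreal_leI)
    ultimately show "emeasure (measure_pmf (f x)) A \<le> indicator B x + ennreal \<delta>"
      by (cases "x \<in> B") (auto intro: order_trans)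
  qed
  also have "\<dots> = ennreal (measure_pmf.prob M B + \<delta>)"
    using assms(2) by (simp add: nn_integral_add measure_pmf.emeasure_eq_measure)
  finally have "ennreal (measure_pmf.prob (bind_pmf M f) A) \<le> ennreal (measure_pmf.prob M B + \<delta>)"
    by (simp only: measure_pmf.emeasure_eq_measure)
  then show ?thesis using assms(2) by (subst (asm) ennreal_le_iff) auto
qed

lemma sparse_upto_bedges:
  assumes sp: "sparse_upto T q (bg_edges G)" and F: "F \<subseteq> bedges G" "card F \<le> T" "finite (bg_edges G)"
  shows "card F \<le> card (\<Union>F) + card F div q"
proof -
  let ?s = "\<lambda>(a, i). {Inl a, Inr i}"
  obtain P where P: "P \<subseteq> bg_edges G" "F = ?s ` P"
    using F(1) unfolding bedges_def by (meson subset_imageE)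
  have finP: "finite P" using P(1) F(3) by (rule finite_subset)
  have "inj_on ?s P" by (auto simp: inj_on_def doubleton_eq_iff)
  then have cF: "card F = card P" using P(2) by (simp add: card_image)
  have U: "\<Union>F = Inl ` fst ` P \<union> Inr ` snd ` P" unfolding P(2) by force
  have "card (\<Union>F) = card (fst ` P) + card (snd ` P)"
    unfolding U using finP by (subst card_Un_disjoint) (auto simp: card_image)
  then show ?thesis using sp P(1) finP F(2) cF by (simp add: sparse_upto_def)
qed

text \<open>Markov's inequality for the squared Frobenius norm of the walk matrix of length
  \<open>2 * Suc k\<close>, whose hikes have length \<open>T = 4 * Suc k\<close>. The threshold
  \<open>\<theta>\<close> is the square of the growth bound and contains
  \<open>\<rho> ^ (2 * Suc k)\<close>, exactly the power of \<open>\<rho>\<close> in the count of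
  hikes, so only \<open>s ^ (2 * k) * \<gamma>\<^sup>2\<close> survives.\<close>

lemma (in biregular_graph) bad_signing_prob:
  fixes s :: real and k r T :: nat
  assumes cd: "2 \<le> c" "c \<le> d" "3 \<le> d" and s: "1 < s" and r: "0 < r" "4 * r \<le> T"
    and T: "T = 4 * Suc k" and sp: "sparse_upto T (4 * r) (bg_edges G)"
  defines "\<rho> \<equiv> sqrt (real c - 1) * sqrt (real d - 1)"
  defines "\<gamma> \<equiv> s - 1 / ((real d - 1) * s) - (real c - 2) / \<rho>"
  shows "measure_pmf.prob (random_signing G) {\<xi>. \<exists>f \<mu>. signed_eigenfunction G c d \<xi> f \<mu> \<and>
      (\<exists>i\<in>set (bg_variables G). f i \<noteq> 0) \<and> (s + 1 / s) * \<rho> \<le> (real c - 1) + (real d - 1) - \<mu>}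
    \<le> real (length (bg_variables G)) *
      (real (Suc T) * (real d)\<^sup>2 + real (Suc r * Suc T * ((Suc r)\<^sup>2 + 1))) ^ (2 * (T div r) + 6)
      / (s ^ (2 * k) * \<gamma>\<^sup>2)"
    (is "measure_pmf.prob ?M ?bad \<le> real ?N * ?Q ^ ?P / _")
proof -
  let ?V = "set (bg_variables G)" and ?E = "bedges G"
  let ?m = "2 * Suc k"
  let ?Z = "\<lambda>\<xi>. \<Sum>i\<in>?V. \<Sum>v\<in>?V. (walk_sum \<xi> ?m i v)\<^sup>2"
  have \<rho>2: "\<rho>\<^sup>2 = (real c - 1) * (real d - 1)"
    using cd by (simp add: \<rho>_def power_mult_distrib)
  have "1 * 1 \<le> (real c - 1) * (real d - 1)" using cd by (intro mult_mono) auto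
  then have "1\<^sup>2 \<le> \<rho>\<^sup>2" using \<rho>2 by simp
  moreover have "0 \<le> \<rho>" using cd by (simp add: \<rho>_def)
  ultimately have \<rho>1: "1 \<le> \<rho>" using power2_le_imp_le by blast
  have \<gamma>: "0 < \<gamma>" unfolding \<gamma>_def using cd s \<rho>1 \<rho>2 by (intro growth_rate_pos) auto
  define \<theta> where "\<theta> = (\<rho> * (s * \<rho>) ^ k * \<gamma>)\<^sup>2"
  have \<theta>_eq: "\<theta> = \<rho> ^ ?m * (s ^ (2 * k) * \<gamma>\<^sup>2)"
    by (simp add: \<theta>_def power_mult_distrib power2_eq_square power_mult mult_ac)
  have \<theta>0: "0 < \<theta>" unfolding \<theta>_def using \<rho>1 s \<gamma> by simp
  have "?bad \<subseteq> {\<xi>. \<theta> \<le> ?Z \<xi>}"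
  proof clarify
    fix \<xi> f \<mu> i assume ef: "signed_eigenfunction G c d \<xi> f \<mu>" and i: "i \<in> ?V" "f i \<noteq> 0"
      and \<mu>: "(s + 1 / s) * \<rho> \<le> (real c - 1) + (real d - 1) - \<mu>"
    interpret signed_eigenfunction G c d \<xi> f \<mu> by (rule ef)
    have "\<rho> * (s * \<rho>) ^ k * \<gamma> \<le> \<bar>nb_poly c d \<mu> k\<bar>" unfolding \<gamma>_def
      by (rule nb_poly_growth) (use \<rho>1 \<rho>2 s cd \<mu> \<gamma> in \<open>simp_all add: \<gamma>_def\<close>)
    moreover have "0 \<le> \<rho> * (s * \<rho>) ^ k * \<gamma>" using \<rho>1 s \<gamma> by simp
    ultimately have "\<theta> \<le> \<bar>nb_poly c d \<mu> k\<bar>\<^sup>2" unfolding \<theta>_def by (rule power_mono)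
    also have "\<dots> = (nb_poly c d \<mu> k)\<^sup>2" by simp
    also have "\<dots> \<le> ?Z \<xi>" by (rule frobenius_bound) (use cd i in auto)
    finally show "\<theta> \<le> ?Z \<xi>" .
  qed
  then have "measure_pmf.prob ?M ?bad \<le> measure_pmf.prob ?M {\<xi>. \<theta> \<le> ?Z \<xi>}"
    by (intro measure_pmf.finite_measure_mono) auto
  also have "\<dots> = measure_pmf.expectation ?M (indicator {\<xi>. \<theta> \<le> ?Z \<xi>})" by simp
  also have "\<dots> \<le> measure_pmf.expectation ?M (\<lambda>\<xi>. ?Z \<xi> / \<theta>)"
  proof (intro integral_mono)
    have fin: "finite (set_pmf ?M)" unfolding random_signing_def
      using finite_bg_edges by (subst set_Pi_pmf) (auto intro!: finite_PiE_dflt simp: o_def)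
    show "integrable ?M (\<lambda>\<xi>. ?Z \<xi> / \<theta>)" "integrable ?M (indicator {\<xi>. \<theta> \<le> ?Z \<xi>} :: _ \<Rightarrow> real)"
      by (rule integrable_measure_pmf_finite[OF fin])+
    show "indicator {\<xi>. \<theta> \<le> ?Z \<xi>} \<xi> \<le> ?Z \<xi> / \<theta>" for \<xi>
    proof (cases "\<theta> \<le> ?Z \<xi>")
      case False
      have "0 \<le> ?Z \<xi>" by (intro sum_nonneg) auto
      then show ?thesis using False \<theta>0 by simp
    qed (use \<theta>0 in simp)
  qed
  also have "\<dots> = measure_pmf.expectation ?M ?Z / \<theta>" by simp
  also have "\<dots> \<le> (\<Sum>i\<in>?V. real (card (hikes ?E (2 * ?m) ?m (Inr i)))) / \<theta>"
    using expectation_walk_sum[of ?m] \<theta>0 by (intro divide_right_mono) auto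
  also have "\<dots> \<le> (\<Sum>i\<in>?V. \<rho> ^ ?m * ?Q ^ ?P) / \<theta>"
  proof (intro divide_right_mono sum_mono)
    fix i
    have T2: "2 * ?m = T" "T div 2 = ?m" using T by auto
    have "real (card (hikes ?E T ?m (Inr i))) \<le> \<rho> ^ (T div 2) * ?Q ^ ?P"
    proof (rule conjunct2[OF card_hikes])
      show "card F \<le> card (\<Union>F) + card F div (4 * r)" if "F \<subseteq> ?E" "card F \<le> T" for F
        using sparse_upto_bedges[OF sp that finite_bg_edges] .
      show "real (card (nbw ?E j x)) \<le> (real d)\<^sup>2 * \<rho> ^ j" for j x
        using \<rho>1 \<rho>2 cd by (intro card_nbw_le) (auto simp: of_nat_diff)
    qed (use r \<rho>1 in auto)
    then show "real (card (hikes ?E (2 * ?m) ?m (Inr i))) \<le> \<rho> ^ ?m * ?Q ^ ?P" using T2 by simp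
  qed (use \<theta>0 in simp)
  also have "\<dots> = real (card ?V) * ?Q ^ ?P / (s ^ (2 * k) * \<gamma>\<^sup>2)"
    using \<rho>1 unfolding \<theta>_eq by simp
  also have "card ?V = ?N" using breg by (simp add: biregular_def distinct_card)
  finally show ?thesis .
qed

lemma set_random_signing:
  assumes "finite (bg_edges G)" "\<xi> \<in> set_pmf (random_signing G)" "e \<in> bg_edges G"
  shows "\<xi> e \<in> {-1, 1}"
  using assms unfolding random_signing_def by (cases e) (auto simp: set_Pi_pmf PiE_dflt_def)

lemma set_random_signed_lift:
  assumes "(H, \<xi>) \<in> set_pmf (random_signed_lift n (complete_bigraph d c))"
  shows "signed_biregular H c d \<xi>" "length (bg_variables H) = c * n" "card (bg_constraints H) = d * n"
proof -
  have H: "H \<in> set_pmf (random_lift n (complete_bigraph d c))" and \<xi>: "\<xi> \<in> set_pmf (random_signing H)"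
    using assms by (auto simp: random_signed_lift_def)
  obtain \<pi> where \<pi>: "H = nlift n (complete_bigraph d c) \<pi>" "\<pi> \<in> lift_perms n (complete_bigraph d c)"
    using H by (auto simp: set_random_lift)
  interpret biregular_graph H c d by unfold_locales (simp add: \<pi> biregular_nlift)
  show "signed_biregular H c d \<xi>"
    by unfold_locales (rule set_random_signing[OF finite_bg_edges \<xi>])
  show "length (bg_variables H) = c * n" "card (bg_constraints H) = d * n"
    using biregular_nlift[OF \<pi>(2)] \<pi>(1) by auto
qed

text \<open>The prefactor in \<open>EIG\<close> equals \<open>1 / (2 * \<kappa>)\<close> with
  \<open>\<kappa> = (c - 1) * d\<close>, and \<open>lambda_max\<close> is attained, so
  \<open>\<mu>\<close> is \<open>c * d\<close> minus it.\<close>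

lemma EIG_large_imp_eigenfunction:
  assumes sb: "signed_biregular H c d \<xi>" and N: "length (bg_variables H) = c * n" "card (bg_constraints H) = d * n"
    and n: "0 < n" and cd: "2 \<le> c" "1 \<le> d"
    and E: "t / (2 * real ((c - 1) * d)) \<le> EIG (primal (H, \<xi>))"
  shows "\<exists>f \<mu>. signed_eigenfunction H c d \<xi> f \<mu> \<and> (\<exists>i\<in>set (bg_variables H). f i \<noteq> 0) \<and>
    t \<le> real c * real d - \<mu>"
proof -
  interpret signed_biregular H c d \<xi> by (rule sb)
  let ?l = "lambda_max (laplacian J)"
  have c2: "2 * real (c choose 2) = real c * (real c - 1)"
  proof -
    have "even (c * (c - 1))" by (cases c) auto
    then have "2 * (c choose 2) = c * (c - 1)" unfolding choose_two by (rule dvd_mult_div_cancel)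
    then have "real (2 * (c choose 2)) = real (c * (c - 1))" by simp
    then show ?thesis using cd by (simp add: of_nat_diff)
  qed
  have "EIG J = real (c * n) / (4 * real (d * n * (c choose 2))) * ?l"
    by (simp add: EIG_def size_J N xor_variables_J)
  also have "real (c * n) / (4 * real (d * n * (c choose 2))) = real c * real n / (2 * (real d * real n * (2 * real (c choose 2))))"
    by simp
  also have "\<dots> = 1 / (2 * real ((c - 1) * d))"
    unfolding c2 using n cd by (simp add: of_nat_diff field_simps)
  finally have "t / (2 * real ((c - 1) * d)) \<le> ?l / (2 * real ((c - 1) * d))" using E by simp
  moreover have "0 < 2 * real ((c - 1) * d)" using cd by simp
  ultimately have t: "t \<le> ?l" by (simp only: divide_le_cancel)
  have "eigenvalue (laplacian J) ?l"
  proof (rule lambda_max_eigenvalue[OF laplacian_carrier])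
    show "0 < length (xor_variables J)" using N n cd by (simp add: xor_variables_J)
    show "laplacian J $$ (p, q) = laplacian J $$ (q, p)"
      if "p < length (xor_variables J)" "q < length (xor_variables J)" for p q
      using that xor_adj_commute[of J "xor_variables J ! p" "xor_variables J ! q"]
      by (simp add: laplacian_index)
  qed
  then obtain f where "signed_eigenfunction H c d \<xi> f (real c * real d - ?l)" "\<exists>i\<in>set (bg_variables H). f i \<noteq> 0"
    using eigenfunction_of_laplacian cd by force
  then show ?thesis using t by (intro exI[of _ f] exI[of _ "real c * real d - ?l"]) auto
qed

text \<open>Since \<open>(1 + \<rho>)\<^sup>2 = 1 + 2 * \<rho> + (c - 1) * (d - 1)\<close>, a large
  eigenvalue bound means \<open>(c - 1) + (d - 1) - \<mu> \<ge> 2 * \<rho> + 2 * \<kappa> *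
  \<epsilon>\<close>, where \<open>\<kappa> = (c - 1) * d\<close>; \<open>s\<epsilon>\<close> turns
  this into the growth condition. The exponent \<open>8 * r\<close> is \<open>2 * q\<close> for the
  sparsity ratio \<open>q = 4 * r\<close>.\<close>

lemma EIG_tail_bound:
  fixes s \<epsilon> :: real and k r T n :: nat
  assumes cd: "2 \<le> c" "c \<le> d" "3 \<le> d" and s: "1 < s" and r: "0 < r" "4 * r \<le> T" and T: "T = 4 * Suc k"
    and n: "2 * T \<le> n" and big: "(2 * (d + c) * T\<^sup>2) ^ (8 * r) \<le> n"
  defines "\<rho> \<equiv> sqrt (real c - 1) * sqrt (real d - 1)"
  assumes s\<epsilon>: "(s + 1 / s) * \<rho> \<le> 2 * \<rho> + 2 * real ((c - 1) * d) * \<epsilon>"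
  defines "\<gamma> \<equiv> s - 1 / ((real d - 1) * s) - (real c - 2) / \<rho>"
  shows "measure_pmf.prob (random_signed_lift n (complete_bigraph d c))
      {S. (1 + \<rho>)\<^sup>2 / (2 * real ((c - 1) * d)) + \<epsilon> \<le> EIG (primal S)}
    \<le> real T / sqrt (real n) + real (c * n) *
      (real (Suc T) * (real d)\<^sup>2 + real (Suc r * Suc T * ((Suc r)\<^sup>2 + 1))) ^ (2 * (T div r) + 6)
      / (s ^ (2 * k) * \<gamma>\<^sup>2)"
    (is "_ \<le> _ + ?\<delta>")
proof -
  let ?K = "complete_bigraph d c" and ?A = "{S. (1 + \<rho>)\<^sup>2 / (2 * real ((c - 1) * d)) + \<epsilon> \<le> EIG (primal S)}"
  let ?B = "{H. \<not> sparse_upto T (4 * r) (bg_edges H)}"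
  have n0: "0 < n" using n T by simp
  have \<rho>2: "\<rho>\<^sup>2 = (real c - 1) * (real d - 1)"
    using cd by (simp add: \<rho>_def power_mult_distrib)
  have \<delta>0: "0 \<le> ?\<delta>" using s by (intro divide_nonneg_nonneg mult_nonneg_nonneg) auto
  have "measure_pmf.prob (random_signed_lift n ?K) ?A \<le> measure_pmf.prob (random_lift n ?K) ?B + ?\<delta>"
    unfolding random_signed_lift_def
  proof (rule prob_bind_pmf_le[OF _ \<delta>0])
    fix H assume H: "H \<in> set_pmf (random_lift n ?K)" "H \<notin> ?B"
    obtain \<pi> where \<pi>: "H = nlift n ?K \<pi>" "\<pi> \<in> lift_perms n ?K"
      using H by (auto simp: set_random_lift)
    interpret biregular_graph H c d by unfold_locales (simp add: \<pi> biregular_nlift)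
    let ?bad = "{\<xi>. \<exists>f \<mu>. signed_eigenfunction H c d \<xi> f \<mu> \<and>
      (\<exists>i\<in>set (bg_variables H). f i \<noteq> 0) \<and> (s + 1 / s) * \<rho> \<le> (real c - 1) + (real d - 1) - \<mu>}"
    have "measure_pmf.prob (map_pmf (\<lambda>\<xi>. (H, \<xi>)) (random_signing H)) ?A =
        measure_pmf.prob (random_signing H) ({\<xi>. (H, \<xi>) \<in> ?A} \<inter> set_pmf (random_signing H))"
      by (simp add: vimage_def measure_Int_set_pmf)
    also have "\<dots> \<le> measure_pmf.prob (random_signing H) ?bad"
    proof (intro measure_pmf.finite_measure_mono subsetI)
      fix \<xi> assume \<xi>: "\<xi> \<in> {\<xi>. (H, \<xi>) \<in> ?A} \<inter> set_pmf (random_signing H)"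
      have "(H, \<xi>) \<in> set_pmf (random_signed_lift n ?K)"
        using H(1) \<xi> by (auto simp: random_signed_lift_def)
      note sb = set_random_signed_lift[OF this]
      let ?\<kappa> = "2 * real ((c - 1) * d)"
      have "((1 + \<rho>)\<^sup>2 + ?\<kappa> * \<epsilon>) / ?\<kappa> \<le> EIG (primal (H, \<xi>))"
        using \<xi> cd by (simp add: add_divide_distrib)
      then obtain f \<mu> where f: "signed_eigenfunction H c d \<xi> f \<mu>" "\<exists>i\<in>set (bg_variables H). f i \<noteq> 0"
        "(1 + \<rho>)\<^sup>2 + ?\<kappa> * \<epsilon> \<le> real c * real d - \<mu>"
        using EIG_large_imp_eigenfunction[OF sb n0 cd(1), of "(1 + \<rho>)\<^sup>2 + ?\<kappa> * \<epsilon>"] cd by auto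
      have "(1 + \<rho>)\<^sup>2 = 1 + 2 * \<rho> + (real c - 1) * (real d - 1)"
        using \<rho>2 by (simp add: power2_eq_square algebra_simps)
      then have "(s + 1 / s) * \<rho> \<le> (real c - 1) + (real d - 1) - \<mu>"
        using f(3) s\<epsilon> by (simp add: algebra_simps)
      then show "\<xi> \<in> ?bad" using f by blast
    qed simp
    also have "\<dots> \<le> ?\<delta>"
    proof -
      have "length (bg_variables H) = c * n" using biregular_nlift(2)[OF \<pi>(2)] \<pi>(1) by simp
      then show ?thesis using bad_signing_prob[OF cd s r T] H(2) unfolding \<gamma>_def \<rho>_def by simp
    qed
    finally show "measure_pmf.prob (map_pmf (\<lambda>\<xi>. (H, \<xi>)) (random_signing H)) ?A \<le> ?\<delta>" .
  qed
  moreover have "measure_pmf.prob (random_lift n ?K) ?B \<le> real T / sqrt (real n)"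
    using n0 n r big T cd by (intro random_lift_sparse) auto
  ultimately show ?thesis by linarith
qed


text \<open>Here \<open>x\<close> stands for \<open>ln n\<close>. The exponent is
  \<open>x + O(x powr (3 / 2) * ln x) - 2 * (x\<^sup>2 - 1) * L\<close>, and the quadratic term wins
  for every \<open>L > 0\<close>.\<close>

lemma tail_limit:
  fixes A L C :: real
  assumes "0 < A" "0 < L"
  shows "((\<lambda>x. 4 * (x + 1)\<^sup>2 / exp (x / 2) + C * exp (x +
     (8 * (x + 1)\<^sup>2 / (sqrt x - 1) + 6) * ln (A * (4 * (x + 1)\<^sup>2 + 1) ^ 4) - 2 * (x\<^sup>2 - 1) * L)) \<longlongrightarrow> 0) at_top"
  using assms by real_asymp

text \<open>The walk length is chosen of order \<open>(ln n)\<^sup>2\<close>, the length of stale pieces of order \<open>sqrt (ln n)\<close>.\<close>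

lemma EIG_tail_tendsto:
  fixes \<epsilon> :: real and c d :: nat
  assumes cd: "2 \<le> c" "c \<le> d" "3 \<le> d" and \<epsilon>: "0 < \<epsilon>"
  defines "\<rho> \<equiv> sqrt (real c - 1) * sqrt (real d - 1)"
  shows "(\<lambda>n. measure_pmf.prob (random_signed_lift n (complete_bigraph d c))
      {S. (1 + \<rho>)\<^sup>2 / (2 * real ((c - 1) * d)) + \<epsilon> \<le> EIG (primal S)}) \<longlonglongrightarrow> 0"
proof -
  define \<kappa> where "\<kappa> = real ((c - 1) * d)"
  have \<kappa>: "0 < \<kappa>" using cd by (simp add: \<kappa>_def)
  have \<rho>: "0 < \<rho>" using cd by (simp add: \<rho>_def)
  \<comment> \<open>Chosen so that
    \<open>\<delta>\<^sup>2 * \<rho> = 2 * \<kappa> * \<epsilon>\<close>; with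
    \<open>s = 1 + \<delta>\<close>, \<open>s + 1 / s = 2 + \<delta>\<^sup>2 / s\<close> is at most
    \<open>2 + \<delta>\<^sup>2\<close>.\<close>
  define \<delta> where "\<delta> = sqrt (2 * \<kappa> * \<epsilon> / \<rho>)"
  define s where "s = 1 + \<delta>"
  have \<delta>: "0 < \<delta>" "\<delta>\<^sup>2 = 2 * \<kappa> * \<epsilon> / \<rho>" using \<kappa> \<rho> \<epsilon> by (simp_all add: \<delta>_def)
  have s: "1 < s" using \<delta> by (simp add: s_def)
  have s\<epsilon>: "(s + 1 / s) * \<rho> \<le> 2 * \<rho> + 2 * \<kappa> * \<epsilon>"
  proof -
    have "s + 1 / s = 2 + \<delta>\<^sup>2 / s" using s by (simp add: s_def field_simps power2_eq_square)
    also have "\<dots> \<le> 2 + \<delta>\<^sup>2" using s mult_right_mono[of 1 s "\<delta>\<^sup>2"] by (simp add: field_simps)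
    finally have "(s + 1 / s) * \<rho> \<le> (2 + \<delta>\<^sup>2) * \<rho>" using \<rho> by (intro mult_right_mono) auto
    then show ?thesis using \<delta>(2) \<rho> by (simp add: algebra_simps)
  qed
  define \<gamma> where "\<gamma> = s - 1 / ((real d - 1) * s) - (real c - 2) / \<rho>"
  define A where "A = (real d)\<^sup>2 + 2"
  define B where "B = 2 * real (d + c)"
  define C where "C = real c / \<gamma>\<^sup>2"
  define Q where "Q x = A * (4 * (x + 1)\<^sup>2 + 1) ^ 4" for x :: real
  define P where "P x = 8 * (x + 1)\<^sup>2 / (sqrt x - 1) + 6" for x :: real
  define G where "G x = 4 * (x + 1)\<^sup>2 / exp (x / 2) + C * exp (x + P x * ln (Q x) - 2 * (x\<^sup>2 - 1) * ln s)" for x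
  have B: "0 < B" using cd by (simp add: B_def)
  have G: "(G \<longlongrightarrow> 0) at_top" unfolding G_def P_def Q_def
    using tail_limit[of A "ln s" C] s by (simp add: A_def add_nonneg_pos)
  \<comment> \<open>With \<open>x = ln n\<close>, the three conditions serve in turn for
    \<open>0 < r\<close>, for \<open>2 * T \<le> n\<close>, and for the hypothesis
    \<open>big\<close> of the union bound.\<close>
  have "\<forall>\<^sub>F x in at_top. 1 < x \<and> 8 * (x + 1)\<^sup>2 \<le> exp x \<and> 8 * sqrt x * ln (B * (4 * (x + 1)\<^sup>2)\<^sup>2) \<le> x"
    using B by (intro eventually_conj eventually_gt_at_top; real_asymp)
  then have "\<forall>\<^sub>F n in sequentially. 1 < ln (real n) \<and> 8 * (ln (real n) + 1)\<^sup>2 \<le> exp (ln (real n)) \<and>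
      8 * sqrt (ln (real n)) * ln (B * (4 * (ln (real n) + 1)\<^sup>2)\<^sup>2) \<le> ln (real n)"
    by (rule eventually_compose_filterlim) (intro filterlim_compose[OF ln_at_top] filterlim_real_sequentially)
  then have ev: "\<forall>\<^sub>F n in sequentially. measure_pmf.prob (random_signed_lift n (complete_bigraph d c))
      {S. (1 + \<rho>)\<^sup>2 / (2 * real ((c - 1) * d)) + \<epsilon> \<le> EIG (primal S)} \<le> G (ln (real n))"
  proof (rule eventually_mono)
    fix n :: nat
    define x where "x = ln (real n)"
    assume "1 < ln (real n) \<and> 8 * (ln (real n) + 1)\<^sup>2 \<le> exp (ln (real n)) \<and>
      8 * sqrt (ln (real n)) * ln (B * (4 * (ln (real n) + 1)\<^sup>2)\<^sup>2) \<le> ln (real n)"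
    then have x1: "1 < x" and x2: "8 * (x + 1)\<^sup>2 \<le> exp x" and x3: "8 * sqrt x * ln (B * (4 * (x + 1)\<^sup>2)\<^sup>2) \<le> x"
      by (auto simp: x_def)
    have n0: "0 < n" using x1 by (intro gr0I) (auto simp: x_def)
    have en: "exp x = real n" using n0 by (simp add: x_def)
    define r where "r = nat \<lfloor>sqrt x\<rfloor>"
    define l where "l = (nat \<lceil>x\<rceil>)\<^sup>2"
    define T where "T = 4 * l"
    define k where "k = l - 1"
    have sx: "1 < sqrt x" using x1 by simp
    have r_le: "real r \<le> sqrt x" and r_ge: "sqrt x - 1 < real r" and r0: "0 < r"
      using sx by (auto simp: r_def le_floor_iff)
    have "real (nat \<lceil>x\<rceil>) = real_of_int \<lceil>x\<rceil>" using x1 by (simp add: of_nat_nat)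
    then have cx: "x \<le> real (nat \<lceil>x\<rceil>)" "real (nat \<lceil>x\<rceil>) \<le> x + 1" by linarith+
    have l_ge: "x\<^sup>2 \<le> real l" and l_le: "real l \<le> (x + 1)\<^sup>2"
      unfolding l_def of_nat_power using cx x1 by (auto intro!: power_mono)
    have xx: "1 < x\<^sup>2" using x1 by (simp add: one_less_power)
    have l0: "0 < l" using l_ge xx by (intro gr0I) auto
    have Tk: "T = 4 * Suc k" using l0 by (simp add: T_def k_def)
    have T_le: "real T \<le> 4 * (x + 1)\<^sup>2" using l_le by (simp add: T_def)
    have r4: "4 * r \<le> T"
    proof -
      have "sqrt x \<le> x" using x1 real_sqrt_le_mono[of x "x\<^sup>2"] by (simp add: power2_eq_square mult_left_le)
      moreover have "x \<le> x\<^sup>2" using x1 by (simp add: power2_eq_square)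
      ultimately have "real r \<le> real l" using r_le l_ge by linarith
      then show ?thesis by (simp add: T_def)
    qed
    have Tn: "2 * T \<le> n"
    proof -
      have "real (2 * T) \<le> real n" using T_le x2 en by simp
      then show ?thesis by (simp only: of_nat_le_iff)
    qed
    have T1: "1 \<le> T" using l0 by (simp add: T_def)
    have big: "(2 * (d + c) * T\<^sup>2) ^ (8 * r) \<le> n"
    proof -
      let ?M = "2 * (d + c) * T\<^sup>2"
      have M1: "1 \<le> real ?M" using T1 cd by (simp flip: of_nat_power of_nat_add of_nat_mult)
      have "real ?M = B * (real T)\<^sup>2" by (simp add: B_def)
      also have "\<dots> \<le> B * (4 * (x + 1)\<^sup>2)\<^sup>2" using B T_le by (intro mult_left_mono power_mono) auto
      finally have "ln (real ?M) \<le> ln (B * (4 * (x + 1)\<^sup>2)\<^sup>2)" using M1 by (intro ln_mono) auto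
      moreover have "0 \<le> ln (real ?M)" using M1 by (rule ln_ge_zero)
      ultimately have "8 * real r * ln (real ?M) \<le> 8 * sqrt x * ln (B * (4 * (x + 1)\<^sup>2)\<^sup>2)"
        using r_le x1 by (intro mult_mono) auto
      then have "real (8 * r) * ln (real ?M) \<le> x" using x3 by simp
      then have "exp (real (8 * r) * ln (real ?M)) \<le> real n" using en by (metis exp_le_cancel_iff)
      moreover have "exp (real (8 * r) * ln (real ?M)) = real ?M ^ (8 * r)"
        using M1 by (subst exp_of_nat_mult) simp
      ultimately have "real (?M ^ (8 * r)) \<le> real n" by (simp only: of_nat_power)
      then show ?thesis by (simp only: of_nat_le_iff)
    qed
    define q where "q = real (Suc T) * (real d)\<^sup>2 + real (Suc r * Suc T * ((Suc r)\<^sup>2 + 1))"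
    let ?P = "2 * (T div r) + 6"
    \<comment> \<open>Both \<open>Suc r\<close> and \<open>Suc T\<close> are at most
      \<open>t\<close>, so the cost of a piece is at most
      \<open>((real d)\<^sup>2 + 2) * t ^ 4\<close>; this explains \<open>A\<close>.\<close>
    have Q_le: "q \<le> Q x"
    proof -
      define t where "t = real (Suc T)"
      have t1: "1 \<le> t" by (simp add: t_def)
      have rt: "real (Suc r) \<le> t" using r4 by (simp add: t_def)
      have tp: "t \<le> t ^ 4" using power_increasing[of 1 4 t] t1 by simp
      have "real (Suc r * Suc T * ((Suc r)\<^sup>2 + 1)) = real (Suc r) * t * ((real (Suc r))\<^sup>2 + 1)"
        by (simp only: t_def of_nat_mult of_nat_add of_nat_power of_nat_1)
      also have "\<dots> \<le> t * t * (t\<^sup>2 + t\<^sup>2)"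
        using rt t1 by (intro mult_mono add_mono power_mono) (auto simp: one_le_power)
      also have "\<dots> = 2 * t ^ 4" by (simp add: power2_eq_square power4_eq_xxxx)
      finally have "q \<le> t ^ 4 * (real d)\<^sup>2 + 2 * t ^ 4"
        using tp unfolding q_def t_def[symmetric] by (intro add_mono mult_right_mono) auto
      also have "\<dots> = A * t ^ 4" by (simp add: A_def algebra_simps)
      also have "\<dots> \<le> Q x" unfolding Q_def
        using T_le t1 by (intro mult_left_mono power_mono) (auto simp: A_def t_def)
      finally show ?thesis .
    qed
    have Q1: "1 \<le> q"
    proof -
      have "1 * 1 \<le> real (Suc T) * (real d)\<^sup>2" using cd by (intro mult_mono one_le_power) auto
      then show ?thesis unfolding q_def by (simp add: add_increasing2)
    qed
    have P_le: "real ?P \<le> P x"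
    proof -
      have "real (T div r) \<le> real T / real r" by (rule of_nat_div_le_of_nat)
      also have "\<dots> \<le> 4 * (x + 1)\<^sup>2 / (sqrt x - 1)" using T_le r_ge sx by (intro frac_le) auto
      finally show ?thesis by (simp add: P_def)
    qed
    have QP: "q ^ ?P \<le> exp (P x * ln (Q x))"
    proof -
      have Q0: "0 < q" using Q1 by linarith
      have "q ^ ?P = exp (real ?P * ln q)" by (simp only: exp_of_nat_mult exp_ln[OF Q0])
      also have "real ?P * ln q \<le> P x * ln (Q x)"
        using P_le Q_le Q1 by (intro mult_mono ln_mono ln_ge_zero) auto
      finally show ?thesis by simp
    qed
    have sk: "exp (2 * (x\<^sup>2 - 1) * ln s) \<le> s ^ (2 * k)"
    proof -
      have "x\<^sup>2 - 1 \<le> real k" using l_ge l0 by (simp add: k_def of_nat_diff)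
      then have "2 * (x\<^sup>2 - 1) * ln s \<le> real (2 * k) * ln s" using s by (intro mult_right_mono) auto
      then have "exp (2 * (x\<^sup>2 - 1) * ln s) \<le> exp (real (2 * k) * ln s)" by simp
      also have "\<dots> = s ^ (2 * k)" using s by (subst exp_of_nat_mult) simp
      finally show ?thesis .
    qed
    have "measure_pmf.prob (random_signed_lift n (complete_bigraph d c))
        {S. (1 + \<rho>)\<^sup>2 / (2 * real ((c - 1) * d)) + \<epsilon> \<le> EIG (primal S)}
      \<le> real T / sqrt (real n) + real (c * n) * q ^ ?P / (s ^ (2 * k) * \<gamma>\<^sup>2)"
      unfolding \<rho>_def \<gamma>_def q_def
      by (rule EIG_tail_bound[OF cd s r0 r4 Tk Tn big]) (use s\<epsilon> in \<open>simp add: \<rho>_def \<kappa>_def\<close>)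
    also have "real T / sqrt (real n) \<le> 4 * (x + 1)\<^sup>2 / exp (x / 2)"
    proof -
      have "sqrt (real n) = exp (x / 2)" unfolding en[symmetric]
        by (rule real_sqrt_unique) (simp_all add: power2_eq_square exp_add[symmetric])
      then show ?thesis using T_le by (simp add: divide_right_mono)
    qed
    also have "real (c * n) * q ^ ?P / (s ^ (2 * k) * \<gamma>\<^sup>2)
        \<le> C * exp (x + P x * ln (Q x) - 2 * (x\<^sup>2 - 1) * ln s)"
    proof -
      have "real (c * n) * q ^ ?P / (s ^ (2 * k) * \<gamma>\<^sup>2) = C * (exp x * (q ^ ?P / s ^ (2 * k)))"
        by (simp add: C_def en mult_ac)
      also have "\<dots> \<le> C * (exp x * (exp (P x * ln (Q x)) / exp (2 * (x\<^sup>2 - 1) * ln s)))"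
        using QP sk Q1 by (intro mult_left_mono frac_le) (auto simp: C_def)
      also have "\<dots> = C * exp (x + P x * ln (Q x) - 2 * (x\<^sup>2 - 1) * ln s)"
        by (simp add: exp_add exp_diff)
      finally show ?thesis .
    qed
    finally show "measure_pmf.prob (random_signed_lift n (complete_bigraph d c))
        {S. (1 + \<rho>)\<^sup>2 / (2 * real ((c - 1) * d)) + \<epsilon> \<le> EIG (primal S)} \<le> G (ln (real n))"
      unfolding G_def x_def by simp
  qed
  have "((\<lambda>n. G (ln (real n))) \<longlongrightarrow> 0) sequentially"
    by (rule filterlim_compose[OF G]) (intro filterlim_compose[OF ln_at_top] filterlim_real_sequentially)
  then show ?thesis
    by (rule tendsto_sandwich[rotated 2, OF tendsto_const]) (use ev in auto)
qed

theorem theorem4p12: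
  fixes c d \<kappa> :: nat and \<rho>\<^sub>1 \<epsilon> :: real
    and S :: "nat \<Rightarrow> (nat \<times> nat, nat \<times> nat) signed_bigraph pmf"
    and I :: "nat \<Rightarrow> (nat \<times> nat) xor_instance pmf"
  assumes "2 \<le> c" and "c \<le> d" and "d \<noteq> 2" and "\<epsilon> > 0"
  defines "\<kappa> \<equiv> (c - 1) * d"
    and "\<rho>\<^sub>1 \<equiv> sqrt (real c - 1) * sqrt (real d - 1)"
    and "S \<equiv> \<lambda>n. random_signed_lift n (complete_bigraph d c)"
    and "I \<equiv> \<lambda>n. map_pmf primal (S n)"
  shows "(\<forall>n. \<forall>J\<in>set_pmf (I n).
            wf_xor_instance J
            \<and> (\<forall>v\<in>set (xor_variables J). xor_degree J v = \<kappa>)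
            \<and> length (xor_variables J) = c * n
            \<and> size (xor_constraints J) = (c choose 2) * d * n)
         \<and> (\<lambda>n. measure_pmf.prob (I n) {J. EIG J \<ge> (1 + \<rho>\<^sub>1)\<^sup>2 / (2 * real \<kappa>) + \<epsilon>}) \<in> o(\<lambda>_. 1)
         \<and> (c = 3 \<longrightarrow>
              (\<forall>n. \<forall>(H, \<xi>)\<in>set_pmf (S n).
                 biregular 3 d H \<and> length (bg_variables H) = 3 * n
                 \<and> (\<forall>e\<in>bg_edges H. \<xi> e \<in> {-1, 1}))
              \<and> (\<lambda>n. measure_pmf.prob (S n)
                   {T. EIG_NAE T \<ge> 9 / 8 - 3 / 8 * ((sqrt (real d - 1) - sqrt 2)\<^sup>2 / real d) + \<epsilon>})
                  \<in> o(\<lambda>_. 1))"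
proof (intro conjI impI)
  have cd: "2 \<le> c" "c \<le> d" "3 \<le> d" using assms(1-3) by auto
  have tail: "(\<lambda>n. measure_pmf.prob (S n) {T. (1 + \<rho>\<^sub>1)\<^sup>2 / (2 * real \<kappa>) + e \<le> EIG (primal T)}) \<in> o(\<lambda>_. 1)"
    if "0 < e" for e
    using EIG_tail_tendsto[OF cd that] unfolding S_def \<kappa>_def \<rho>\<^sub>1_def by (intro smalloI_tendsto) simp_all
  show "\<forall>n. \<forall>J\<in>set_pmf (I n).
            wf_xor_instance J
            \<and> (\<forall>v\<in>set (xor_variables J). xor_degree J v = \<kappa>)
            \<and> length (xor_variables J) = c * n
            \<and> size (xor_constraints J) = (c choose 2) * d * n"
  proof (intro allI ballI)
    fix n J assume "J \<in> set_pmf (I n)"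
    then obtain H \<xi> where H: "(H, \<xi>) \<in> set_pmf (random_signed_lift n (complete_bigraph d c))" "J = primal (H, \<xi>)"
      by (auto simp: I_def S_def)
    interpret signed_biregular H c d \<xi> by (rule set_random_signed_lift(1)[OF H(1)])
    show "wf_xor_instance J
            \<and> (\<forall>v\<in>set (xor_variables J). xor_degree J v = \<kappa>)
            \<and> length (xor_variables J) = c * n
            \<and> size (xor_constraints J) = (c choose 2) * d * n"
      using wf_J xor_degree_J set_random_signed_lift(2,3)[OF H(1)]
      by (simp add: H(2) xor_variables_J size_J \<kappa>_def)
  qed
  show "(\<lambda>n. measure_pmf.prob (I n) {J. EIG J \<ge> (1 + \<rho>\<^sub>1)\<^sup>2 / (2 * real \<kappa>) + \<epsilon>}) \<in> o(\<lambda>_. 1)"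
    using tail[OF assms(4)] by (simp add: I_def vimage_def)
  assume c3: "c = 3"
  show "\<forall>n. \<forall>(H, \<xi>)\<in>set_pmf (S n).
                 biregular 3 d H \<and> length (bg_variables H) = 3 * n
                 \<and> (\<forall>e\<in>bg_edges H. \<xi> e \<in> {-1, 1})"
  proof (intro allI ballI, clarify)
    fix n H \<xi> assume H: "(H, \<xi>) \<in> set_pmf (S n)"
    then have H': "(H, \<xi>) \<in> set_pmf (random_signed_lift n (complete_bigraph d c))" by (simp add: S_def)
    interpret signed_biregular H c d \<xi> by (rule set_random_signed_lift(1)[OF H'])
    show "biregular 3 d H \<and> length (bg_variables H) = 3 * n \<and> (\<forall>e\<in>bg_edges H. \<xi> e \<in> {-1, 1})"
      using breg signs set_random_signed_lift(2)[OF H'] c3 by blast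
  qed
  \<comment> \<open>For \<open>c = 3\<close>, \<open>\<kappa> = 2 * d\<close> and the cross term of
    the square is \<open>2 * \<rho>\<^sub>1\<close>; the stated bound is exactly
    \<open>3 / 2\<close> times the general one.\<close>
  have "9 / 8 - 3 / 8 * ((sqrt (real d - 1) - sqrt 2)\<^sup>2 / real d) =
      3 / 2 * ((1 + \<rho>\<^sub>1)\<^sup>2 / (2 * real \<kappa>))"
  proof -
    have r2: "sqrt 2 * sqrt 2 = (2::real)" "sqrt (real d - 1) * sqrt (real d - 1) = real d - 1"
      using cd by simp_all
    have 1: "(sqrt (real d - 1) - sqrt 2)\<^sup>2 = real d + 1 - 2 * \<rho>\<^sub>1"
      using r2 c3 by (simp add: \<rho>\<^sub>1_def power2_eq_square algebra_simps)
    have "\<rho>\<^sub>1\<^sup>2 = 2 * (real d - 1)"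
      using cd c3 by (simp add: \<rho>\<^sub>1_def power_mult_distrib)
    then have 2: "(1 + \<rho>\<^sub>1)\<^sup>2 = 2 * real d - 1 + 2 * \<rho>\<^sub>1"
      by (simp add: power2_eq_square algebra_simps)
    have 3: "real \<kappa> = 2 * real d" using c3 by (simp add: \<kappa>_def)
    show ?thesis unfolding 1 2 3 using cd by (simp add: field_simps)
  qed
  \<comment> \<open>Undoing the factor \<open>3 / 2\<close> shrinks the slack to
    \<open>2 / 3 * \<epsilon>\<close>, which is still a fixed positive number.\<close>
  then have "{T :: (nat \<times> nat, nat \<times> nat) signed_bigraph.
        EIG_NAE T \<ge> 9 / 8 - 3 / 8 * ((sqrt (real d - 1) - sqrt 2)\<^sup>2 / real d) + \<epsilon>} =
      {T. (1 + \<rho>\<^sub>1)\<^sup>2 / (2 * real \<kappa>) + 2 / 3 * \<epsilon> \<le> EIG (primal T)}"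
    by (auto simp: EIG_NAE_def)
  then show "(\<lambda>n. measure_pmf.prob (S n)
       {T. EIG_NAE T \<ge> 9 / 8 - 3 / 8 * ((sqrt (real d - 1) - sqrt 2)\<^sup>2 / real d) + \<epsilon>}) \<in> o(\<lambda>_. 1)"
    using tail[of "2 / 3 * \<epsilon>"] assms(4) by simp
qed

end
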